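(* Let $\mathsf h$ be an arbitrary complex number. The Jordanian quantum algebra $\mathcal U_{\mathsf h}(sl(3))$ over $\mathbb C$ described in the context admits a Hopf structure with coproduct $\Delta$, antipode $S$ and counit $\epsilon$ determined by $$\Delta(E_1)=E_1\otimes1+T\otimes E_1,\quad \Delta(E_2)=E_2\otimes1+T\otimes E_2,$$ $$\Delta(T)=T\otimes T,\quad \Delta(T^{-1})=T^{-1}\otimes T^{-1},$$ $$\Delta(F_1)=F_1\otimes1+T^{-1}\otimes F_1+\mathsf hH_3\otimes E_2=F_1\otimes1+T^{-1}\otimes F_1+T(H_1+H_2)\otimes T^{-1}[F_1,T],$$ $$\Delta(F_2)=F_2\otimes1+T^{-1}\otimes F_2-\mathsf hH_3\otimes E_1=F_2\otimes1+T^{-1}\otimes F_2+T(H_1+H_2)\otimes T^{-1}[F_2,T],$$ $$\Delta(F_3)=F_3\otimes T+T^{-1}\otimes F_3,$$ $$\Delta(H_i)=H_i\otimes1+1\otimes H_i-\tfrac12(1-T^{-2})\otimes T^{-1}H_3=H_i\otimes1+1\otimes H_i-\tfrac12(1-T^{-2})\otimes(H_1+H_2)\quad(i=1,2),$$ $$\Delta(H_3)=H_3\otimes T+T^{-1}\otimes H_3,$$ $$S(E_1)=-T^{-1}E_1,\quad S(E_2)=-T^{-1}E_2,\quad S(T)=T^{-1},\quad S(T^{-1})=T,$$ $$S(F_1)=-TF_1+\mathsf hTH_3T^{-1}E_2=-TF_1+T^2(H_1+H_2)T^{-2}[F_1,T],$$ $$S(F_2)=-TF_2-\mathsf hTH_3T^{-1}E_1=-TF_2+T^2(H_1+H_2)T^{-2}[F_2,T],$$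 $$S(F_3)=-TF_3T^{-1},$$ $$S(H_i)=-H_i-\tfrac12(T-T^{-1})H_3=-H_i-\tfrac12(T^2-1)(H_1+H_2)\quad(i=1,2),$$ $$S(H_3)=-TH_3T^{-1},$$ $$\epsilon(a)=0\ \text{ for all } a\in\{H_1,H_2,H_3,E_1,E_2,F_1,F_2,F_3\},\qquad \epsilon(T)=\epsilon(T^{-1})=1.$$
   Context: Here $[a,b]=ab-ba$. The Jordanian algebra $\mathcal U_{\mathsf h}(sl(3))$ is the associative algebra over $\mathbb C$ generated by $H_1,H_2,H_3,E_1,E_2,T,T^{-1},F_1,F_2,F_3$ with the relations $$TT^{-1}=T^{-1}T=1,\quad [H_3,T]=T^2-1,\quad [H_3,T^{-1}]=T^{-2}-1,$$ $$[T,F_3]=\tfrac{\mathsf h}{2}(H_3T+TH_3),\quad [T^{-1},F_3]=-\tfrac{\mathsf h}{2}(H_3T^{-1}+T^{-1}H_3),$$ $$[H_3,F_3]=-\tfrac12(TF_3+F_3T+T^{-1}F_3+F_3T^{-1}),$$ $$[H_1,H_2]=0,\quad [H_1,T^{-1}H_3]=[H_2,T^{-1}H_3]=0,$$ $$[H_1,E_1]=2E_1,\quad [H_2,E_2]=2E_2,\quad [H_1,E_2]=-E_2,\quad [H_2,E_1]=-E_1,$$ $$[T^{-1}H_3,E_1]=E_1,\quad [T^{-1}H_3,E_2]=E_2,$$ $$[H_1,F_1]=-2F_1+\mathsf hE_2T^{-1}H_3,\quad [H_2,F_2]=-2F_2-\mathsf hE_1T^{-1}H_3,$$ $$[H_1,F_2]=F_2-\mathsf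 hE_1T^{-1}H_3,\quad [H_2,F_1]=F_1+\mathsf hE_2T^{-1}H_3,$$ $$[TH_3,F_1]=-T^2F_1,\quad [TH_3,F_2]=-T^2F_2,$$ $$[T^{-1}E_1,F_1]=\tfrac12(T+T^{-1})H_1+\tfrac12(T-T^{-1})H_2,$$ $$[T^{-1}E_2,F_2]=\tfrac12(T+T^{-1})H_2+\tfrac12(T-T^{-1})H_1,$$ $$[T^{-1}E_1,F_2]=0,\quad [T^{-1}E_2,F_1]=0,\quad [E_1,E_2]=\tfrac{1}{2\mathsf h}(T^2-1),$$ $$[TF_2,TF_1]=T\bigl(F_3-\tfrac{\mathsf h}{2}H_3TH_3-\tfrac{\mathsf h}{8}(T-T^{-1})\bigr),$$ $$[TH_i,T]=\tfrac12(T^2-1),\quad [TH_i,T^{-1}]=\tfrac12(T^{-2}-1)\quad(i=1,2),$$ $$[H_i,F_3]=-\tfrac14T^{-1}(TF_3+F_3T+T^{-1}F_3+F_3T^{-1})-\tfrac{\mathsf h}{4}T^{-1}H_3^2-\tfrac{\mathsf h}{4}H_3T^{-1}H_3\quad(i=1,2),$$ $$[E_1,T]=[E_1,T^{-1}]=[E_2,T]=[E_2,T^{-1}]=0,$$ $$[F_1,T]=\mathsf hTE_2,\quad [F_1,T^{-1}]=-\mathsf hT^{-1}E_2,\quad [F_2,T]=-\mathsf hTE_1,\quad [F_2,T^{-1}]=\mathsf hT^{-1}E_1,$$ $$[E_1,F_3]=-\tfrac12(TF_2+F_2T),\quad [E_2,F_3]=\tfrac12(TF_1+F_1T),$$ $$[F_1,F_3]=\mathsf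 hTF_1-\mathsf hE_2F_3+\tfrac{\mathsf h^2}{4}TE_2,\quad [F_2,F_3]=\mathsf hTF_2+\mathsf hE_1F_3-\tfrac{\mathsf h^2}{4}TE_1.$$ A particular realization (nonlinear map; other maps may also be considered) in terms of the classical Chevalley generators $h_i,e_i,f_i$ of $sl(3)$, with $h_3=h_1+h_2$, $e_3=e_1e_2-e_2e_1$, $f_3=f_2f_1-f_1f_2$, is $T^{\pm1}=\pm\mathsf he_3+\sqrt{1+\mathsf h^2e_3^2}$, $H_3=\sqrt{1+\mathsf h^2e_3^2}\,h_3$, $F_3=f_3-\frac{\mathsf h^2}{4}e_3(h_3^2-1)$, $E_i=T^{1/2}e_i$, $F_1=T^{-1/2}(f_1+\frac{\mathsf h}{2}e_2Th_3)$, $F_2=T^{-1/2}(f_2-\frac{\mathsf h}{2}e_1Th_3)$, $H_i=h_i-\frac{\mathsf h}{2}e_3T^{-1}h_3$ ($i=1,2$); in it $T^{-1}H_3=H_1+H_2$.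
   Formalization: The relation [E1,E2]=(T²-1)/(2h), undefined at h=0, is read as 2h[E1,E2]=T²-1; the claim is proved both with the printed coefficient h of TF_i in [F_i,F3], which collapses the algebra for h≠0, and with the consistent coefficient h/2. *)

theory Defs
  imports Complex_Main "HOL-Algebra.QuotRing" "HOL-Algebra.Module" "HOL-Library.Poly_Mapping"
begin

section \<open>Associative unital algebras over the complex numbers\<close>

definition complex_alg :: "(complex, complex) module" where
  "complex_alg = \<lparr>carrier = UNIV, mult = (*), one = 1, zero = 0, add = (+), smult = (*)\<rparr>"

locale complex_algebra =
  fixes A :: "(complex, 'a) module" (structure)
  assumes ring: "ring A"
    and module: "Module.module complex_alg A"
    and smult_mult_left:
      "\<lbrakk>x \<in> carrier A; y \<in> carrier A\<rbrakk> \<Longrightarrow> (c \<odot> x) \<otimes> y = c \<odot> (x \<otimes> y)"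
    and smult_mult_right:
      "\<lbrakk>x \<in> carrier A; y \<in> carrier A\<rbrakk> \<Longrightarrow> x \<otimes> (c \<odot> y) = c \<odot> (x \<otimes> y)"

definition linear_maps :: "(complex, 'a) module \<Rightarrow> (complex, 'b) module \<Rightarrow> ('a \<Rightarrow> 'b) set" where
  "linear_maps A B =
     {f \<in> carrier A \<rightarrow> carrier B.
        (\<forall>x\<in>carrier A. \<forall>y\<in>carrier A. f (x \<oplus>\<^bsub>A\<^esub> y) = f x \<oplus>\<^bsub>B\<^esub> f y) \<and>
        (\<forall>c. \<forall>x\<in>carrier A. f (c \<odot>\<^bsub>A\<^esub> x) = c \<odot>\<^bsub>B\<^esub> f x)}"

definition algebra_homs :: "(complex, 'a) module \<Rightarrow> (complex, 'b) module \<Rightarrow> ('a \<Rightarrow> 'b) set" where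
  "algebra_homs A B = ring_hom A B \<inter> linear_maps A B"

definition quotient_algebra :: "(complex, 'a) module \<Rightarrow> 'a set \<Rightarrow> (complex, 'a set) module" where
  "quotient_algebra A I =
     \<lparr>carrier = carrier (A Quot I), mult = mult (A Quot I), one = one (A Quot I),
      zero = zero (A Quot I), add = add (A Quot I),
      smult = (\<lambda>c X. \<Union>x\<in>X. I +>\<^bsub>A\<^esub> (c \<odot>\<^bsub>A\<^esub> x))\<rparr>"

abbreviation pm_scale :: "complex \<Rightarrow> ('m \<Rightarrow>\<^sub>0 complex) \<Rightarrow> ('m \<Rightarrow>\<^sub>0 complex)" where
  "pm_scale c \<equiv> Poly_Mapping.map ((*) c)"

definition monoid_algebra :: "('m, 'k) monoid_scheme \<Rightarrow> (complex, 'm \<Rightarrow>\<^sub>0 complex) module" where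
  "monoid_algebra M =
     \<lparr>carrier = {f. Poly_Mapping.keys f \<subseteq> carrier M},
      mult = (\<lambda>f g. \<Sum>p\<in>Poly_Mapping.keys f. \<Sum>q\<in>Poly_Mapping.keys g.
                Poly_Mapping.single (p \<otimes>\<^bsub>M\<^esub> q)
                  (Poly_Mapping.lookup f p * Poly_Mapping.lookup g q)),
      one = Poly_Mapping.single \<one>\<^bsub>M\<^esub> 1, zero = 0, add = (+), smult = pm_scale\<rparr>"


section \<open>Algebras given by generators and relations\<close>

definition free_monoid :: "'g list monoid" where
  "free_monoid = \<lparr>carrier = UNIV, mult = (@), one = []\<rparr>"

definition free_algebra :: "(complex, 'g list \<Rightarrow>\<^sub>0 complex) module" where
  "free_algebra = monoid_algebra free_monoid"

definition free_gen :: "'g \<Rightarrow> ('g list \<Rightarrow>\<^sub>0 complex)" where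
  "free_gen g = Poly_Mapping.single [g] 1"

text \<open>A pair \<open>(l, r)\<close> in \<open>R\<close> stands for the relation \<open>l = r\<close>.
  HOL-Algebra's ideals, and hence \<open>Idl\<close>, are two-sided.\<close>

definition relation_ideal ::
  "(('g list \<Rightarrow>\<^sub>0 complex) \<times> ('g list \<Rightarrow>\<^sub>0 complex)) set \<Rightarrow> ('g list \<Rightarrow>\<^sub>0 complex) set" where
  "relation_ideal R = Idl\<^bsub>free_algebra\<^esub> {l \<ominus>\<^bsub>free_algebra\<^esub> r | l r. (l, r) \<in> R}"

definition presented_algebra ::
  "(('g list \<Rightarrow>\<^sub>0 complex) \<times> ('g list \<Rightarrow>\<^sub>0 complex)) set
     \<Rightarrow> (complex, ('g list \<Rightarrow>\<^sub>0 complex) set) module" where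
  "presented_algebra R = quotient_algebra free_algebra (relation_ideal R)"

definition presented_gen ::
  "(('g list \<Rightarrow>\<^sub>0 complex) \<times> ('g list \<Rightarrow>\<^sub>0 complex)) set
     \<Rightarrow> 'g \<Rightarrow> ('g list \<Rightarrow>\<^sub>0 complex) set" where
  "presented_gen R g = relation_ideal R +>\<^bsub>free_algebra\<^esub> free_gen g"


section \<open>Tensor products of algebras\<close>

text \<open>\<open>A \<otimes> B\<close> is the free vector space on \<open>carrier A \<times> carrier B\<close> modulo the span of the
  bilinearity relators. The product \<open>(a \<otimes> b) (a' \<otimes> b') = a a' \<otimes> b b'\<close> is the one induced from the
  monoid algebra of \<open>A \<times>\<times> B\<close>, in which that span is a two-sided ideal: a relator times a basis pair
  is again a relator.\<close>

definition bilinear_relators ::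
  "(complex, 'a) module \<Rightarrow> (complex, 'b) module \<Rightarrow> ('a \<times> 'b \<Rightarrow>\<^sub>0 complex) set" where
  "bilinear_relators A B =
     {Poly_Mapping.single (a \<oplus>\<^bsub>A\<^esub> a', b) 1 - Poly_Mapping.single (a, b) 1
        - Poly_Mapping.single (a', b) 1
      | a a' b. a \<in> carrier A \<and> a' \<in> carrier A \<and> b \<in> carrier B} \<union>
     {Poly_Mapping.single (a, b \<oplus>\<^bsub>B\<^esub> b') 1 - Poly_Mapping.single (a, b) 1
        - Poly_Mapping.single (a, b') 1
      | a b b'. a \<in> carrier A \<and> b \<in> carrier B \<and> b' \<in> carrier B} \<union>
     {Poly_Mapping.single (c \<odot>\<^bsub>A\<^esub> a, b) 1 - Poly_Mapping.single (a, b) c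
      | c a b. a \<in> carrier A \<and> b \<in> carrier B} \<union>
     {Poly_Mapping.single (a, c \<odot>\<^bsub>B\<^esub> b) 1 - Poly_Mapping.single (a, b) c
      | c a b. a \<in> carrier A \<and> b \<in> carrier B}"

definition bilinear_span ::
  "(complex, 'a) module \<Rightarrow> (complex, 'b) module \<Rightarrow> ('a \<times> 'b \<Rightarrow>\<^sub>0 complex) set" where
  "bilinear_span A B = Modules.module.span pm_scale (bilinear_relators A B)"

definition tensor_algebra ::
  "(complex, 'a) module \<Rightarrow> (complex, 'b) module \<Rightarrow> (complex, ('a \<times> 'b \<Rightarrow>\<^sub>0 complex) set) module"
  where
  "tensor_algebra A B = quotient_algebra (monoid_algebra (A \<times>\<times> B)) (bilinear_span A B)"

definition pure_tensor ::
  "(complex, 'a) module \<Rightarrow> (complex, 'b) module \<Rightarrow> 'a \<Rightarrow> 'b \<Rightarrow> ('a \<times> 'b \<Rightarrow>\<^sub>0 complex) set" where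
  "pure_tensor A B a b =
     bilinear_span A B +>\<^bsub>monoid_algebra (A \<times>\<times> B)\<^esub> Poly_Mapping.single (a, b) 1"

text \<open>The linear map out of a tensor product, into \<open>C\<close>, with \<open>a \<otimes> b \<mapsto> \<phi> a b\<close>; for bilinear \<open>\<phi>\<close> the
  value does not depend on the representative that is chosen.\<close>

definition tensor_lift ::
  "(complex, 'c) module \<Rightarrow> ('a \<Rightarrow> 'b \<Rightarrow> 'c) \<Rightarrow> ('a \<times> 'b \<Rightarrow>\<^sub>0 complex) set \<Rightarrow> 'c" where
  "tensor_lift C \<phi> X =
     (let f = (SOME f. f \<in> X)
      in \<Oplus>\<^bsub>C\<^esub>p\<in>Poly_Mapping.keys f. Poly_Mapping.lookup f p \<odot>\<^bsub>C\<^esub> \<phi> (fst p) (snd p))"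

definition tensor_map ::
  "(complex, 'c) module \<Rightarrow> (complex, 'd) module \<Rightarrow> ('a \<Rightarrow> 'c) \<Rightarrow> ('b \<Rightarrow> 'd)
     \<Rightarrow> ('a \<times> 'b \<Rightarrow>\<^sub>0 complex) set \<Rightarrow> ('c \<times> 'd \<Rightarrow>\<^sub>0 complex) set" where
  "tensor_map C D f g = tensor_lift (tensor_algebra C D) (\<lambda>a b. pure_tensor C D (f a) (g b))"

text \<open>The canonical map \<open>(A \<otimes> A) \<otimes> A \<rightarrow> A \<otimes> (A \<otimes> A)\<close>.\<close>

definition tensor_assoc ::
  "(complex, 'a) module \<Rightarrow> (('a \<times> 'a \<Rightarrow>\<^sub>0 complex) set \<times> 'a \<Rightarrow>\<^sub>0 complex) set
     \<Rightarrow> ('a \<times> ('a \<times> 'a \<Rightarrow>\<^sub>0 complex) set \<Rightarrow>\<^sub>0 complex) set" where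
  "tensor_assoc A =
     (let AA = tensor_algebra A A; AAA = tensor_algebra A AA
      in tensor_lift AAA
           (\<lambda>t c. tensor_lift AAA (\<lambda>a b. pure_tensor A AA a (pure_tensor A A b c)) t))"


section \<open>Hopf algebras\<close>

locale hopf_algebra = complex_algebra A for A :: "(complex, 'a) module" (structure) +
  fixes \<Delta> :: "'a \<Rightarrow> ('a \<times> 'a \<Rightarrow>\<^sub>0 complex) set"
    and \<epsilon> :: "'a \<Rightarrow> complex"
    and S :: "'a \<Rightarrow> 'a"
  assumes comult_hom: "\<Delta> \<in> algebra_homs A (tensor_algebra A A)"
    and counit_hom: "\<epsilon> \<in> algebra_homs A complex_alg"
    and antipode_linear: "S \<in> linear_maps A A"
    and coassoc: "x \<in> carrier A \<Longrightarrow>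
      tensor_assoc A (tensor_map (tensor_algebra A A) A \<Delta> (\<lambda>b. b) (\<Delta> x)) =
      tensor_map A (tensor_algebra A A) (\<lambda>a. a) \<Delta> (\<Delta> x)"
    and counit_left: "x \<in> carrier A \<Longrightarrow> tensor_lift A (\<lambda>a b. \<epsilon> a \<odot> b) (\<Delta> x) = x"
    and counit_right: "x \<in> carrier A \<Longrightarrow> tensor_lift A (\<lambda>a b. \<epsilon> b \<odot> a) (\<Delta> x) = x"
    and antipode_left: "x \<in> carrier A \<Longrightarrow> tensor_lift A (\<lambda>a b. S a \<otimes> b) (\<Delta> x) = \<epsilon> x \<odot> \<one>"
    and antipode_right: "x \<in> carrier A \<Longrightarrow> tensor_lift A (\<lambda>a b. a \<otimes> S b) (\<Delta> x) = \<epsilon> x \<odot> \<one>"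


section \<open>The Jordanian algebra of sl(3)\<close>

definition commutator :: "('a, 'm) ring_scheme \<Rightarrow> 'a \<Rightarrow> 'a \<Rightarrow> 'a" (\<open>\<lbrakk>_,/ _\<rbrakk>\<index>\<close>) where
  "\<lbrakk>x, y\<rbrakk>\<^bsub>A\<^esub> = x \<otimes>\<^bsub>A\<^esub> y \<ominus>\<^bsub>A\<^esub> y \<otimes>\<^bsub>A\<^esub> x"

text \<open>\<open>T'\<close> stands for the inverse of \<open>T\<close>.

  The relation \<open>[E1, E2] = (T\<^sup>2 - 1) / (2 h)\<close> is written with its denominator cleared, so that it also
  makes sense for \<open>h = 0\<close>.

  \<open>\<kappa>\<close> is the coefficient of \<open>T F1\<close> in \<open>[F1, F3]\<close> and of \<open>T F2\<close> in \<open>[F2, F3]\<close>. The published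
  presentation has \<open>\<kappa> = h\<close>. For \<open>h \<noteq> 0\<close> that value forces \<open>E2 = 0\<close> (commute \<open>[F1, F3]\<close> with \<open>T\<close> and use
  the Jacobi identity), and the algebra collapses to the group algebra of a group of order two, so
  that the nonlinear map to \<open>sl(3)\<close> cannot exist. The other relations are compatible with
  \<open>\<kappa> = h / 2\<close>, and for \<open>h = 0\<close> both values agree.\<close>

definition jordanian_relations ::
  "(complex, 'a) module \<Rightarrow> complex \<Rightarrow> complex \<Rightarrow> 'a \<Rightarrow> 'a \<Rightarrow> 'a \<Rightarrow> 'a \<Rightarrow> 'a \<Rightarrow> 'a \<Rightarrow> 'a \<Rightarrow> 'a \<Rightarrow> 'a \<Rightarrow> 'a
     \<Rightarrow> ('a \<times> 'a) set"
  where
  "jordanian_relations A h \<kappa> H1 H2 H3 E1 E2 T T' F1 F2 F3 =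
   {(T \<otimes> T', \<one>), (T' \<otimes> T, \<one>),
    (\<lbrakk>H3, T\<rbrakk>, T \<otimes> T \<ominus> \<one>),
    (\<lbrakk>H3, T'\<rbrakk>, T' \<otimes> T' \<ominus> \<one>),
    (\<lbrakk>T, F3\<rbrakk>, (h/2) \<odot> (H3 \<otimes> T \<oplus> T \<otimes> H3)),
    (\<lbrakk>T', F3\<rbrakk>, (-h/2) \<odot> (H3 \<otimes> T' \<oplus> T' \<otimes> H3)),
    (\<lbrakk>H3, F3\<rbrakk>, (-1/2) \<odot> (T \<otimes> F3 \<oplus> F3 \<otimes> T \<oplus> T' \<otimes> F3 \<oplus> F3 \<otimes> T')),
    (\<lbrakk>H1, H2\<rbrakk>, \<zero>), (\<lbrakk>H1, T' \<otimes> H3\<rbrakk>, \<zero>), (\<lbrakk>H2, T' \<otimes> H3\<rbrakk>, \<zero>),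
    (\<lbrakk>H1, E1\<rbrakk>, 2 \<odot> E1), (\<lbrakk>H2, E2\<rbrakk>, 2 \<odot> E2), (\<lbrakk>H1, E2\<rbrakk>, \<ominus> E2), (\<lbrakk>H2, E1\<rbrakk>, \<ominus> E1),
    (\<lbrakk>T' \<otimes> H3, E1\<rbrakk>, E1), (\<lbrakk>T' \<otimes> H3, E2\<rbrakk>, E2),
    (\<lbrakk>H1, F1\<rbrakk>, (-2) \<odot> F1 \<oplus> h \<odot> (E2 \<otimes> T' \<otimes> H3)),
    (\<lbrakk>H2, F2\<rbrakk>, (-2) \<odot> F2 \<ominus> h \<odot> (E1 \<otimes> T' \<otimes> H3)),
    (\<lbrakk>H1, F2\<rbrakk>, F2 \<ominus> h \<odot> (E1 \<otimes> T' \<otimes> H3)),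
    (\<lbrakk>H2, F1\<rbrakk>, F1 \<oplus> h \<odot> (E2 \<otimes> T' \<otimes> H3)),
    (\<lbrakk>T \<otimes> H3, F1\<rbrakk>, \<ominus> (T \<otimes> T \<otimes> F1)), (\<lbrakk>T \<otimes> H3, F2\<rbrakk>, \<ominus> (T \<otimes> T \<otimes> F2)),
    (\<lbrakk>T' \<otimes> E1, F1\<rbrakk>, (1/2) \<odot> ((T \<oplus> T') \<otimes> H1) \<oplus> (1/2) \<odot> ((T \<ominus> T') \<otimes> H2)),
    (\<lbrakk>T' \<otimes> E2, F2\<rbrakk>, (1/2) \<odot> ((T \<oplus> T') \<otimes> H2) \<oplus> (1/2) \<odot> ((T \<ominus> T') \<otimes> H1)),
    (\<lbrakk>T' \<otimes> E1, F2\<rbrakk>, \<zero>), (\<lbrakk>T' \<otimes> E2, F1\<rbrakk>, \<zero>),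
    ((2*h) \<odot> \<lbrakk>E1, E2\<rbrakk>, T \<otimes> T \<ominus> \<one>),
    (\<lbrakk>T \<otimes> F2, T \<otimes> F1\<rbrakk>, T \<otimes> (F3 \<ominus> (h/2) \<odot> (H3 \<otimes> T \<otimes> H3) \<ominus> (h/8) \<odot> (T \<ominus> T'))),
    (\<lbrakk>T \<otimes> H1, T\<rbrakk>, (1/2) \<odot> (T \<otimes> T \<ominus> \<one>)),
    (\<lbrakk>T \<otimes> H2, T\<rbrakk>, (1/2) \<odot> (T \<otimes> T \<ominus> \<one>)),
    (\<lbrakk>T \<otimes> H1, T'\<rbrakk>, (1/2) \<odot> (T' \<otimes> T' \<ominus> \<one>)),
    (\<lbrakk>T \<otimes> H2, T'\<rbrakk>, (1/2) \<odot> (T' \<otimes> T' \<ominus> \<one>)),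
    (\<lbrakk>H1, F3\<rbrakk>,
       (-1/4) \<odot> (T' \<otimes> (T \<otimes> F3 \<oplus> F3 \<otimes> T \<oplus> T' \<otimes> F3 \<oplus> F3 \<otimes> T'))
       \<ominus> (h/4) \<odot> (T' \<otimes> H3 \<otimes> H3) \<ominus> (h/4) \<odot> (H3 \<otimes> T' \<otimes> H3)),
    (\<lbrakk>H2, F3\<rbrakk>,
       (-1/4) \<odot> (T' \<otimes> (T \<otimes> F3 \<oplus> F3 \<otimes> T \<oplus> T' \<otimes> F3 \<oplus> F3 \<otimes> T'))
       \<ominus> (h/4) \<odot> (T' \<otimes> H3 \<otimes> H3) \<ominus> (h/4) \<odot> (H3 \<otimes> T' \<otimes> H3)),
    (\<lbrakk>E1, T\<rbrakk>, \<zero>), (\<lbrakk>E1, T'\<rbrakk>, \<zero>), (\<lbrakk>E2, T\<rbrakk>, \<zero>), (\<lbrakk>E2, T'\<rbrakk>, \<zero>),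
    (\<lbrakk>F1, T\<rbrakk>, h \<odot> (T \<otimes> E2)), (\<lbrakk>F1, T'\<rbrakk>, (-h) \<odot> (T' \<otimes> E2)),
    (\<lbrakk>F2, T\<rbrakk>, (-h) \<odot> (T \<otimes> E1)), (\<lbrakk>F2, T'\<rbrakk>, h \<odot> (T' \<otimes> E1)),
    (\<lbrakk>E1, F3\<rbrakk>, (-1/2) \<odot> (T \<otimes> F2 \<oplus> F2 \<otimes> T)),
    (\<lbrakk>E2, F3\<rbrakk>, (1/2) \<odot> (T \<otimes> F1 \<oplus> F1 \<otimes> T)),
    (\<lbrakk>F1, F3\<rbrakk>, \<kappa> \<odot> (T \<otimes> F1) \<ominus> h \<odot> (E2 \<otimes> F3) \<oplus> (h\<^sup>2/4) \<odot> (T \<otimes> E2)),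
    (\<lbrakk>F2, F3\<rbrakk>, \<kappa> \<odot> (T \<otimes> F2) \<oplus> h \<odot> (E1 \<otimes> F3) \<ominus> (h\<^sup>2/4) \<odot> (T \<otimes> E1))}"
  for A (structure)

datatype jgen = gH1 | gH2 | gH3 | gE1 | gE2 | gT | gT' | gF1 | gF2 | gF3

abbreviation jordanian_presentation ::
  "complex \<Rightarrow> complex \<Rightarrow> ((jgen list \<Rightarrow>\<^sub>0 complex) \<times> (jgen list \<Rightarrow>\<^sub>0 complex)) set" where
  "jordanian_presentation h \<kappa> \<equiv>
     jordanian_relations free_algebra h \<kappa>
       (free_gen gH1) (free_gen gH2) (free_gen gH3) (free_gen gE1) (free_gen gE2)
       (free_gen gT) (free_gen gT') (free_gen gF1) (free_gen gF2) (free_gen gF3)"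

definition jordanian_algebra ::
  "complex \<Rightarrow> complex \<Rightarrow> (complex, (jgen list \<Rightarrow>\<^sub>0 complex) set) module" where
  "jordanian_algebra h \<kappa> = presented_algebra (jordanian_presentation h \<kappa>)"

definition jordanian_gen :: "complex \<Rightarrow> complex \<Rightarrow> jgen \<Rightarrow> (jgen list \<Rightarrow>\<^sub>0 complex) set" where
  "jordanian_gen h \<kappa> g = presented_gen (jordanian_presentation h \<kappa>) g"

abbreviation self_tensor ::
  "(complex, 'a) module \<Rightarrow> 'a \<Rightarrow> 'a \<Rightarrow> ('a \<times> 'a \<Rightarrow>\<^sub>0 complex) set"
  (\<open>(_ \<boxtimes>\<index> _)\<close> [68, 68] 67) where
  "x \<boxtimes>\<^bsub>A\<^esub> y \<equiv> pure_tensor A A x y"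

end

theory Submission
  imports Defs
begin

text \<open>
  If \<open>h \<noteq> 0\<close>, commuting \<open>T\<close> with the relation for \<open>[T F2, T F1]\<close> shows \<open>H3 = T (H1 + H2)\<close>. For
  \<open>\<kappa> = h / 2\<close> the remaining relations then become rewrite rules that sort words in the order
  \<open>T, T', E1, E2, H1, H2, F1, F2, F3\<close>; for \<open>\<kappa> = h\<close> all generators except \<open>T = T'\<close> vanish; and for
  \<open>h = 0\<close> the element \<open>T = T'\<close> is a central involution, \<open>H3\<close> stays independent, and the other
  commutators are again rewrite rules. In each case, rewriting to normal form in \<open>U\<close>, \<open>U \<otimes> U\<close> and
  \<open>U \<otimes> (U \<otimes> U)\<close> verifies that the prescribed images of the generators respect the relations, with
  the antipode regarded as a homomorphism to the opposite algebra, and that the Hopf axioms hold on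
  generators. The axioms then hold everywhere because both sides are homomorphisms or, for the
  antipode, because their validity is preserved under products. A coproduct and a counit are
  determined by their values on generators, and the antipode is the convolution inverse of the
  identity.\<close>

section \<open>Complex algebras and their linear maps\<close>

text \<open>Coefficients have the shape \<open>n \<eta>^j / 2^i\<close>, so with
  \<open>\<eta> = h\<close> one finite computation settles all nonzero \<open>h\<close> at once. It
  divides by \<open>h\<close>, notably to order \<open>E2 E1\<close> and to isolate
  \<open>H3\<close>. At \<open>h = 0\<close> this is impossible, and
  \<open>2h [E1,E2] = T^2 - 1\<close> degenerates to \<open>T^2 = 1\<close>; hence the separate
  case, computed with \<open>\<eta> = 1\<close>. The identity \<open>H3 = T (H1 + H2)\<close> arises
  because \<open>[F1,T]\<close> and \<open>[F2,T]\<close> are multiples of \<open>T E2\<close> and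
  \<open>T E1\<close>. Up to powers of \<open>T\<close>, commuting \<open>T\<close> with
  \<open>[T F2, T F1]\<close> therefore gives \<open>h\<close> times
  \<open>[T' E1, F1] + [T' E2, F2] = T (H1 + H2)\<close>, while \<open>[T, F3]\<close> on the other
  side brings in \<open>H3\<close>. Commuting \<open>T\<close> with the relation for
  \<open>[F1,F3]\<close> leaves \<open>h (\<kappa> - h/2) T^2 E2 = 0\<close>. This is empty for
  \<open>\<kappa> = h/2\<close> and starts the collapse for \<open>\<kappa> = h\<close>. A
  computation proves an equation because each rewrite step preserves the value in the algebra: an
  empty normal form of a difference is a certificate of equality.\<close>

context complex_algebra
begin

sublocale ring A
  by (rule ring)

sublocale vec: Module.module complex_alg A
  by (rule module)

lemma carrier_complex_alg [simp]: "c \<in> carrier complex_alg"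
  by (simp add: complex_alg_def)

lemma smult_closed [simp, intro]: "x \<in> carrier A \<Longrightarrow> c \<odot> x \<in> carrier A"
  by (rule vec.smult_closed) simp_all

lemma smult_add_left: "x \<in> carrier A \<Longrightarrow> (c + d) \<odot> x = c \<odot> x \<oplus> d \<odot> x"
  using vec.smult_l_distr[of c d x] by (simp add: complex_alg_def)

lemma smult_add_right:
  "\<lbrakk>x \<in> carrier A; y \<in> carrier A\<rbrakk> \<Longrightarrow> c \<odot> (x \<oplus> y) = c \<odot> x \<oplus> c \<odot> y"
  by (rule vec.smult_r_distr) simp_all

lemma smult_smult: "x \<in> carrier A \<Longrightarrow> c \<odot> (d \<odot> x) = (c * d) \<odot> x"
  using vec.smult_assoc1[of c d x] by (simp add: complex_alg_def)

lemma smult_1 [simp]: "x \<in> carrier A \<Longrightarrow> 1 \<odot> x = x"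
  using vec.smult_one[of x] by (simp add: complex_alg_def)

lemma smult_0 [simp]: "x \<in> carrier A \<Longrightarrow> 0 \<odot> x = \<zero>"
  using vec.smult_l_null[of x] by (simp add: complex_alg_def)

lemma smult_zero [simp]: "c \<odot> \<zero> = \<zero>"
  by (rule vec.smult_r_null) simp

lemma minus_eq_smult: "x \<in> carrier A \<Longrightarrow> \<ominus> x = (- 1) \<odot> x"
  using smult_add_left[of x "- 1" 1] by (simp add: minus_equality)

lemma smult_minus: "x \<in> carrier A \<Longrightarrow> (- c) \<odot> x = \<ominus> (c \<odot> x)"
  by (simp add: minus_eq_smult smult_smult)

lemma add_diff_cancel:
  assumes "x \<in> carrier A" "y \<in> carrier A"
  shows "x \<oplus> y \<ominus> x \<ominus> y = \<zero>"
proof -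
  have "x \<oplus> y \<ominus> x \<ominus> y = (x \<oplus> y) \<oplus> \<ominus> (x \<oplus> y)"
    using assms by (simp add: minus_eq minus_add a_assoc)
  with assms show ?thesis by (simp only: r_neg a_closed)
qed

text \<open>Turns vanishing certificates into equations. The second orientation serves the relation
  \<open>2h [E1,E2] = T^2 - 1\<close> when its left side is zero.\<close>

lemma diff_eq_zero:
  assumes "x \<in> carrier A" "y \<in> carrier A"
  shows "x \<ominus> y = \<zero> \<longleftrightarrow> x = y" and "\<zero> = x \<ominus> y \<longleftrightarrow> x = y"
proof -
  have "x = y" if "x \<ominus> y = \<zero>"
  proof -
    have "x \<ominus> y \<oplus> y = y" using that assms by simp
    then show ?thesis using assms by (simp add: minus_eq a_assoc l_neg)
  qed
  then show "x \<ominus> y = \<zero> \<longleftrightarrow> x = y" and "\<zero> = x \<ominus> y \<longleftrightarrow> x = y"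
    using assms by (auto simp: minus_eq r_neg)
qed

lemma smult_mult_smult:
  "\<lbrakk>x \<in> carrier A; y \<in> carrier A\<rbrakk> \<Longrightarrow> (c \<odot> x) \<otimes> (d \<odot> y) = (c * d) \<odot> (x \<otimes> y)"
  by (simp add: smult_mult_left smult_mult_right smult_smult mult.commute)

end

lemma cring_complex_alg: "cring complex_alg"
proof (rule cringI)
  show "abelian_group complex_alg"
  proof (rule abelian_groupI)
    fix x assume "x \<in> carrier complex_alg"
    show "\<exists>y\<in>carrier complex_alg. y \<oplus>\<^bsub>complex_alg\<^esub> x = \<zero>\<^bsub>complex_alg\<^esub>"
      by (rule bexI[of _ "- x"]) (simp_all add: complex_alg_def)
  qed (simp_all add: complex_alg_def)
  show "comm_monoid complex_alg"
    by (rule comm_monoidI) (simp_all add: complex_alg_def)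
qed (simp add: complex_alg_def distrib_right)

lemma complex_algI:
  assumes "ring A"
    and "\<And>c x. x \<in> carrier A \<Longrightarrow> c \<odot>\<^bsub>A\<^esub> x \<in> carrier A"
    and "\<And>c d x. x \<in> carrier A \<Longrightarrow> (c + d) \<odot>\<^bsub>A\<^esub> x = c \<odot>\<^bsub>A\<^esub> x \<oplus>\<^bsub>A\<^esub> d \<odot>\<^bsub>A\<^esub> x"
    and "\<And>c x y. \<lbrakk>x \<in> carrier A; y \<in> carrier A\<rbrakk> \<Longrightarrow>
      c \<odot>\<^bsub>A\<^esub> (x \<oplus>\<^bsub>A\<^esub> y) = c \<odot>\<^bsub>A\<^esub> x \<oplus>\<^bsub>A\<^esub> c \<odot>\<^bsub>A\<^esub> y"
    and "\<And>c d x. x \<in> carrier A \<Longrightarrow> (c * d) \<odot>\<^bsub>A\<^esub> x = c \<odot>\<^bsub>A\<^esub> (d \<odot>\<^bsub>A\<^esub> x)"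
    and "\<And>x. x \<in> carrier A \<Longrightarrow> 1 \<odot>\<^bsub>A\<^esub> x = x"
    and "\<And>c x y. \<lbrakk>x \<in> carrier A; y \<in> carrier A\<rbrakk> \<Longrightarrow>
      (c \<odot>\<^bsub>A\<^esub> x) \<otimes>\<^bsub>A\<^esub> y = c \<odot>\<^bsub>A\<^esub> (x \<otimes>\<^bsub>A\<^esub> y)"
    and "\<And>c x y. \<lbrakk>x \<in> carrier A; y \<in> carrier A\<rbrakk> \<Longrightarrow>
      x \<otimes>\<^bsub>A\<^esub> (c \<odot>\<^bsub>A\<^esub> y) = c \<odot>\<^bsub>A\<^esub> (x \<otimes>\<^bsub>A\<^esub> y)"
  shows "complex_algebra A"
proof -
  interpret ring A by fact
  have "Module.module complex_alg A"
    by (rule moduleI[OF cring_complex_alg]) (use assms in \<open>auto simp: complex_alg_def intro: abelian_group_axioms\<close>)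
  then show ?thesis
    by (intro complex_algebra.intro assms(1,7,8))
qed

lemma complex_algebra_complex_alg: "complex_algebra complex_alg"
  by (rule complex_algI[OF cring.axioms(1)[OF cring_complex_alg]])
    (simp_all add: complex_alg_def algebra_simps)

lemma linear_mapsI:
  assumes "\<And>x. x \<in> carrier A \<Longrightarrow> f x \<in> carrier B"
    and "\<And>x y. \<lbrakk>x \<in> carrier A; y \<in> carrier A\<rbrakk> \<Longrightarrow> f (x \<oplus>\<^bsub>A\<^esub> y) = f x \<oplus>\<^bsub>B\<^esub> f y"
    and "\<And>c x. x \<in> carrier A \<Longrightarrow> f (c \<odot>\<^bsub>A\<^esub> x) = c \<odot>\<^bsub>B\<^esub> f x"
  shows "f \<in> linear_maps A B"
  using assms by (auto simp: linear_maps_def)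

lemma linear_maps_closed: "\<lbrakk>f \<in> linear_maps A B; x \<in> carrier A\<rbrakk> \<Longrightarrow> f x \<in> carrier B"
  by (auto simp: linear_maps_def)

lemma linear_maps_add:
  "\<lbrakk>f \<in> linear_maps A B; x \<in> carrier A; y \<in> carrier A\<rbrakk> \<Longrightarrow> f (x \<oplus>\<^bsub>A\<^esub> y) = f x \<oplus>\<^bsub>B\<^esub> f y"
  by (auto simp: linear_maps_def)

lemma linear_maps_smult:
  "\<lbrakk>f \<in> linear_maps A B; x \<in> carrier A\<rbrakk> \<Longrightarrow> f (c \<odot>\<^bsub>A\<^esub> x) = c \<odot>\<^bsub>B\<^esub> f x"
  by (auto simp: linear_maps_def)

lemma linear_maps_compose:
  "\<lbrakk>f \<in> linear_maps A B; g \<in> linear_maps B C\<rbrakk> \<Longrightarrow> (\<lambda>x. g (f x)) \<in> linear_maps A C"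
  by (auto simp: linear_maps_def Pi_iff)

lemma linear_maps_id: "(\<lambda>x. x) \<in> linear_maps A A"
  by (auto simp: linear_maps_def)

lemma linear_maps_zero:
  assumes "complex_algebra A" "complex_algebra B" "f \<in> linear_maps A B"
  shows "f \<zero>\<^bsub>A\<^esub> = \<zero>\<^bsub>B\<^esub>"
proof -
  interpret A: complex_algebra A by fact
  interpret B: complex_algebra B by fact
  show ?thesis
    using linear_maps_smult[OF assms(3), of "\<zero>\<^bsub>A\<^esub>" 0] linear_maps_closed[OF assms(3)] by simp
qed

lemma linear_maps_minus:
  assumes "complex_algebra A" "complex_algebra B" "f \<in> linear_maps A B"
    "x \<in> carrier A" "y \<in> carrier A"
  shows "f (\<ominus>\<^bsub>A\<^esub> x) = \<ominus>\<^bsub>B\<^esub> f x" "f (x \<ominus>\<^bsub>A\<^esub> y) = f x \<ominus>\<^bsub>B\<^esub> f y"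
proof -
  interpret A: complex_algebra A by fact
  interpret B: complex_algebra B by fact
  show "f (\<ominus>\<^bsub>A\<^esub> x) = \<ominus>\<^bsub>B\<^esub> f x" "f (x \<ominus>\<^bsub>A\<^esub> y) = f x \<ominus>\<^bsub>B\<^esub> f y"
    using assms linear_maps_closed[OF assms(3)]
    by (simp_all add: A.minus_eq B.minus_eq A.minus_eq_smult B.minus_eq_smult
        linear_maps_add linear_maps_smult)
qed

lemma linear_maps_sum:
  assumes "complex_algebra B" "f \<in> linear_maps A B" "g \<in> linear_maps A B"
  shows "(\<lambda>x. f x \<oplus>\<^bsub>B\<^esub> g x) \<in> linear_maps A B"
proof -
  interpret B: complex_algebra B by fact
  show ?thesis
    using assms
    by (intro linear_mapsI)
      (simp_all add: linear_maps_closed linear_maps_add linear_maps_smult B.a_ac B.smult_add_right)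
qed

lemma linear_maps_scaled:
  assumes "complex_algebra B" "f \<in> linear_maps A B"
  shows "(\<lambda>x. c \<odot>\<^bsub>B\<^esub> f x) \<in> linear_maps A B"
proof -
  interpret B: complex_algebra B by fact
  show ?thesis
    using assms
    by (intro linear_mapsI)
      (simp_all add: linear_maps_closed linear_maps_add linear_maps_smult B.smult_add_right
        B.smult_smult mult.commute)
qed

lemma linear_maps_mult_left:
  assumes "complex_algebra B" "f \<in> linear_maps A B" "b \<in> carrier B"
  shows "(\<lambda>x. b \<otimes>\<^bsub>B\<^esub> f x) \<in> linear_maps A B"
proof -
  interpret B: complex_algebra B by fact
  show ?thesis
    using assms
    by (intro linear_mapsI)
      (simp_all add: linear_maps_closed linear_maps_add linear_maps_smult B.r_distr B.smult_mult_right)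
qed

lemma linear_maps_mult_right:
  assumes "complex_algebra B" "f \<in> linear_maps A B" "b \<in> carrier B"
  shows "(\<lambda>x. f x \<otimes>\<^bsub>B\<^esub> b) \<in> linear_maps A B"
proof -
  interpret B: complex_algebra B by fact
  show ?thesis
    using assms
    by (intro linear_mapsI)
      (simp_all add: linear_maps_closed linear_maps_add linear_maps_smult B.l_distr B.smult_mult_left)
qed

lemma linear_maps_scalar_part:
  assumes "complex_algebra B" "f \<in> linear_maps A complex_alg" "b \<in> carrier B"
  shows "(\<lambda>x. f x \<odot>\<^bsub>B\<^esub> b) \<in> linear_maps A B"
proof -
  interpret B: complex_algebra B by fact
  show ?thesis
    using assms
    by (intro linear_mapsI)
      (simp_all add: linear_maps_add linear_maps_smult complex_alg_def B.smult_add_left B.smult_smult)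
qed

lemma algebra_homsI:
  assumes "f \<in> linear_maps A B"
    and "\<And>x y. \<lbrakk>x \<in> carrier A; y \<in> carrier A\<rbrakk> \<Longrightarrow> f (x \<otimes>\<^bsub>A\<^esub> y) = f x \<otimes>\<^bsub>B\<^esub> f y"
    and "f \<one>\<^bsub>A\<^esub> = \<one>\<^bsub>B\<^esub>"
  shows "f \<in> algebra_homs A B"
  using assms by (auto simp: algebra_homs_def linear_maps_def intro!: ring_hom_memI)

lemma algebra_homs_linear: "f \<in> algebra_homs A B \<Longrightarrow> f \<in> linear_maps A B"
  by (simp add: algebra_homs_def)

lemma algebra_homs_mult:
  "\<lbrakk>f \<in> algebra_homs A B; x \<in> carrier A; y \<in> carrier A\<rbrakk> \<Longrightarrow> f (x \<otimes>\<^bsub>A\<^esub> y) = f x \<otimes>\<^bsub>B\<^esub> f y"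
  by (auto simp: algebra_homs_def intro: ring_hom_mult)

lemma algebra_homs_one: "f \<in> algebra_homs A B \<Longrightarrow> f \<one>\<^bsub>A\<^esub> = \<one>\<^bsub>B\<^esub>"
  by (auto simp: algebra_homs_def intro: ring_hom_one)

lemmas algebra_homs_closed = linear_maps_closed[OF algebra_homs_linear]
lemmas algebra_homs_add = linear_maps_add[OF algebra_homs_linear]
lemmas algebra_homs_smult = linear_maps_smult[OF algebra_homs_linear]

lemma algebra_homs_compose:
  assumes "f \<in> algebra_homs A B" "g \<in> algebra_homs B C"
  shows "(\<lambda>x. g (f x)) \<in> algebra_homs A C"
  by (rule algebra_homsI[OF linear_maps_compose[OF assms[THEN algebra_homs_linear]]])
    (simp_all add: algebra_homs_mult[OF assms(1)] algebra_homs_mult[OF assms(2)]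
      algebra_homs_one[OF assms(1)] algebra_homs_one[OF assms(2)] algebra_homs_closed[OF assms(1)])

lemma algebra_homs_id: "(\<lambda>x. x) \<in> algebra_homs A A"
  by (rule algebra_homsI) (simp_all add: linear_maps_id)

lemma algebra_homs_cong:
  assumes "complex_algebra A" "f \<in> algebra_homs A B" "\<And>x. x \<in> carrier A \<Longrightarrow> g x = f x"
  shows "g \<in> algebra_homs A B"
proof -
  interpret complex_algebra A by fact
  show ?thesis
    by (intro algebra_homsI linear_mapsI)
      (simp_all add: assms(3) algebra_homs_closed[OF assms(2)] algebra_homs_add[OF assms(2)]
        algebra_homs_smult[OF assms(2)] algebra_homs_mult[OF assms(2)] algebra_homs_one[OF assms(2)])
qed


section \<open>Monoid algebras\<close>

definition lin_ext :: "(complex, 'c) module \<Rightarrow> ('m \<Rightarrow> 'c) \<Rightarrow> ('m \<Rightarrow>\<^sub>0 complex) \<Rightarrow> 'c" where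
  "lin_ext C \<phi> f =
     (\<Oplus>\<^bsub>C\<^esub>p\<in>Poly_Mapping.keys f. Poly_Mapping.lookup f p \<odot>\<^bsub>C\<^esub> \<phi> p)"

lemma lookup_pm_scale: "Poly_Mapping.lookup (pm_scale c f) p = c * Poly_Mapping.lookup f p"
  by (simp add: Poly_Mapping.map.rep_eq when_def)

lemma keys_pm_scale: "Poly_Mapping.keys (pm_scale c f) \<subseteq> Poly_Mapping.keys f"
  by (auto simp: in_keys_iff lookup_pm_scale)

lemma pm_scale_single [simp]:
  "pm_scale c (Poly_Mapping.single p d) = Poly_Mapping.single p (c * d)"
  by (rule poly_mapping_eqI) (simp add: lookup_pm_scale lookup_single when_def)

lemma pm_scale_zero [simp]: "pm_scale c 0 = 0"
  by (rule poly_mapping_eqI) (simp add: lookup_pm_scale)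

lemma pm_scale_add: "pm_scale c (f + g) = pm_scale c f + pm_scale c g"
  by (rule poly_mapping_eqI) (simp add: lookup_pm_scale lookup_add algebra_simps)

text \<open>Identities that are linear in an argument reduce to basis elements by this rule; keeping
  \<open>S\<close> in the hypotheses confines the induction to the carrier of a monoid
  algebra.\<close>

lemma poly_mapping_span_induct [consumes 1, case_names zero single]:
  fixes f :: "'m \<Rightarrow>\<^sub>0 complex"
  assumes "Poly_Mapping.keys f \<subseteq> S"
    and "P 0"
    and "\<And>p c f. \<lbrakk>p \<in> S; Poly_Mapping.keys f \<subseteq> S; P f\<rbrakk> \<Longrightarrow> P (Poly_Mapping.single p c + f)"
  shows "P f"
proof -
  \<comment> \<open>Quantifying over all \<open>f\<close> supported in \<open>F\<close> lets the
    part of \<open>f\<close> away from \<open>p\<close> fall under the induction hypothesis.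
    \<open>F\<close> may leave \<open>S\<close>; a key outside \<open>S\<close> has coefficient 0
    and is treated separately.\<close>
  have "finite F \<Longrightarrow> (\<forall>f. Poly_Mapping.keys f \<subseteq> F \<longrightarrow> Poly_Mapping.keys f \<subseteq> S \<longrightarrow> P f)" for F
  proof (induction F rule: finite_induct)
    case empty
    then show ?case using assms(2) by (auto simp: in_keys_iff intro: poly_mapping_eqI)
  next
    case (insert p F)
    show ?case
    proof (intro allI impI)
      fix f :: "'m \<Rightarrow>\<^sub>0 complex"
      assume f: "Poly_Mapping.keys f \<subseteq> insert p F" "Poly_Mapping.keys f \<subseteq> S"
      define g where "g = f - Poly_Mapping.single p (Poly_Mapping.lookup f p)"
      have g: "Poly_Mapping.lookup g q = (if q = p then 0 else Poly_Mapping.lookup f q)" for q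
        by (simp add: g_def lookup_minus lookup_single when_def)
      have "Poly_Mapping.keys g \<subseteq> F" "Poly_Mapping.keys g \<subseteq> S"
        using f by (auto simp: in_keys_iff g split: if_splits)
      then have "P g" using insert.IH by blast
      show "P f"
      proof (cases "p \<in> S")
        case True
        have "f = Poly_Mapping.single p (Poly_Mapping.lookup f p) + g" by (simp add: g_def)
        then show ?thesis using assms(3)[OF True _ \<open>P g\<close>] \<open>Poly_Mapping.keys g \<subseteq> S\<close> by metis
      next
        case False
        then have "Poly_Mapping.lookup f p = 0" using f(2) by (auto simp: in_keys_iff)
        then show ?thesis using \<open>P g\<close> by (simp add: g_def)
      qed
    qed
  qed
  from this[of "Poly_Mapping.keys f"] assms(1) show ?thesis by simp
qed

context complex_algebra
begin

text \<open>The support changes under addition and scaling, because terms can cancel. A common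
  finite index set makes the sums comparable.\<close>

lemma lin_ext_superset:
  assumes "finite F" "Poly_Mapping.keys f \<subseteq> F" "\<And>p. p \<in> F \<Longrightarrow> \<phi> p \<in> carrier A"
  shows "lin_ext A \<phi> f = (\<Oplus>p\<in>F. Poly_Mapping.lookup f p \<odot> \<phi> p)"
  unfolding lin_ext_def
  by (rule add.finprod_mono_neutral_cong_left) (use assms in \<open>auto simp: in_keys_iff\<close>)

lemma lin_ext_zero [simp]: "lin_ext A \<phi> 0 = \<zero>"
  by (simp add: lin_ext_def)

lemma lin_ext_closed:
  "(\<And>p. p \<in> Poly_Mapping.keys f \<Longrightarrow> \<phi> p \<in> carrier A) \<Longrightarrow> lin_ext A \<phi> f \<in> carrier A"
  unfolding lin_ext_def by (rule finsum_closed) auto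

lemma lin_ext_add:
  assumes "\<And>p. p \<in> Poly_Mapping.keys f \<union> Poly_Mapping.keys g \<Longrightarrow> \<phi> p \<in> carrier A"
  shows "lin_ext A \<phi> (f + g) = lin_ext A \<phi> f \<oplus> lin_ext A \<phi> g"
proof -
  let ?F = "Poly_Mapping.keys f \<union> Poly_Mapping.keys g"
  have *: "lin_ext A \<phi> f' = (\<Oplus>p\<in>?F. Poly_Mapping.lookup f' p \<odot> \<phi> p)"
    if "Poly_Mapping.keys f' \<subseteq> ?F" for f'
    by (rule lin_ext_superset) (use assms that in auto)
  have "(\<Oplus>p\<in>?F. Poly_Mapping.lookup (f + g) p \<odot> \<phi> p)
      = (\<Oplus>p\<in>?F. Poly_Mapping.lookup f p \<odot> \<phi> p \<oplus> Poly_Mapping.lookup g p \<odot> \<phi> p)"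
    by (rule add.finprod_cong') (use assms in \<open>auto simp: lookup_add smult_add_left\<close>)
  also have "\<dots> = (\<Oplus>p\<in>?F. Poly_Mapping.lookup f p \<odot> \<phi> p)
      \<oplus> (\<Oplus>p\<in>?F. Poly_Mapping.lookup g p \<odot> \<phi> p)"
    by (rule add.finprod_multf) (use assms in auto)
  finally show ?thesis
    by (simp add: * Poly_Mapping.keys_add)
qed

lemma lin_ext_scale:
  assumes "\<And>p. p \<in> Poly_Mapping.keys f \<Longrightarrow> \<phi> p \<in> carrier A"
  shows "lin_ext A \<phi> (pm_scale c f) = c \<odot> lin_ext A \<phi> f"
proof -
  have "lin_ext A \<phi> (pm_scale c f)
      = (\<Oplus>p\<in>Poly_Mapping.keys f. c \<odot> (Poly_Mapping.lookup f p \<odot> \<phi> p))"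
    using assms keys_pm_scale[of c f]
    by (subst lin_ext_superset[of "Poly_Mapping.keys f"])
      (auto intro!: add.finprod_cong' simp: lookup_pm_scale smult_smult)
  also have "\<dots> = c \<odot> lin_ext A \<phi> f"
    unfolding lin_ext_def using assms by (intro vec.finsum_smult_ldistr[symmetric]) auto
  finally show ?thesis .
qed

lemma lin_ext_single:
  assumes "\<phi> p \<in> carrier A"
  shows "lin_ext A \<phi> (Poly_Mapping.single p c) = c \<odot> \<phi> p"
  using assms by (subst lin_ext_superset[of "{p}"]) (auto simp: lookup_single)

end

lemma monoid_algebra_sel [simp]:
  "carrier (monoid_algebra M) = {f. Poly_Mapping.keys f \<subseteq> carrier M}"
  "one (monoid_algebra M) = Poly_Mapping.single \<one>\<^bsub>M\<^esub> 1"
  "zero (monoid_algebra M) = 0" "add (monoid_algebra M) = (+)"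
  "smult (monoid_algebra M) = pm_scale"
  by (simp_all add: monoid_algebra_def)

lemma sum_keys_superset:
  assumes "finite F" "Poly_Mapping.keys f \<subseteq> F" "\<And>p. h p 0 = 0"
  shows "(\<Sum>p\<in>Poly_Mapping.keys f. h p (Poly_Mapping.lookup f p)) = (\<Sum>p\<in>F. h p (Poly_Mapping.lookup f p))"
  by (rule sum.mono_neutral_left) (use assms in \<open>auto simp: in_keys_iff\<close>)

lemma sum_keys_add:
  fixes h :: "'m \<Rightarrow> complex \<Rightarrow> 'b::ab_group_add"
  assumes "\<And>p x y. h p (x + y) = h p x + h p y"
  shows "(\<Sum>p\<in>Poly_Mapping.keys (f + g). h p (Poly_Mapping.lookup (f + g) p))
    = (\<Sum>p\<in>Poly_Mapping.keys f. h p (Poly_Mapping.lookup f p))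
      + (\<Sum>p\<in>Poly_Mapping.keys g. h p (Poly_Mapping.lookup g p))"
proof -
  have z: "h p 0 = 0" for p using assms[of p 0 0] by simp
  let ?F = "Poly_Mapping.keys f \<union> Poly_Mapping.keys g"
  show ?thesis
    by (subst (1 2 3) sum_keys_superset[of ?F])
      (use Poly_Mapping.keys_add[of f g] in \<open>auto simp: z lookup_add assms sum.distrib\<close>)
qed

lemma mult_monoid_algebra_def:
  "f \<otimes>\<^bsub>monoid_algebra M\<^esub> g = (\<Sum>p\<in>Poly_Mapping.keys f. \<Sum>q\<in>Poly_Mapping.keys g.
     Poly_Mapping.single (p \<otimes>\<^bsub>M\<^esub> q) (Poly_Mapping.lookup f p * Poly_Mapping.lookup g q))"
  by (simp add: monoid_algebra_def)

lemma monoid_algebra_add_left: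
  "(f + f') \<otimes>\<^bsub>monoid_algebra M\<^esub> g = f \<otimes>\<^bsub>monoid_algebra M\<^esub> g + f' \<otimes>\<^bsub>monoid_algebra M\<^esub> g"
  unfolding mult_monoid_algebra_def
  by (rule sum_keys_add[of "\<lambda>p x. \<Sum>q\<in>Poly_Mapping.keys g.
        Poly_Mapping.single (p \<otimes>\<^bsub>M\<^esub> q) (x * Poly_Mapping.lookup g q)"])
    (simp add: distrib_right single_add sum.distrib)

lemma monoid_algebra_add_right:
  "f \<otimes>\<^bsub>monoid_algebra M\<^esub> (g + g') = f \<otimes>\<^bsub>monoid_algebra M\<^esub> g + f \<otimes>\<^bsub>monoid_algebra M\<^esub> g'"
  unfolding mult_monoid_algebra_def sum.distrib[symmetric]
  by (rule sum.cong[OF refl],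
      rule sum_keys_add[of "\<lambda>q x. Poly_Mapping.single (p \<otimes>\<^bsub>M\<^esub> q) (Poly_Mapping.lookup f p * x)" for p])
    (simp add: distrib_left single_add)

lemma monoid_algebra_single:
  "Poly_Mapping.single p c \<otimes>\<^bsub>monoid_algebra M\<^esub> Poly_Mapping.single q d
     = Poly_Mapping.single (p \<otimes>\<^bsub>M\<^esub> q) (c * d)"
  by (simp add: mult_monoid_algebra_def)

lemma monoid_algebra_zero [simp]:
  "0 \<otimes>\<^bsub>monoid_algebra M\<^esub> g = 0" "f \<otimes>\<^bsub>monoid_algebra M\<^esub> 0 = 0"
  by (simp_all add: mult_monoid_algebra_def)

lemmas monoid_algebra_mult = monoid_algebra_add_left monoid_algebra_add_right monoid_algebra_single

lemma keys_add_subset: "\<lbrakk>Poly_Mapping.keys f \<subseteq> S; Poly_Mapping.keys g \<subseteq> S\<rbrakk> \<Longrightarrow> Poly_Mapping.keys (f + g) \<subseteq> S"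
  using Poly_Mapping.keys_add[of f g] by auto

lemma keys_sum_subset:
  "(\<And>i. i \<in> I \<Longrightarrow> Poly_Mapping.keys (f i) \<subseteq> S) \<Longrightarrow> Poly_Mapping.keys (sum f I) \<subseteq> S"
  by (induction I rule: infinite_finite_induct) (auto simp: keys_add_subset)

lemma complex_algebra_monoid_algebra:
  fixes M :: "('m, 'k) monoid_scheme" (structure)
  assumes "Group.monoid M"
  shows "complex_algebra (monoid_algebra M)"
proof -
  interpret Group.monoid M by fact
  let ?A = "monoid_algebra M"
  have closed: "f \<otimes>\<^bsub>?A\<^esub> g \<in> carrier ?A" if "f \<in> carrier ?A" "g \<in> carrier ?A" for f g
    unfolding mult_monoid_algebra_def monoid_algebra_sel mem_Collect_eq
    by (intro keys_sum_subset) (use that in \<open>auto split: if_splits\<close>)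
  have assoc1: "(Poly_Mapping.single p c \<otimes>\<^bsub>?A\<^esub> Poly_Mapping.single q d) \<otimes>\<^bsub>?A\<^esub> k
      = Poly_Mapping.single p c \<otimes>\<^bsub>?A\<^esub> (Poly_Mapping.single q d \<otimes>\<^bsub>?A\<^esub> k)"
    if "Poly_Mapping.keys k \<subseteq> carrier M" "p \<in> carrier M" "q \<in> carrier M" for p q c d k
    using that(1)
    by (induction rule: poly_mapping_span_induct)
      (simp_all add: monoid_algebra_mult that m_assoc mult.assoc)
  have assoc2: "(Poly_Mapping.single p c \<otimes>\<^bsub>?A\<^esub> g) \<otimes>\<^bsub>?A\<^esub> k
      = Poly_Mapping.single p c \<otimes>\<^bsub>?A\<^esub> (g \<otimes>\<^bsub>?A\<^esub> k)"
    if "Poly_Mapping.keys g \<subseteq> carrier M" "Poly_Mapping.keys k \<subseteq> carrier M" "p \<in> carrier M" for p c g k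
    using that(1)
    by (induction rule: poly_mapping_span_induct)
      (simp_all add: monoid_algebra_add_left monoid_algebra_add_right assoc1 that)
  have assoc: "(f \<otimes>\<^bsub>?A\<^esub> g) \<otimes>\<^bsub>?A\<^esub> k = f \<otimes>\<^bsub>?A\<^esub> (g \<otimes>\<^bsub>?A\<^esub> k)"
    if "Poly_Mapping.keys f \<subseteq> carrier M" "Poly_Mapping.keys g \<subseteq> carrier M"
      "Poly_Mapping.keys k \<subseteq> carrier M" for f g k
    using that(1)
    by (induction rule: poly_mapping_span_induct) (simp_all add: monoid_algebra_add_left assoc2 that)
  have one_l: "Poly_Mapping.single \<one> 1 \<otimes>\<^bsub>?A\<^esub> f = f"
    and one_r: "f \<otimes>\<^bsub>?A\<^esub> Poly_Mapping.single \<one> 1 = f" if "Poly_Mapping.keys f \<subseteq> carrier M" for f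
    using that
    by (induction rule: poly_mapping_span_induct) (simp_all add: monoid_algebra_mult)
  have scale_single: "Poly_Mapping.single p (c * d) \<otimes>\<^bsub>?A\<^esub> g
       = pm_scale c (Poly_Mapping.single p d \<otimes>\<^bsub>?A\<^esub> g)"
    "Poly_Mapping.single p d \<otimes>\<^bsub>?A\<^esub> pm_scale c g
       = pm_scale c (Poly_Mapping.single p d \<otimes>\<^bsub>?A\<^esub> g)"
    if "Poly_Mapping.keys g \<subseteq> carrier M" for c p d g
    using that
    by (induction rule: poly_mapping_span_induct)
      (simp_all add: monoid_algebra_mult pm_scale_add mult_ac)
  have scale: "pm_scale c f \<otimes>\<^bsub>?A\<^esub> g = pm_scale c (f \<otimes>\<^bsub>?A\<^esub> g)"
    "f \<otimes>\<^bsub>?A\<^esub> pm_scale c g = pm_scale c (f \<otimes>\<^bsub>?A\<^esub> g)"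
    if "Poly_Mapping.keys f \<subseteq> carrier M" "Poly_Mapping.keys g \<subseteq> carrier M" for c f g
    using that(1)
    by (induction rule: poly_mapping_span_induct)
      (simp_all add: monoid_algebra_add_left pm_scale_add scale_single[OF that(2)])
  have "abelian_group ?A"
  proof (rule abelian_groupI)
    fix f assume "f \<in> carrier ?A"
    then show "\<exists>g\<in>carrier ?A. g \<oplus>\<^bsub>?A\<^esub> f = \<zero>\<^bsub>?A\<^esub>"
      by (intro bexI[of _ "- f"]) simp_all
  qed (auto simp: keys_add_subset algebra_simps)
  moreover have "Group.monoid ?A"
    by (rule monoidI) (use closed assoc one_l one_r in auto)
  ultimately have "ring ?A"
    by (rule ringI) (auto simp: monoid_algebra_mult)
  then show ?thesis
  proof (rule complex_algI)
    fix c and f assume "f \<in> carrier ?A"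
    then show "c \<odot>\<^bsub>?A\<^esub> f \<in> carrier ?A" using keys_pm_scale[of c f] by auto
  next
    fix c d and f
    show "(c + d) \<odot>\<^bsub>?A\<^esub> f = c \<odot>\<^bsub>?A\<^esub> f \<oplus>\<^bsub>?A\<^esub> d \<odot>\<^bsub>?A\<^esub> f"
      "(c * d) \<odot>\<^bsub>?A\<^esub> f = c \<odot>\<^bsub>?A\<^esub> (d \<odot>\<^bsub>?A\<^esub> f)" "1 \<odot>\<^bsub>?A\<^esub> f = f"
      by (auto intro!: poly_mapping_eqI simp: lookup_pm_scale lookup_add distrib_right mult.assoc)
  qed (simp_all add: pm_scale_add scale)
qed

lemma linear_maps_monoid_algebra_eq:
  fixes M :: "('m, 'k) monoid_scheme" (structure)
  assumes M: "Group.monoid M" and B: "complex_algebra B"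
    and f: "f \<in> linear_maps (monoid_algebra M) B" and g: "g \<in> linear_maps (monoid_algebra M) B"
    and eq: "\<And>p. p \<in> carrier M \<Longrightarrow> f (Poly_Mapping.single p 1) = g (Poly_Mapping.single p 1)"
    and x: "x \<in> carrier (monoid_algebra M)"
  shows "f x = g x"
proof -
  have A: "complex_algebra (monoid_algebra M)" by (rule complex_algebra_monoid_algebra[OF M])
  have s: "f (Poly_Mapping.single p c) = g (Poly_Mapping.single p c)" if "p \<in> carrier M" for p c
    using linear_maps_smult[OF f, of "Poly_Mapping.single p 1" c]
      linear_maps_smult[OF g, of "Poly_Mapping.single p 1" c] eq[OF that] that by simp
  from x have "Poly_Mapping.keys x \<subseteq> carrier M" by simp
  then show ?thesis
  proof (induction rule: poly_mapping_span_induct)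
    case zero
    then show ?case using linear_maps_zero[OF A B f] linear_maps_zero[OF A B g] by simp
  next
    case (single p c k)
    then show ?case
      using linear_maps_add[OF f, of "Poly_Mapping.single p c" k]
        linear_maps_add[OF g, of "Poly_Mapping.single p c" k] s[of p c] by simp
  qed
qed

lemma lin_ext_linear:
  assumes "complex_algebra B" "\<And>p. p \<in> carrier M \<Longrightarrow> \<phi> p \<in> carrier B"
  shows "lin_ext B \<phi> \<in> linear_maps (monoid_algebra M) B"
proof -
  interpret B: complex_algebra B by fact
  show ?thesis
    by (rule linear_mapsI)
      (use assms(2) in \<open>auto simp: subset_iff intro!: B.lin_ext_closed B.lin_ext_add B.lin_ext_scale\<close>)
qed

text \<open>Both sides of multiplicativity are linear in each factor. With \<open>y\<close> fixed it
  is enough to let \<open>x\<close> be a basis element, and then the same argument applies to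
  \<open>y\<close>; the double sum in the product is never expanded.\<close>

lemma lin_ext_hom:
  fixes M :: "('m, 'k) monoid_scheme" (structure)
  assumes M: "Group.monoid M" and B: "complex_algebra B"
    and closed: "\<And>p. p \<in> carrier M \<Longrightarrow> \<phi> p \<in> carrier B"
    and mult: "\<And>p q. \<lbrakk>p \<in> carrier M; q \<in> carrier M\<rbrakk> \<Longrightarrow> \<phi> (p \<otimes> q) = \<phi> p \<otimes>\<^bsub>B\<^esub> \<phi> q"
    and one: "\<phi> \<one> = \<one>\<^bsub>B\<^esub>"
  shows "lin_ext B \<phi> \<in> algebra_homs (monoid_algebra M) B"
proof -
  interpret M: Group.monoid M by fact
  interpret A: complex_algebra "monoid_algebra M" by (rule complex_algebra_monoid_algebra[OF M])
  interpret B: complex_algebra B by fact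
  let ?A = "monoid_algebra M"
  let ?f = "lin_ext B \<phi>"
  have lin: "?f \<in> linear_maps ?A B" by (rule lin_ext_linear[OF B closed])
  note lm = linear_maps_mult_left[OF B] linear_maps_mult_right[OF B]
    linear_maps_compose[OF linear_maps_mult_left[OF A.complex_algebra_axioms linear_maps_id] lin]
    linear_maps_compose[OF linear_maps_mult_right[OF A.complex_algebra_axioms linear_maps_id] lin]
  have single: "?f (Poly_Mapping.single p c) = c \<odot>\<^bsub>B\<^esub> \<phi> p" if "p \<in> carrier M" for p c
    by (rule B.lin_ext_single[of \<phi> p, OF closed[OF that]])
  show ?thesis
  proof (rule algebra_homsI[OF lin])
    fix x y assume x: "x \<in> carrier ?A" and y: "y \<in> carrier ?A"
    show "?f (x \<otimes>\<^bsub>?A\<^esub> y) = ?f x \<otimes>\<^bsub>B\<^esub> ?f y"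
    proof (rule linear_maps_monoid_algebra_eq[OF M B lm(4)[OF y]
          lm(2)[OF lin linear_maps_closed[OF lin y]] _ x])
      fix p assume p: "p \<in> carrier M"
      then have p': "Poly_Mapping.single p 1 \<in> carrier ?A" by simp
      show "?f (Poly_Mapping.single p 1 \<otimes>\<^bsub>?A\<^esub> y) = ?f (Poly_Mapping.single p 1) \<otimes>\<^bsub>B\<^esub> ?f y"
        by (rule linear_maps_monoid_algebra_eq[OF M B lm(3)[OF p']
              lm(1)[OF lin linear_maps_closed[OF lin p']] _ y])
          (simp add: monoid_algebra_single single p closed mult)
    qed
  next
    show "?f \<one>\<^bsub>?A\<^esub> = \<one>\<^bsub>B\<^esub>" by (simp add: single one)
  qed
qed

section \<open>Quotients and presentations\<close>

locale algebra_ideal = complex_algebra A + ideal I A for A :: "(complex, 'a) module" (structure) and I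

lemma quotient_algebra_sel:
  "carrier (quotient_algebra A I) = a_rcosets\<^bsub>A\<^esub> I"
  "mult (quotient_algebra A I) = rcoset_mult A I"
  "one (quotient_algebra A I) = I +>\<^bsub>A\<^esub> \<one>\<^bsub>A\<^esub>"
  "zero (quotient_algebra A I) = I"
  "add (quotient_algebra A I) = set_add A"
  "smult (quotient_algebra A I) = (\<lambda>c X. \<Union>x\<in>X. I +>\<^bsub>A\<^esub> (c \<odot>\<^bsub>A\<^esub> x))"
  by (simp_all add: quotient_algebra_def FactRing_def)

text \<open>The arbitrary representative imitates the choice made in \<open>tensor_lift\<close>, so
  that the results on quotients apply to it through \<open>tensor_lift_quot_lift\<close>.\<close>

definition quot_lift :: "('a \<Rightarrow> 'b) \<Rightarrow> 'a set \<Rightarrow> 'b" where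
  "quot_lift f X = f (SOME x. x \<in> X)"

context algebra_ideal
begin

abbreviation "Q \<equiv> quotient_algebra A I"

text \<open>A two-sided ideal is a subspace because \<open>c x = (c 1) x\<close>.\<close>

lemma smult_ideal: "x \<in> I \<Longrightarrow> c \<odot> x \<in> I"
  using I_l_closed[of x "c \<odot> \<one>"] by (simp add: smult_mult_left a_Hcarr)

lemma coset_eq_iff: "\<lbrakk>x \<in> carrier A; y \<in> carrier A\<rbrakk> \<Longrightarrow> I +> x = I +> y \<longleftrightarrow> x \<ominus> y \<in> I"
  using quotient_eq_iff_same_a_r_cos[OF ideal_axioms] by blast

lemma quotient_cases:
  assumes "X \<in> carrier Q"
  obtains x where "x \<in> carrier A" "X = I +> x"
  using assms by (auto simp: quotient_algebra_sel A_RCOSETS_def' a_r_coset_def')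

lemma coset_closed [simp]: "x \<in> carrier A \<Longrightarrow> I +> x \<in> carrier Q"
  by (auto simp: quotient_algebra_sel intro: a_rcosetsI[OF a_subset])

lemma coset_mult: "\<lbrakk>x \<in> carrier A; y \<in> carrier A\<rbrakk> \<Longrightarrow> (I +> x) \<otimes>\<^bsub>Q\<^esub> (I +> y) = I +> (x \<otimes> y)"
  by (simp add: quotient_algebra_sel rcoset_mult_add)

lemma coset_add: "\<lbrakk>x \<in> carrier A; y \<in> carrier A\<rbrakk> \<Longrightarrow> (I +> x) \<oplus>\<^bsub>Q\<^esub> (I +> y) = I +> (x \<oplus> y)"
  by (simp add: quotient_algebra_sel a_rcos_sum)

text \<open>The scalar action is a union over all representatives \<open>y\<close> of the coset. All
  of them contribute the same coset, since \<open>c y - c x\<close> is \<open>c\<close> times an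
  element of \<open>I\<close>.\<close>

lemma coset_smult:
  assumes "x \<in> carrier A"
  shows "c \<odot>\<^bsub>Q\<^esub> (I +> x) = I +> (c \<odot> x)"
proof -
  have "I +> (c \<odot> y) = I +> (c \<odot> x)" if y: "y \<in> I +> x" for y
  proof -
    from y assms obtain i where i: "i \<in> I" "y = i \<oplus> x" by (auto simp: a_r_coset_def')
    then have "c \<odot> y \<ominus> c \<odot> x = c \<odot> i"
      using assms by (simp add: smult_add_right a_Hcarr minus_eq a_assoc r_neg)
    then show ?thesis using i assms by (subst coset_eq_iff) (auto simp: smult_ideal a_Hcarr)
  qed
  then have "(\<Union>y\<in>I +> x. I +> (c \<odot> y)) = I +> (c \<odot> x)"
    using a_rcos_self[OF assms] by (intro UN_constant_eq[of x]) blast+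
  then show ?thesis by (simp add: quotient_algebra_sel)
qed

lemma coset_one: "\<one>\<^bsub>Q\<^esub> = I +> \<one>"
  by (simp add: quotient_algebra_sel)

lemma coset_zero: "\<zero>\<^bsub>Q\<^esub> = I +> \<zero>"
  by (simp add: quotient_algebra_sel a_rcos_const)

lemma complex_algebra_quotient: "complex_algebra Q"
proof (rule complex_algI)
  note simps = coset_zero coset_one coset_add coset_mult coset_smult
  have "abelian_group Q"
  proof (rule abelian_groupI)
    fix X Y Z assume "X \<in> carrier Q" "Y \<in> carrier Q" "Z \<in> carrier Q"
    then obtain x y z where [simp]: "x \<in> carrier A" "y \<in> carrier A" "z \<in> carrier A"
      and XYZ: "X = I +> x" "Y = I +> y" "Z = I +> z"
      by (elim quotient_cases)
    show "X \<oplus>\<^bsub>Q\<^esub> Y \<oplus>\<^bsub>Q\<^esub> Z = X \<oplus>\<^bsub>Q\<^esub> (Y \<oplus>\<^bsub>Q\<^esub> Z)"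
      by (simp add: XYZ simps a_assoc)
  next
    fix X Y assume "X \<in> carrier Q" "Y \<in> carrier Q"
    then obtain x y where [simp]: "x \<in> carrier A" "y \<in> carrier A" and XY: "X = I +> x" "Y = I +> y"
      by (elim quotient_cases)
    show "X \<oplus>\<^bsub>Q\<^esub> Y \<in> carrier Q" "X \<oplus>\<^bsub>Q\<^esub> Y = Y \<oplus>\<^bsub>Q\<^esub> X"
      by (simp_all add: XY simps a_comm)
  next
    fix X assume "X \<in> carrier Q"
    then obtain x where [simp]: "x \<in> carrier A" and X: "X = I +> x" by (rule quotient_cases)
    show "\<zero>\<^bsub>Q\<^esub> \<oplus>\<^bsub>Q\<^esub> X = X" by (simp add: X simps)
    show "\<exists>Y\<in>carrier Q. Y \<oplus>\<^bsub>Q\<^esub> X = \<zero>\<^bsub>Q\<^esub>"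
      by (rule bexI[of _ "I +> \<ominus> x"]) (simp_all add: X simps l_neg)
  qed (simp add: simps)
  moreover have "Group.monoid Q"
  proof (rule monoidI)
    fix X Y Z assume "X \<in> carrier Q" "Y \<in> carrier Q" "Z \<in> carrier Q"
    then obtain x y z where [simp]: "x \<in> carrier A" "y \<in> carrier A" "z \<in> carrier A"
      and XYZ: "X = I +> x" "Y = I +> y" "Z = I +> z"
      by (elim quotient_cases)
    show "X \<otimes>\<^bsub>Q\<^esub> Y \<otimes>\<^bsub>Q\<^esub> Z = X \<otimes>\<^bsub>Q\<^esub> (Y \<otimes>\<^bsub>Q\<^esub> Z)"
      by (simp add: XYZ simps m_assoc)
  next
    fix X Y assume "X \<in> carrier Q" "Y \<in> carrier Q"
    then obtain x y where [simp]: "x \<in> carrier A" "y \<in> carrier A" and XY: "X = I +> x" "Y = I +> y"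
      by (elim quotient_cases)
    show "X \<otimes>\<^bsub>Q\<^esub> Y \<in> carrier Q" by (simp add: XY simps)
  next
    fix X assume "X \<in> carrier Q"
    then obtain x where [simp]: "x \<in> carrier A" and X: "X = I +> x" by (rule quotient_cases)
    show "\<one>\<^bsub>Q\<^esub> \<otimes>\<^bsub>Q\<^esub> X = X" "X \<otimes>\<^bsub>Q\<^esub> \<one>\<^bsub>Q\<^esub> = X" by (simp_all add: X simps)
  qed (simp add: simps)
  ultimately show "ring Q"
  proof (rule ringI)
    fix X Y Z assume "X \<in> carrier Q" "Y \<in> carrier Q" "Z \<in> carrier Q"
    then obtain x y z where [simp]: "x \<in> carrier A" "y \<in> carrier A" "z \<in> carrier A"
      and XYZ: "X = I +> x" "Y = I +> y" "Z = I +> z"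
      by (elim quotient_cases)
    show "(X \<oplus>\<^bsub>Q\<^esub> Y) \<otimes>\<^bsub>Q\<^esub> Z = X \<otimes>\<^bsub>Q\<^esub> Z \<oplus>\<^bsub>Q\<^esub> Y \<otimes>\<^bsub>Q\<^esub> Z"
      "Z \<otimes>\<^bsub>Q\<^esub> (X \<oplus>\<^bsub>Q\<^esub> Y) = Z \<otimes>\<^bsub>Q\<^esub> X \<oplus>\<^bsub>Q\<^esub> Z \<otimes>\<^bsub>Q\<^esub> Y"
      by (simp_all add: XYZ simps l_distr r_distr)
  qed
  fix c d and X Y assume "X \<in> carrier Q"
  then obtain x where [simp]: "x \<in> carrier A" and X: "X = I +> x" by (rule quotient_cases)
  show "c \<odot>\<^bsub>Q\<^esub> X \<in> carrier Q" "(c + d) \<odot>\<^bsub>Q\<^esub> X = c \<odot>\<^bsub>Q\<^esub> X \<oplus>\<^bsub>Q\<^esub> d \<odot>\<^bsub>Q\<^esub> X"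
    "(c * d) \<odot>\<^bsub>Q\<^esub> X = c \<odot>\<^bsub>Q\<^esub> (d \<odot>\<^bsub>Q\<^esub> X)" "1 \<odot>\<^bsub>Q\<^esub> X = X"
    by (simp_all add: X simps smult_add_left smult_smult)
  assume "Y \<in> carrier Q"
  then obtain y where [simp]: "y \<in> carrier A" and Y: "Y = I +> y" by (rule quotient_cases)
  show "c \<odot>\<^bsub>Q\<^esub> (X \<oplus>\<^bsub>Q\<^esub> Y) = c \<odot>\<^bsub>Q\<^esub> X \<oplus>\<^bsub>Q\<^esub> c \<odot>\<^bsub>Q\<^esub> Y"
    "(c \<odot>\<^bsub>Q\<^esub> X) \<otimes>\<^bsub>Q\<^esub> Y = c \<odot>\<^bsub>Q\<^esub> (X \<otimes>\<^bsub>Q\<^esub> Y)"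
    "X \<otimes>\<^bsub>Q\<^esub> (c \<odot>\<^bsub>Q\<^esub> Y) = c \<odot>\<^bsub>Q\<^esub> (X \<otimes>\<^bsub>Q\<^esub> Y)"
    by (simp_all add: X Y simps smult_add_right smult_mult_left smult_mult_right)
qed

lemma coset_hom: "(\<lambda>x. I +> x) \<in> algebra_homs A Q"
  by (intro algebra_homsI linear_mapsI) (simp_all add: coset_add coset_mult coset_smult coset_one)

lemma quot_lift_coset:
  assumes B: "complex_algebra B" and f: "f \<in> linear_maps A B"
    and zero: "\<And>x. x \<in> I \<Longrightarrow> f x = \<zero>\<^bsub>B\<^esub>" and x: "x \<in> carrier A"
  shows "quot_lift f (I +> x) = f x"
proof -
  interpret B: complex_algebra B by fact
  have "(SOME y. y \<in> I +> x) \<in> I +> x"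
    using a_rcos_self[OF x] by (metis someI_ex)
  then obtain i where "i \<in> I" "(SOME y. y \<in> I +> x) = i \<oplus> x" by (auto simp: a_r_coset_def')
  then show ?thesis
    using x by (simp add: quot_lift_def linear_maps_add[OF f] a_Hcarr zero linear_maps_closed[OF f])
qed

lemma quot_lift_linear:
  assumes B: "complex_algebra B" and f: "f \<in> linear_maps A B"
    and zero: "\<And>x. x \<in> I \<Longrightarrow> f x = \<zero>\<^bsub>B\<^esub>"
  shows "quot_lift f \<in> linear_maps Q B"
  by (rule linear_mapsI)
    (erule quotient_cases, (erule quotient_cases)?, simp add: coset_add coset_smult
      quot_lift_coset[OF assms] linear_maps_add[OF f] linear_maps_smult[OF f] linear_maps_closed[OF f])+

lemma quot_lift_hom:
  assumes B: "complex_algebra B" and f: "f \<in> algebra_homs A B"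
    and zero: "\<And>x. x \<in> I \<Longrightarrow> f x = \<zero>\<^bsub>B\<^esub>"
  shows "quot_lift f \<in> algebra_homs Q B"
  by (rule algebra_homsI[OF quot_lift_linear[OF B algebra_homs_linear[OF f] zero]], assumption)
    ((erule quotient_cases)?, (erule quotient_cases)?, simp add: coset_mult coset_one
      algebra_homs_mult[OF f] algebra_homs_one[OF f] quot_lift_coset[OF B algebra_homs_linear[OF f] zero])+

end

section \<open>Free algebras, presentations and their universal property\<close>

lemma monoid_free_monoid: "Group.monoid free_monoid"
  by (rule monoidI) (simp_all add: free_monoid_def)

lemma complex_algebra_free_algebra: "complex_algebra free_algebra"
  unfolding free_algebra_def by (rule complex_algebra_monoid_algebra[OF monoid_free_monoid])

lemma carrier_free_algebra [simp]: "carrier free_algebra = UNIV"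
  by (simp add: free_algebra_def free_monoid_def)

definition free_hom :: "(complex, 'b) module \<Rightarrow> ('g \<Rightarrow> 'b) \<Rightarrow> ('g list \<Rightarrow>\<^sub>0 complex) \<Rightarrow> 'b" where
  "free_hom B \<rho> = lin_ext B (\<lambda>w. foldr (\<lambda>g x. \<rho> g \<otimes>\<^bsub>B\<^esub> x) w \<one>\<^bsub>B\<^esub>)"

lemma foldr_mult_closed:
  assumes "complex_algebra B" "\<And>g. \<rho> g \<in> carrier B"
  shows "foldr (\<lambda>g x. \<rho> g \<otimes>\<^bsub>B\<^esub> x) w \<one>\<^bsub>B\<^esub> \<in> carrier B"
proof -
  interpret B: complex_algebra B by fact
  show ?thesis by (induction w) (simp_all add: assms)
qed

lemma foldr_mult_append:
  assumes "complex_algebra B" "\<And>g. \<rho> g \<in> carrier B"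
  shows "foldr (\<lambda>g x. \<rho> g \<otimes>\<^bsub>B\<^esub> x) (v @ w) \<one>\<^bsub>B\<^esub>
    = foldr (\<lambda>g x. \<rho> g \<otimes>\<^bsub>B\<^esub> x) v \<one>\<^bsub>B\<^esub> \<otimes>\<^bsub>B\<^esub> foldr (\<lambda>g x. \<rho> g \<otimes>\<^bsub>B\<^esub> x) w \<one>\<^bsub>B\<^esub>"
proof -
  interpret B: complex_algebra B by fact
  note [simp] = foldr_mult_closed[OF assms]
  show ?thesis by (induction v) (simp_all add: assms(2) B.m_assoc)
qed

lemma free_hom_hom:
  assumes "complex_algebra B" "\<And>g. \<rho> g \<in> carrier B"
  shows "free_hom B \<rho> \<in> algebra_homs free_algebra B"
  unfolding free_hom_def free_algebra_def
  by (rule lin_ext_hom[OF monoid_free_monoid assms(1)])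
    (simp_all only: free_monoid_def monoid.simps foldr_mult_append[OF assms] foldr_mult_closed[OF assms]
      foldr.simps id_apply)

lemma free_hom_gen:
  assumes "complex_algebra B" "\<And>g. \<rho> g \<in> carrier B"
  shows "free_hom B \<rho> (free_gen g) = \<rho> g"
proof -
  interpret B: complex_algebra B by fact
  show ?thesis
    unfolding free_hom_def free_gen_def
    by (subst B.lin_ext_single) (simp_all add: assms(2))
qed

lemma algebra_ideal_relation_ideal: "algebra_ideal free_algebra (relation_ideal R)"
proof -
  interpret complex_algebra free_algebra by (rule complex_algebra_free_algebra)
  have "ideal (relation_ideal R) free_algebra"
    unfolding relation_ideal_def by (rule genideal_ideal) auto
  then show ?thesis
    by (simp add: algebra_ideal_def complex_algebra_free_algebra)
qed

lemma complex_algebra_presented: "complex_algebra (presented_algebra R)"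
  unfolding presented_algebra_def
  by (rule algebra_ideal.complex_algebra_quotient[OF algebra_ideal_relation_ideal])

lemma presented_gen_closed [simp]: "presented_gen R g \<in> carrier (presented_algebra R)"
  unfolding presented_algebra_def presented_gen_def
  by (rule algebra_ideal.coset_closed[OF algebra_ideal_relation_ideal]) simp

lemma presented_proj_hom:
  "(\<lambda>x. relation_ideal R +>\<^bsub>free_algebra\<^esub> x) \<in> algebra_homs free_algebra (presented_algebra R)"
  unfolding presented_algebra_def
  by (rule algebra_ideal.coset_hom[OF algebra_ideal_relation_ideal])

lemma presented_relation:
  assumes "(l, r) \<in> R"
  shows "relation_ideal R +>\<^bsub>free_algebra\<^esub> l = relation_ideal R +>\<^bsub>free_algebra\<^esub> r"
proof -
  interpret algebra_ideal free_algebra "relation_ideal R" by (rule algebra_ideal_relation_ideal)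
  have "l \<ominus>\<^bsub>free_algebra\<^esub> r \<in> relation_ideal R"
    unfolding relation_ideal_def
    by (rule subsetD[OF genideal_self]) (use assms in auto)
  then show ?thesis by (simp add: coset_eq_iff)
qed

text \<open>Serves properties that are not an equality of two homomorphisms. The antipode laws are
  of this kind, as the convolution of \<open>S\<close> with the identity is in general not
  multiplicative.\<close>

lemma presented_induct [consumes 1, case_names gen one add smult mult]:
  assumes x: "x \<in> carrier (presented_algebra R)"
    and gen: "\<And>g. P (presented_gen R g)"
    and one: "P \<one>\<^bsub>presented_algebra R\<^esub>"
    and add: "\<And>x y. \<lbrakk>x \<in> carrier (presented_algebra R); y \<in> carrier (presented_algebra R); P x; P y\<rbrakk>
      \<Longrightarrow> P (x \<oplus>\<^bsub>presented_algebra R\<^esub> y)"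
    and smult: "\<And>c x. \<lbrakk>x \<in> carrier (presented_algebra R); P x\<rbrakk> \<Longrightarrow> P (c \<odot>\<^bsub>presented_algebra R\<^esub> x)"
    and mult: "\<And>x y. \<lbrakk>x \<in> carrier (presented_algebra R); y \<in> carrier (presented_algebra R); P x; P y\<rbrakk>
      \<Longrightarrow> P (x \<otimes>\<^bsub>presented_algebra R\<^esub> y)"
  shows "P x"
proof -
  interpret algebra_ideal free_algebra "relation_ideal R" by (rule algebra_ideal_relation_ideal)
  interpret U: complex_algebra "presented_algebra R" by (rule complex_algebra_presented)
  let ?\<pi> = "\<lambda>x. relation_ideal R +>\<^bsub>free_algebra\<^esub> x"
  note hom = presented_proj_hom[of R]
  note closed = algebra_homs_closed[OF hom]
  have word: "P (?\<pi> (Poly_Mapping.single w 1))" for w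
  proof (induction w)
    case Nil
    have "Poly_Mapping.single [] 1 = (\<one>\<^bsub>free_algebra\<^esub> :: 'a list \<Rightarrow>\<^sub>0 complex)"
      by (simp add: free_algebra_def free_monoid_def)
    then show ?case using one algebra_homs_one[OF hom] by metis
  next
    case (Cons g w)
    have "Poly_Mapping.single (g # w) 1 = free_gen g \<otimes>\<^bsub>free_algebra\<^esub> Poly_Mapping.single w 1"
      by (simp add: free_gen_def free_algebra_def monoid_algebra_single) (simp add: free_monoid_def)
    then have "?\<pi> (Poly_Mapping.single (g # w) 1)
        = presented_gen R g \<otimes>\<^bsub>presented_algebra R\<^esub> ?\<pi> (Poly_Mapping.single w 1)"
      using algebra_homs_mult[OF hom, of "free_gen g" "Poly_Mapping.single w 1"]
      by (simp add: presented_gen_def)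
    then show ?case using mult[OF _ _ gen Cons] closed by simp
  qed
  have s: "P (?\<pi> (Poly_Mapping.single w c))" for w c
  proof -
    have "Poly_Mapping.single w c = c \<odot>\<^bsub>free_algebra\<^esub> Poly_Mapping.single w 1"
      by (simp add: free_algebra_def)
    then show ?thesis
      using smult[OF closed word[of w], of c] algebra_homs_smult[OF hom, of "Poly_Mapping.single w 1" c]
      by simp
  qed
  from x obtain f where f: "x = ?\<pi> f"
    unfolding presented_algebra_def by (auto elim: quotient_cases)
  have "Poly_Mapping.keys f \<subseteq> UNIV" by simp
  then have "P (?\<pi> f)"
  proof (induction rule: poly_mapping_span_induct)
    case zero
    show ?case using s[of undefined 0] by simp
  next
    case (single p c f)
    then have "P (?\<pi> (Poly_Mapping.single p c) \<oplus>\<^bsub>presented_algebra R\<^esub> ?\<pi> f)"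
      using add[OF closed closed s] by simp
    moreover have "Poly_Mapping.single p c + f = Poly_Mapping.single p c \<oplus>\<^bsub>free_algebra\<^esub> f"
      by (simp add: free_algebra_def)
    ultimately show ?case
      using algebra_homs_add[OF hom, of "Poly_Mapping.single p c" f] by simp
  qed
  with f show ?thesis by simp
qed

lemma algebra_homs_presented_eq:
  assumes f: "f \<in> algebra_homs (presented_algebra R) B"
    and g: "g \<in> algebra_homs (presented_algebra R) B"
    and eq: "\<And>a. f (presented_gen R a) = g (presented_gen R a)"
    and x: "x \<in> carrier (presented_algebra R)"
  shows "f x = g x"
  using x
  by (induction rule: presented_induct)
    (simp_all add: eq algebra_homs_one[OF f] algebra_homs_one[OF g] algebra_homs_add[OF f]
      algebra_homs_add[OF g] algebra_homs_smult[OF f] algebra_homs_smult[OF g]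
      algebra_homs_mult[OF f] algebra_homs_mult[OF g])

definition presented_hom ::
  "(complex, 'b) module \<Rightarrow> ('g \<Rightarrow> 'b) \<Rightarrow> ('g list \<Rightarrow>\<^sub>0 complex) set \<Rightarrow> 'b" where
  "presented_hom B \<rho> = quot_lift (free_hom B \<rho>)"

context
  fixes B :: "(complex, 'b) module" and \<rho> :: "'g \<Rightarrow> 'b" and R
  assumes B: "complex_algebra B" and \<rho>: "\<And>g. \<rho> g \<in> carrier B"
    and rel: "\<And>l r. (l, r) \<in> R \<Longrightarrow> free_hom B \<rho> l = free_hom B \<rho> r"
begin

interpretation B: complex_algebra B by (rule B)
interpretation algebra_ideal free_algebra "relation_ideal R" by (rule algebra_ideal_relation_ideal)

text \<open>The kernel of the homomorphism is a two-sided ideal that contains every relator, hence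
  contains the ideal they generate.\<close>

lemma free_hom_relation_ideal: "x \<in> relation_ideal R \<Longrightarrow> free_hom B \<rho> x = \<zero>\<^bsub>B\<^esub>"
proof -
  note hom = free_hom_hom[of B \<rho>, OF B \<rho>]
  note lin = algebra_homs_linear[OF hom]
  note closed = algebra_homs_closed[OF hom]
  let ?K = "{x. free_hom B \<rho> x = \<zero>\<^bsub>B\<^esub>}"
  have "ideal ?K free_algebra"
  proof (rule idealI)
    show "subgroup ?K (add_monoid free_algebra)"
    proof (rule add.subgroupI)
      show "?K \<noteq> {}"
        using linear_maps_zero[OF complex_algebra_free_algebra B lin] by auto
    next
      fix a assume "a \<in> ?K"
      then show "\<ominus>\<^bsub>free_algebra\<^esub> a \<in> ?K"
        using linear_maps_minus(1)[OF complex_algebra_free_algebra B lin, of a] by simp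
    qed (simp_all add: linear_maps_add[OF lin])
  qed (simp_all add: ring_axioms algebra_homs_mult[OF hom] closed)
  moreover have "{l \<ominus>\<^bsub>free_algebra\<^esub> r | l r. (l, r) \<in> R} \<subseteq> ?K"
    using rel linear_maps_minus(2)[OF complex_algebra_free_algebra B lin] closed
    by (auto simp: B.r_neg B.minus_eq)
  ultimately have "relation_ideal R \<subseteq> ?K"
    unfolding relation_ideal_def by (rule genideal_minimal)
  then show "x \<in> relation_ideal R \<Longrightarrow> free_hom B \<rho> x = \<zero>\<^bsub>B\<^esub>" by auto
qed

lemma presented_hom_hom: "presented_hom B \<rho> \<in> algebra_homs (presented_algebra R) B"
  unfolding presented_hom_def presented_algebra_def
  by (rule quot_lift_hom[OF B free_hom_hom[of B \<rho>, OF B \<rho>] free_hom_relation_ideal])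

lemma presented_hom_gen: "presented_hom B \<rho> (presented_gen R g) = \<rho> g"
  unfolding presented_hom_def presented_gen_def
  by (subst quot_lift_coset[OF B algebra_homs_linear[OF free_hom_hom[of B \<rho>, OF B \<rho>]]
        free_hom_relation_ideal])
    (simp_all add: free_hom_gen[of B \<rho>, OF B \<rho>])

end


section \<open>Tensor products\<close>

definition bilinear_maps ::
  "(complex, 'a) module \<Rightarrow> (complex, 'b) module \<Rightarrow> (complex, 'c) module \<Rightarrow> ('a \<Rightarrow> 'b \<Rightarrow> 'c) set" where
  "bilinear_maps A B C = {\<phi>. (\<forall>a\<in>carrier A. \<phi> a \<in> linear_maps B C) \<and>
     (\<forall>b\<in>carrier B. (\<lambda>a. \<phi> a b) \<in> linear_maps A C)}"

lemma bilinear_mapsI: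
  assumes "\<And>a. a \<in> carrier A \<Longrightarrow> \<phi> a \<in> linear_maps B C"
    and "\<And>b. b \<in> carrier B \<Longrightarrow> (\<lambda>a. \<phi> a b) \<in> linear_maps A C"
  shows "\<phi> \<in> bilinear_maps A B C"
  using assms by (auto simp: bilinear_maps_def)

lemma bilinear_maps_linear:
  assumes "\<phi> \<in> bilinear_maps A B C"
  shows "a \<in> carrier A \<Longrightarrow> \<phi> a \<in> linear_maps B C"
    and "b \<in> carrier B \<Longrightarrow> (\<lambda>a. \<phi> a b) \<in> linear_maps A C"
  using assms by (auto simp: bilinear_maps_def)

interpretation pm: Modules.module pm_scale
  by unfold_locales
    (auto intro!: poly_mapping_eqI simp: lookup_pm_scale lookup_add algebra_simps)

lemma keys_diff_subset:
  fixes f g :: "'m \<Rightarrow>\<^sub>0 complex"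
  shows "\<lbrakk>Poly_Mapping.keys f \<subseteq> S; Poly_Mapping.keys g \<subseteq> S\<rbrakk> \<Longrightarrow> Poly_Mapping.keys (f - g) \<subseteq> S"
  using keys_add_subset[of f S "- g"] by simp

lemma monoid_algebra_diff:
  "(f - f') \<otimes>\<^bsub>monoid_algebra M\<^esub> g = f \<otimes>\<^bsub>monoid_algebra M\<^esub> g - f' \<otimes>\<^bsub>monoid_algebra M\<^esub> g"
  "f \<otimes>\<^bsub>monoid_algebra M\<^esub> (g - g') = f \<otimes>\<^bsub>monoid_algebra M\<^esub> g - f \<otimes>\<^bsub>monoid_algebra M\<^esub> g'"
  using monoid_algebra_add_left[of M "f - f'" f' g] monoid_algebra_add_right[of M f "g - g'" g']
  by (simp_all add: algebra_simps)

section \<open>Algebra structure and universal property of a tensor product\<close>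

locale tensor_product = A: complex_algebra A + B: complex_algebra B
  for A :: "(complex, 'a) module" and B :: "(complex, 'b) module"
begin

abbreviation "P \<equiv> monoid_algebra (A \<times>\<times> B)"
abbreviation "AB \<equiv> tensor_algebra A B"

lemma monoid_prod: "Group.monoid (A \<times>\<times> B)"
  by (rule DirProd_monoid[OF A.monoid_axioms B.monoid_axioms])

sublocale P: complex_algebra P
  by (rule complex_algebra_monoid_algebra[OF monoid_prod])

lemma relators_closed: "x \<in> bilinear_relators A B \<Longrightarrow> x \<in> carrier P"
  unfolding bilinear_relators_def
  by (elim UnE CollectE exE conjE) (simp_all add: keys_diff_subset)

lemma span_closed: "x \<in> bilinear_span A B \<Longrightarrow> x \<in> carrier P"
  unfolding bilinear_span_def
proof (induction rule: pm.span_induct_alt)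
  case (step c x y)
  then show ?case
    using relators_closed[of x] P.smult_closed[of x c] by (simp add: keys_add_subset)
qed simp

lemma scaled_relator: "\<lbrakk>x \<in> bilinear_relators A B; y = pm_scale d x\<rbrakk> \<Longrightarrow> y \<in> bilinear_span A B"
  unfolding bilinear_span_def by (simp add: pm.span_base pm.span_scale)

text \<open>The defining relators have leading coefficient 1, but a product with a basis pair of
  coefficient \<open>d\<close> scales all their terms; this and the next three lemmas admit the
  factor \<open>d\<close>.\<close>

lemma relators_add_left:
  "\<lbrakk>a \<in> carrier A; a' \<in> carrier A; b \<in> carrier B\<rbrakk> \<Longrightarrow>
    Poly_Mapping.single (a \<oplus>\<^bsub>A\<^esub> a', b) d - Poly_Mapping.single (a, b) d
      - Poly_Mapping.single (a', b) d \<in> bilinear_span A B"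
  by (rule scaled_relator[of "Poly_Mapping.single (a \<oplus>\<^bsub>A\<^esub> a', b) 1 - Poly_Mapping.single (a, b) 1
        - Poly_Mapping.single (a', b) 1"])
    (auto simp: bilinear_relators_def pm.scale_right_diff_distrib)

lemma relators_add_right:
  "\<lbrakk>a \<in> carrier A; b \<in> carrier B; b' \<in> carrier B\<rbrakk> \<Longrightarrow>
    Poly_Mapping.single (a, b \<oplus>\<^bsub>B\<^esub> b') d - Poly_Mapping.single (a, b) d
      - Poly_Mapping.single (a, b') d \<in> bilinear_span A B"
  by (rule scaled_relator[of "Poly_Mapping.single (a, b \<oplus>\<^bsub>B\<^esub> b') 1 - Poly_Mapping.single (a, b) 1
        - Poly_Mapping.single (a, b') 1"])
    (auto simp: bilinear_relators_def pm.scale_right_diff_distrib)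

lemma relators_smult_left:
  "\<lbrakk>a \<in> carrier A; b \<in> carrier B\<rbrakk> \<Longrightarrow>
    Poly_Mapping.single (c \<odot>\<^bsub>A\<^esub> a, b) d - Poly_Mapping.single (a, b) (c * d) \<in> bilinear_span A B"
  by (rule scaled_relator[of "Poly_Mapping.single (c \<odot>\<^bsub>A\<^esub> a, b) 1 - Poly_Mapping.single (a, b) c"])
    (auto simp: bilinear_relators_def pm.scale_right_diff_distrib mult.commute)

lemma relators_smult_right:
  "\<lbrakk>a \<in> carrier A; b \<in> carrier B\<rbrakk> \<Longrightarrow>
    Poly_Mapping.single (a, c \<odot>\<^bsub>B\<^esub> b) d - Poly_Mapping.single (a, b) (c * d) \<in> bilinear_span A B"
  by (rule scaled_relator[of "Poly_Mapping.single (a, c \<odot>\<^bsub>B\<^esub> b) 1 - Poly_Mapping.single (a, b) c"])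
    (auto simp: bilinear_relators_def pm.scale_right_diff_distrib mult.commute)

lemmas relators_scale = relators_add_left relators_add_right relators_smult_left relators_smult_right

lemma relators_mult_single:
  assumes "x \<in> bilinear_relators A B" "a' \<in> carrier A" "b' \<in> carrier B"
  shows "x \<otimes>\<^bsub>P\<^esub> Poly_Mapping.single (a', b') d \<in> bilinear_span A B"
    and "Poly_Mapping.single (a', b') d \<otimes>\<^bsub>P\<^esub> x \<in> bilinear_span A B"
  using assms unfolding bilinear_relators_def
  by (auto simp: monoid_algebra_single monoid_algebra_diff A.l_distr A.r_distr B.l_distr B.r_distr
      A.smult_mult_left A.smult_mult_right B.smult_mult_left B.smult_mult_right mult.commute[of d]
      relators_scale)

lemma relators_mult:
  assumes "x \<in> bilinear_relators A B" "y \<in> carrier P"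
  shows "x \<otimes>\<^bsub>P\<^esub> y \<in> bilinear_span A B" and "y \<otimes>\<^bsub>P\<^esub> x \<in> bilinear_span A B"
proof -
  from assms(2) have "Poly_Mapping.keys y \<subseteq> carrier (A \<times>\<times> B)" by simp
  then have "x \<otimes>\<^bsub>P\<^esub> y \<in> bilinear_span A B \<and> y \<otimes>\<^bsub>P\<^esub> x \<in> bilinear_span A B"
  proof (induction rule: poly_mapping_span_induct)
    case zero
    then show ?case by (simp add: bilinear_span_def pm.span_zero)
  next
    case (single p c f)
    then show ?case
      using relators_mult_single[OF assms(1), of "fst p" "snd p" c]
      by (auto simp: monoid_algebra_add_left monoid_algebra_add_right DirProd_def bilinear_span_def
          intro: pm.span_add)
  qed
  then show "x \<otimes>\<^bsub>P\<^esub> y \<in> bilinear_span A B" and "y \<otimes>\<^bsub>P\<^esub> x \<in> bilinear_span A B" by auto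
qed

lemma span_mult:
  assumes "x \<in> bilinear_span A B" "y \<in> carrier P"
  shows "x \<otimes>\<^bsub>P\<^esub> y \<in> bilinear_span A B \<and> y \<otimes>\<^bsub>P\<^esub> x \<in> bilinear_span A B"
  using assms(1)[unfolded bilinear_span_def]
proof (induction rule: pm.span_induct_alt)
  case base
  then show ?case by (simp add: bilinear_span_def pm.span_zero)
next
  case (step c x z)
  have "pm_scale c x \<otimes>\<^bsub>P\<^esub> y = pm_scale c (x \<otimes>\<^bsub>P\<^esub> y)"
    "y \<otimes>\<^bsub>P\<^esub> pm_scale c x = pm_scale c (y \<otimes>\<^bsub>P\<^esub> x)"
    using P.smult_mult_left[of x y c] P.smult_mult_right[of y x c] relators_closed[OF step(1)] assms(2)
    by simp_all
  then show ?case
    using step relators_mult[OF step(1) assms(2)]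
    by (simp add: monoid_algebra_add_left monoid_algebra_add_right bilinear_span_def
        pm.span_add pm.span_scale)
qed

sublocale algebra_ideal P "bilinear_span A B"
proof -
  have "ideal (bilinear_span A B) P"
  proof (rule idealI)
    show "subgroup (bilinear_span A B) (add_monoid P)"
    proof (rule P.add.subgroupI)
      show "bilinear_span A B \<subseteq> carrier P" using span_closed by auto
      show "bilinear_span A B \<noteq> {}" using pm.span_zero by (auto simp: bilinear_span_def)
    next
      fix a assume a: "a \<in> bilinear_span A B"
      have "\<ominus>\<^bsub>P\<^esub> a = - a"
        using span_closed[OF a] by (intro P.minus_equality) simp_all
      with a show "\<ominus>\<^bsub>P\<^esub> a \<in> bilinear_span A B"
        by (simp add: bilinear_span_def pm.span_neg)
    qed (auto simp: bilinear_span_def pm.span_add)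
  qed (use span_mult P.ring_axioms in auto)
  then show "algebra_ideal P (bilinear_span A B)"
    by (simp add: algebra_ideal_def P.complex_algebra_axioms)
qed

sublocale AB: complex_algebra AB
  unfolding tensor_algebra_def by (rule complex_algebra_quotient)

abbreviation tensor (infixl \<open>\<boxdot>\<close> 72) where "a \<boxdot> b \<equiv> pure_tensor A B a b"

lemma single_closed: "\<lbrakk>a \<in> carrier A; b \<in> carrier B\<rbrakk> \<Longrightarrow> Poly_Mapping.single (a, b) c \<in> carrier P"
  by simp

lemma pure_closed [simp, intro]: "\<lbrakk>a \<in> carrier A; b \<in> carrier B\<rbrakk> \<Longrightarrow> a \<boxdot> b \<in> carrier AB"
  unfolding tensor_algebra_def pure_tensor_def by (rule coset_closed) simp

lemma pure_mult:
  "\<lbrakk>a \<in> carrier A; b \<in> carrier B; a' \<in> carrier A; b' \<in> carrier B\<rbrakk> \<Longrightarrow>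
    (a \<boxdot> b) \<otimes>\<^bsub>AB\<^esub> (a' \<boxdot> b') = (a \<otimes>\<^bsub>A\<^esub> a') \<boxdot> (b \<otimes>\<^bsub>B\<^esub> b')"
  unfolding tensor_algebra_def pure_tensor_def
  by (subst coset_mult) (simp_all add: monoid_algebra_single)

lemma pure_one: "\<one>\<^bsub>AB\<^esub> = \<one>\<^bsub>A\<^esub> \<boxdot> \<one>\<^bsub>B\<^esub>"
  unfolding tensor_algebra_def pure_tensor_def by (simp add: coset_one)

lemma P_minus: "\<lbrakk>x \<in> carrier P; y \<in> carrier P\<rbrakk> \<Longrightarrow> x \<ominus>\<^bsub>P\<^esub> y = x - y"
  by (subst P.minus_eq, subst P.minus_equality[of "- y" y]) simp_all

lemma pure_bilinear: "pure_tensor A B \<in> bilinear_maps A B AB"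
proof -
  have eq: "bilinear_span A B +>\<^bsub>P\<^esub> x = bilinear_span A B +>\<^bsub>P\<^esub> y"
    if "x - y \<in> bilinear_span A B" "x \<in> carrier P" "y \<in> carrier P" for x y
    using that by (simp add: coset_eq_iff P_minus)
  have add_l: "(a \<oplus>\<^bsub>A\<^esub> a') \<boxdot> b = (a \<boxdot> b) \<oplus>\<^bsub>AB\<^esub> (a' \<boxdot> b)"
    if "a \<in> carrier A" "a' \<in> carrier A" "b \<in> carrier B" for a a' b
    unfolding tensor_algebra_def pure_tensor_def
    using that relators_scale(1)[OF that, of 1]
    by (subst coset_add, simp, simp, intro eq) (simp_all add: keys_add_subset algebra_simps)
  have add_r: "a \<boxdot> (b \<oplus>\<^bsub>B\<^esub> b') = (a \<boxdot> b) \<oplus>\<^bsub>AB\<^esub> (a \<boxdot> b')"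
    if "a \<in> carrier A" "b \<in> carrier B" "b' \<in> carrier B" for a b b'
    unfolding tensor_algebra_def pure_tensor_def
    using that relators_scale(2)[OF that, of 1]
    by (subst coset_add, simp, simp, intro eq) (simp_all add: keys_add_subset algebra_simps)
  have smult_l: "(c \<odot>\<^bsub>A\<^esub> a) \<boxdot> b = c \<odot>\<^bsub>AB\<^esub> (a \<boxdot> b)"
    if "a \<in> carrier A" "b \<in> carrier B" for a b c
    unfolding tensor_algebra_def pure_tensor_def
    using that relators_scale(3)[OF that, of c 1]
    by (subst coset_smult, simp, intro eq) auto
  have smult_r: "a \<boxdot> (c \<odot>\<^bsub>B\<^esub> b) = c \<odot>\<^bsub>AB\<^esub> (a \<boxdot> b)"
    if "a \<in> carrier A" "b \<in> carrier B" for a b c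
    unfolding tensor_algebra_def pure_tensor_def
    using that relators_scale(4)[OF that, of c 1]
    by (subst coset_smult, simp, intro eq) auto
  show ?thesis
    by (intro bilinear_mapsI linear_mapsI) (simp_all add: add_l add_r smult_l smult_r)
qed

text \<open>Every element is the coset of a combination of basis pairs, and the coset of a pair is a
  pure tensor. This replaces any work with representatives: later identities are first seen to be
  linear and then checked on pure tensors.\<close>

lemma linear_maps_tensor_eq:
  assumes C: "complex_algebra C" and f: "f \<in> linear_maps AB C" and g: "g \<in> linear_maps AB C"
    and eq: "\<And>a b. \<lbrakk>a \<in> carrier A; b \<in> carrier B\<rbrakk> \<Longrightarrow> f (a \<boxdot> b) = g (a \<boxdot> b)"
    and x: "x \<in> carrier AB"
  shows "f x = g x"
proof -
  let ?\<pi> = "\<lambda>x. bilinear_span A B +>\<^bsub>P\<^esub> x"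
  have \<pi>: "?\<pi> \<in> linear_maps P AB"
    unfolding tensor_algebra_def by (rule algebra_homs_linear[OF coset_hom])
  from x obtain y where y: "y \<in> carrier P" "x = ?\<pi> y"
    unfolding tensor_algebra_def by (elim quotient_cases) blast
  have "f (?\<pi> y) = g (?\<pi> y)"
    by (rule linear_maps_monoid_algebra_eq[OF monoid_prod C linear_maps_compose[OF \<pi> f]
          linear_maps_compose[OF \<pi> g] _ y(1)])
      (use eq in \<open>auto simp: pure_tensor_def\<close>)
  with y show ?thesis by simp
qed

context
  fixes C :: "(complex, 'c) module" and \<phi> :: "'a \<Rightarrow> 'b \<Rightarrow> 'c"
  assumes C: "complex_algebra C" and \<phi>: "\<phi> \<in> bilinear_maps A B C"
begin

interpretation C: complex_algebra C by (rule C)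

lemma tensor_lift_quot_lift: "tensor_lift C \<phi> = quot_lift (lin_ext C (\<lambda>p. \<phi> (fst p) (snd p)))"
  by (rule ext) (simp add: tensor_lift_def quot_lift_def lin_ext_def Let_def)

lemma bilinear_closed [simp]: "\<lbrakk>a \<in> carrier A; b \<in> carrier B\<rbrakk> \<Longrightarrow> \<phi> a b \<in> carrier C"
  by (rule linear_maps_closed[OF bilinear_maps_linear(1)[OF \<phi>]])

lemma lin_ext_bilinear: "lin_ext C (\<lambda>p. \<phi> (fst p) (snd p)) \<in> linear_maps P C"
  by (rule lin_ext_linear[OF C]) auto

lemma lin_ext_bilinear_single:
  "\<lbrakk>a \<in> carrier A; b \<in> carrier B\<rbrakk> \<Longrightarrow>
    lin_ext C (\<lambda>p. \<phi> (fst p) (snd p)) (Poly_Mapping.single (a, b) c) = c \<odot>\<^bsub>C\<^esub> \<phi> a b"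
  by (subst C.lin_ext_single) simp_all

text \<open>Each of the four kinds of relator is killed by the corresponding additivity or
  homogeneity of \<open>\<phi>\<close>. Membership in the carrier is proved along with it, because
  the extension is known to be linear only there.\<close>

lemma lin_ext_bilinear_span:
  assumes "x \<in> bilinear_span A B"
  shows "lin_ext C (\<lambda>p. \<phi> (fst p) (snd p)) x = \<zero>\<^bsub>C\<^esub>"
proof -
  from assms have "x \<in> carrier P \<and> lin_ext C (\<lambda>p. \<phi> (fst p) (snd p)) x = \<zero>\<^bsub>C\<^esub>"
    unfolding bilinear_span_def
  proof (induction rule: pm.span_induct_alt)
  case (step c x y)
  let ?f = "lin_ext C (\<lambda>p. \<phi> (fst p) (snd p))"
  note lin = lin_ext_bilinear
  have minus: "?f (x - y) = ?f x \<ominus>\<^bsub>C\<^esub> ?f y" if "x \<in> carrier P" "y \<in> carrier P" for x y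
    using linear_maps_minus(2)[OF P.complex_algebra_axioms C lin that] P_minus[OF that] by simp
  have "?f x = \<zero>\<^bsub>C\<^esub>"
    using step(1) unfolding bilinear_relators_def
    by (auto simp: minus lin_ext_bilinear_single keys_diff_subset
        linear_maps_add[OF bilinear_maps_linear(1)[OF \<phi>]] linear_maps_add[OF bilinear_maps_linear(2)[OF \<phi>]]
        linear_maps_smult[OF bilinear_maps_linear(1)[OF \<phi>]]
        linear_maps_smult[OF bilinear_maps_linear(2)[OF \<phi>]] C.add_diff_cancel C.r_neg[folded C.minus_eq])
  moreover have "x \<in> carrier P" "y \<in> carrier P"
    using relators_closed[OF step(1)] step(2) by auto
  ultimately show ?case
    using linear_maps_add[OF lin, of "pm_scale c x" y] linear_maps_smult[OF lin, of x c] step(2)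
      P.smult_closed[of x c]
    by (simp add: keys_add_subset)
  qed simp
  then show ?thesis by simp
qed

lemma tensor_lift_pure:
  assumes "a \<in> carrier A" "b \<in> carrier B"
  shows "tensor_lift C \<phi> (a \<boxdot> b) = \<phi> a b"
  unfolding tensor_lift_quot_lift pure_tensor_def
  using quot_lift_coset[OF C lin_ext_bilinear lin_ext_bilinear_span single_closed[OF assms, of 1]] assms
  by (simp add: lin_ext_bilinear_single)

lemma tensor_lift_linear: "tensor_lift C \<phi> \<in> linear_maps AB C"
  unfolding tensor_lift_quot_lift tensor_algebra_def
  by (rule quot_lift_linear[OF C lin_ext_bilinear lin_ext_bilinear_span])

end

text \<open>As in \<open>lin_ext_hom\<close>, one factor is frozen at a time and the two sides are
  compared as linear maps in the other.\<close>

lemma hom_on_pureI: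
  assumes C: "complex_algebra C" and f: "f \<in> linear_maps AB C"
    and mult: "\<And>a b a' b'. \<lbrakk>a \<in> carrier A; b \<in> carrier B; a' \<in> carrier A; b' \<in> carrier B\<rbrakk> \<Longrightarrow>
      f ((a \<otimes>\<^bsub>A\<^esub> a') \<boxdot> (b \<otimes>\<^bsub>B\<^esub> b')) = f (a \<boxdot> b) \<otimes>\<^bsub>C\<^esub> f (a' \<boxdot> b')"
    and one: "f (\<one>\<^bsub>A\<^esub> \<boxdot> \<one>\<^bsub>B\<^esub>) = \<one>\<^bsub>C\<^esub>"
  shows "f \<in> algebra_homs AB C"
proof (rule algebra_homsI[OF f])
  interpret C: complex_algebra C by fact
  note AB = AB.complex_algebra_axioms
  note closed = linear_maps_closed[OF f]
  fix x y assume x: "x \<in> carrier AB" and y: "y \<in> carrier AB"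
  show "f (x \<otimes>\<^bsub>AB\<^esub> y) = f x \<otimes>\<^bsub>C\<^esub> f y"
  proof (rule linear_maps_tensor_eq[OF C
        linear_maps_compose[OF linear_maps_mult_right[OF AB linear_maps_id y] f]
        linear_maps_mult_right[OF C f closed[OF y]] _ x])
    fix a b assume ab: "a \<in> carrier A" "b \<in> carrier B"
    then have t: "a \<boxdot> b \<in> carrier AB" by blast
    show "f ((a \<boxdot> b) \<otimes>\<^bsub>AB\<^esub> y) = f (a \<boxdot> b) \<otimes>\<^bsub>C\<^esub> f y"
      by (rule linear_maps_tensor_eq[OF C
            linear_maps_compose[OF linear_maps_mult_left[OF AB linear_maps_id t] f]
            linear_maps_mult_left[OF C f closed[OF t]] _ y])
        (simp add: pure_mult ab mult)
  qed
qed (simp add: pure_one one)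

end

section \<open>Functoriality of the tensor product\<close>

lemma tensor_map_bilinear:
  assumes "complex_algebra C" "complex_algebra D"
    and f: "f \<in> linear_maps A C" and g: "g \<in> linear_maps B D"
  shows "(\<lambda>a b. pure_tensor C D (f a) (g b)) \<in> bilinear_maps A B (tensor_algebra C D)"
proof -
  interpret CD: tensor_product C D using assms by (simp add: tensor_product_def)
  note bl = bilinear_maps_linear[OF CD.pure_bilinear]
  show ?thesis
    by (rule bilinear_mapsI)
      (simp_all add: linear_maps_compose[OF g bl(1)[OF linear_maps_closed[OF f]]]
        linear_maps_compose[OF f bl(2)[OF linear_maps_closed[OF g]]])
qed

lemma tensor_map_pure:
  assumes "complex_algebra A" "complex_algebra B" "complex_algebra C" "complex_algebra D"
    and "f \<in> linear_maps A C" "g \<in> linear_maps B D" and "a \<in> carrier A" "b \<in> carrier B"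
  shows "tensor_map C D f g (pure_tensor A B a b) = pure_tensor C D (f a) (g b)"
proof -
  interpret AB: tensor_product A B using assms by (simp add: tensor_product_def)
  interpret CD: tensor_product C D using assms by (simp add: tensor_product_def)
  show ?thesis
    unfolding tensor_map_def
    by (rule AB.tensor_lift_pure[OF CD.AB.complex_algebra_axioms tensor_map_bilinear]) (use assms in auto)
qed

lemma tensor_map_linear:
  assumes "complex_algebra A" "complex_algebra B" "complex_algebra C" "complex_algebra D"
    and "f \<in> linear_maps A C" "g \<in> linear_maps B D"
  shows "tensor_map C D f g \<in> linear_maps (tensor_algebra A B) (tensor_algebra C D)"
proof -
  interpret AB: tensor_product A B using assms by (simp add: tensor_product_def)
  interpret CD: tensor_product C D using assms by (simp add: tensor_product_def)
  show ?thesis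
    unfolding tensor_map_def
    by (rule AB.tensor_lift_linear[OF CD.AB.complex_algebra_axioms tensor_map_bilinear]) (use assms in auto)
qed

lemma tensor_map_hom:
  assumes A: "complex_algebra A" "complex_algebra B" "complex_algebra C" "complex_algebra D"
    and f: "f \<in> algebra_homs A C" and g: "g \<in> algebra_homs B D"
  shows "tensor_map C D f g \<in> algebra_homs (tensor_algebra A B) (tensor_algebra C D)"
proof -
  interpret AB: tensor_product A B using assms by (simp add: tensor_product_def)
  interpret CD: tensor_product C D using assms by (simp add: tensor_product_def)
  note lin = f[THEN algebra_homs_linear] g[THEN algebra_homs_linear]
  note [simp] = tensor_map_pure[OF A lin] algebra_homs_mult[OF f] algebra_homs_mult[OF g]
    algebra_homs_one[OF f] algebra_homs_one[OF g] linear_maps_closed[OF lin(1)] linear_maps_closed[OF lin(2)]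
  show ?thesis
    by (rule AB.hom_on_pureI[OF CD.AB.complex_algebra_axioms tensor_map_linear[OF A lin]])
      (simp_all add: CD.pure_mult CD.pure_one)
qed

section \<open>The associativity and counit maps as homomorphisms\<close>

context complex_algebra
begin

abbreviation "A2 \<equiv> tensor_algebra A A"
abbreviation "A3 \<equiv> tensor_algebra A A2"

interpretation A2: tensor_product A A
  by (simp add: tensor_product_def complex_algebra_axioms)
interpretation A3: tensor_product A A2
  by (simp add: tensor_product_def complex_algebra_axioms A2.AB.complex_algebra_axioms)
interpretation A3': tensor_product A2 A
  by (simp add: tensor_product_def complex_algebra_axioms A2.AB.complex_algebra_axioms)

lemma complex_algebra_tensor: "complex_algebra A2" "complex_algebra A3"
  by (rule A2.AB.complex_algebra_axioms A3.AB.complex_algebra_axioms)+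

lemma assoc_inner_bilinear:
  assumes c: "c \<in> carrier A"
  shows "(\<lambda>a b. pure_tensor A A2 a (pure_tensor A A b c)) \<in> bilinear_maps A A A3"
proof (rule bilinear_mapsI)
  note l2 = bilinear_maps_linear[OF A2.pure_bilinear] and l3 = bilinear_maps_linear[OF A3.pure_bilinear]
  fix a assume a: "a \<in> carrier A"
  show "(\<lambda>b. pure_tensor A A2 a (pure_tensor A A b c)) \<in> linear_maps A A3"
    by (rule linear_maps_compose[OF l2(2)[OF c] l3(1)[OF a]])
  show "(\<lambda>b. pure_tensor A A2 b (pure_tensor A A a c)) \<in> linear_maps A A3"
    by (rule l3(2)[OF A2.pure_closed[OF a c]])
qed

lemmas assoc_inner_pure =
  A2.tensor_lift_pure[OF A3.AB.complex_algebra_axioms assoc_inner_bilinear]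
lemmas assoc_inner_linear =
  A2.tensor_lift_linear[OF A3.AB.complex_algebra_axioms assoc_inner_bilinear]

text \<open>Linearity in \<open>c\<close> is the delicate half, because \<open>c\<close> sits inside
  the map that is lifted. For fixed \<open>c\<close> and \<open>d\<close> both sides of the required
  identity are linear in \<open>t\<close>, so they may be compared on pure tensors, where
  bilinearity of the tensor symbol decides.\<close>

lemma assoc_bilinear:
  "(\<lambda>t c. tensor_lift A3 (\<lambda>a b. pure_tensor A A2 a (pure_tensor A A b c)) t) \<in> bilinear_maps A2 A A3"
  (is "?\<phi> \<in> _")
proof (rule bilinear_mapsI)
  fix t assume t: "t \<in> carrier A2"
  note l1 = linear_maps_add[OF bilinear_maps_linear(1)[OF A2.pure_bilinear]]
    linear_maps_add[OF bilinear_maps_linear(1)[OF A3.pure_bilinear]]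
    linear_maps_smult[OF bilinear_maps_linear(1)[OF A2.pure_bilinear]]
    linear_maps_smult[OF bilinear_maps_linear(1)[OF A3.pure_bilinear]]
  show "?\<phi> t \<in> linear_maps A A3"
  proof (rule linear_mapsI)
    fix c d and k assume cd [simp]: "c \<in> carrier A" "d \<in> carrier A"
    show "?\<phi> t (c \<oplus> d) = ?\<phi> t c \<oplus>\<^bsub>A3\<^esub> ?\<phi> t d"
      by (rule A2.linear_maps_tensor_eq[OF complex_algebra_tensor(2) _ _ _ t, of "\<lambda>t. ?\<phi> t (c \<oplus> d)"])
        (simp_all add: assoc_inner_pure assoc_inner_linear linear_maps_sum complex_algebra_tensor l1)
  next
    fix k and c assume c [simp]: "c \<in> carrier A"
    show "?\<phi> t c \<in> carrier A3"
      by (rule linear_maps_closed[OF assoc_inner_linear[OF c] t])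
    show "?\<phi> t (k \<odot> c) = k \<odot>\<^bsub>A3\<^esub> ?\<phi> t c"
      by (rule A2.linear_maps_tensor_eq[OF complex_algebra_tensor(2) _ _ _ t, of "\<lambda>t. ?\<phi> t (k \<odot> c)"])
        (simp_all add: assoc_inner_pure assoc_inner_linear linear_maps_scaled complex_algebra_tensor l1)
  qed
qed (rule assoc_inner_linear)

lemma tensor_assoc_pure':
  "\<lbrakk>t \<in> carrier A2; c \<in> carrier A\<rbrakk> \<Longrightarrow> tensor_assoc A (pure_tensor A2 A t c)
    = tensor_lift A3 (\<lambda>a b. pure_tensor A A2 a (pure_tensor A A b c)) t"
  unfolding tensor_assoc_def Let_def
  by (rule A3'.tensor_lift_pure[OF complex_algebra_tensor(2) assoc_bilinear])

lemma tensor_assoc_pure: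
  "\<lbrakk>a \<in> carrier A; b \<in> carrier A; c \<in> carrier A\<rbrakk> \<Longrightarrow>
    tensor_assoc A (pure_tensor A2 A (pure_tensor A A a b) c) = pure_tensor A A2 a (pure_tensor A A b c)"
  by (simp add: tensor_assoc_pure' assoc_inner_pure)

lemma tensor_assoc_linear: "tensor_assoc A \<in> linear_maps (tensor_algebra A2 A) A3"
  unfolding tensor_assoc_def Let_def
  by (rule A3'.tensor_lift_linear[OF complex_algebra_tensor(2) assoc_bilinear])

text \<open>Multiplicativity on pure tensors of \<open>A2\<close> and \<open>A\<close> still
  involves arbitrary elements \<open>s\<close> and \<open>t\<close> of \<open>A2\<close>; these are
  resolved into pure tensors one after the other.\<close>

lemma tensor_assoc_hom: "tensor_assoc A \<in> algebra_homs (tensor_algebra A2 A) A3"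
proof (rule A3'.hom_on_pureI[OF complex_algebra_tensor(2) tensor_assoc_linear])
  let ?\<phi> = "\<lambda>c. tensor_lift A3 (\<lambda>a b. pure_tensor A A2 a (pure_tensor A A b c))"
  note lm = linear_maps_mult_left[OF complex_algebra_tensor(2)]
    linear_maps_mult_right[OF complex_algebra_tensor(2)]
    linear_maps_compose[OF linear_maps_mult_left[OF complex_algebra_tensor(1) linear_maps_id]]
    linear_maps_compose[OF linear_maps_mult_right[OF complex_algebra_tensor(1) linear_maps_id]]
  fix s c t d
  assume s: "s \<in> carrier A2" and c [simp]: "c \<in> carrier A" and t: "t \<in> carrier A2"
    and d [simp]: "d \<in> carrier A"
  note lin = assoc_inner_linear[OF c] assoc_inner_linear[OF d] assoc_inner_linear[OF m_closed[OF c d]]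
  have "?\<phi> (c \<otimes> d) (s \<otimes>\<^bsub>A2\<^esub> t) = ?\<phi> c s \<otimes>\<^bsub>A3\<^esub> ?\<phi> d t"
  proof (rule A2.linear_maps_tensor_eq[OF complex_algebra_tensor(2)
        lm(4)[OF t lin(3)] lm(2)[OF lin(1) linear_maps_closed[OF lin(2) t]] _ s])
    fix a b assume [simp]: "a \<in> carrier A" "b \<in> carrier A"
    then have ab: "pure_tensor A A a b \<in> carrier A2" by blast
    show "?\<phi> (c \<otimes> d) (pure_tensor A A a b \<otimes>\<^bsub>A2\<^esub> t) = ?\<phi> c (pure_tensor A A a b) \<otimes>\<^bsub>A3\<^esub> ?\<phi> d t"
      by (rule A2.linear_maps_tensor_eq[OF complex_algebra_tensor(2)
            lm(3)[OF ab lin(3)] lm(1)[OF lin(2) linear_maps_closed[OF lin(1) ab]] _ t])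
        (simp add: A2.pure_mult A3.pure_mult assoc_inner_pure)
  qed
  then show "tensor_assoc A (pure_tensor A2 A (s \<otimes>\<^bsub>A2\<^esub> t) (c \<otimes> d))
      = tensor_assoc A (pure_tensor A2 A s c) \<otimes>\<^bsub>A3\<^esub> tensor_assoc A (pure_tensor A2 A t d)"
    using s t by (simp add: tensor_assoc_pure')
qed (simp add: A2.pure_one A3.pure_one tensor_assoc_pure)

lemma mult_bilinear:
  assumes f: "f \<in> linear_maps B A" and g: "g \<in> linear_maps C A"
  shows "(\<lambda>a b. f a \<otimes> g b) \<in> bilinear_maps B C A"
  by (intro bilinear_mapsI linear_maps_mult_left linear_maps_mult_right complex_algebra_axioms f g
      linear_maps_closed[OF f] linear_maps_closed[OF g])

lemma smult_bilinear:
  assumes "\<epsilon> \<in> linear_maps A complex_alg"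
  shows "(\<lambda>a b. \<epsilon> a \<odot> b) \<in> bilinear_maps A A A" "(\<lambda>a b. \<epsilon> b \<odot> a) \<in> bilinear_maps A A A"
  by (rule bilinear_mapsI linear_maps_scaled[OF complex_algebra_axioms linear_maps_id]
      linear_maps_scalar_part[OF complex_algebra_axioms assms] | assumption)+

text \<open>Multiplicative because the values of \<open>\<epsilon>\<close> are scalars and can be
  moved out of the product. With \<open>S\<close> in place of \<open>\<epsilon>\<close> this
  argument breaks down, and \<open>convL_mult\<close> and \<open>convR_mult\<close> take its
  place.\<close>

lemma counit_homs:
  assumes "\<epsilon> \<in> algebra_homs A complex_alg"
  shows "tensor_lift A (\<lambda>a b. \<epsilon> a \<odot> b) \<in> algebra_homs A2 A"
    and "tensor_lift A (\<lambda>a b. \<epsilon> b \<odot> a) \<in> algebra_homs A2 A"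
proof -
  note lin = algebra_homs_linear[OF assms]
  have [simp]: "\<epsilon> \<one> = 1" "\<lbrakk>x \<in> carrier A; y \<in> carrier A\<rbrakk> \<Longrightarrow> \<epsilon> (x \<otimes> y) = \<epsilon> x * \<epsilon> y" for x y
    using algebra_homs_one[OF assms] algebra_homs_mult[OF assms] by (simp_all add: complex_alg_def)
  note A = complex_algebra_axioms
  show "tensor_lift A (\<lambda>a b. \<epsilon> a \<odot> b) \<in> algebra_homs A2 A"
    by (rule A2.hom_on_pureI[OF A A2.tensor_lift_linear[OF A smult_bilinear(1)[OF lin]]])
      (simp_all add: A2.tensor_lift_pure[OF A smult_bilinear(1)[OF lin]] smult_mult_smult)
  show "tensor_lift A (\<lambda>a b. \<epsilon> b \<odot> a) \<in> algebra_homs A2 A"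
    by (rule A2.hom_on_pureI[OF A A2.tensor_lift_linear[OF A smult_bilinear(2)[OF lin]]])
      (simp_all add: A2.tensor_lift_pure[OF A smult_bilinear(2)[OF lin]] smult_mult_smult)
qed

end


section \<open>Hopf structures on a presented algebra\<close>

definition opposite_algebra :: "(complex, 'a) module \<Rightarrow> (complex, 'a) module" where
  "opposite_algebra A = A\<lparr>mult := \<lambda>x y. y \<otimes>\<^bsub>A\<^esub> x\<rparr>"

lemma opposite_algebra_sel [simp]:
  "carrier (opposite_algebra A) = carrier A" "one (opposite_algebra A) = one A"
  "zero (opposite_algebra A) = zero A" "add (opposite_algebra A) = add A"
  "smult (opposite_algebra A) = smult A" "x \<otimes>\<^bsub>opposite_algebra A\<^esub> y = y \<otimes>\<^bsub>A\<^esub> x"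
  by (simp_all add: opposite_algebra_def)

lemma complex_algebra_opposite:
  fixes A :: "(complex, 'a) module" (structure)
  assumes "complex_algebra A"
  shows "complex_algebra (opposite_algebra A)"
proof -
  interpret complex_algebra A by fact
  have "abelian_group (opposite_algebra A)"
    by (rule abelian_groupI) (auto simp: a_ac intro: bexI[of _ "\<ominus> x" for x] l_neg)
  moreover have "Group.monoid (opposite_algebra A)"
    by (rule monoidI) (simp_all add: m_assoc)
  ultimately have "ring (opposite_algebra A)"
    by (rule ringI) (simp_all add: l_distr r_distr)
  then show ?thesis
    by (rule complex_algI)
      (simp_all add: smult_add_left smult_add_right smult_smult smult_mult_left smult_mult_right)
qed

lemma linear_maps_opposite: "linear_maps B (opposite_algebra A) = linear_maps B A"
  by (simp add: linear_maps_def)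

context
  fixes A :: "(complex, 'a) module" (structure) and \<Delta> \<epsilon> S
  assumes A: "complex_algebra A" and \<Delta>: "\<Delta> \<in> algebra_homs A (tensor_algebra A A)"
    and \<epsilon>: "\<epsilon> \<in> algebra_homs A complex_alg" and S: "S \<in> algebra_homs A (opposite_algebra A)"
begin

interpretation complex_algebra A by (rule A)
interpretation A2: tensor_product A A by (simp add: tensor_product_def A)

lemma antipode_linear: "S \<in> linear_maps A A"
  using algebra_homs_linear[OF S] by (simp add: linear_maps_opposite)

lemmas S_closed [simp] = linear_maps_closed[OF antipode_linear]

lemma S_mult [simp]: "\<lbrakk>x \<in> carrier A; y \<in> carrier A\<rbrakk> \<Longrightarrow> S (x \<otimes> y) = S y \<otimes> S x"
  using algebra_homs_mult[OF S, of x y] by simp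

lemma S_one [simp]: "S \<one> = \<one>"
  using algebra_homs_one[OF S] by simp

lemma \<epsilon>_simps [simp]:
  "\<epsilon> \<one> = 1" "\<lbrakk>x \<in> carrier A; y \<in> carrier A\<rbrakk> \<Longrightarrow> \<epsilon> (x \<otimes> y) = \<epsilon> x * \<epsilon> y"
  "\<lbrakk>x \<in> carrier A; y \<in> carrier A\<rbrakk> \<Longrightarrow> \<epsilon> (x \<oplus> y) = \<epsilon> x + \<epsilon> y"
  "x \<in> carrier A \<Longrightarrow> \<epsilon> (c \<odot> x) = c * \<epsilon> x"
  using algebra_homs_one[OF \<epsilon>] algebra_homs_mult[OF \<epsilon>] algebra_homs_add[OF \<epsilon>] algebra_homs_smult[OF \<epsilon>]
  by (simp_all add: complex_alg_def)

abbreviation "convL \<equiv> tensor_lift A (\<lambda>a b. S a \<otimes> b)"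
abbreviation "convR \<equiv> tensor_lift A (\<lambda>a b. a \<otimes> S b)"

lemmas convL_linear = A2.tensor_lift_linear[OF A mult_bilinear[OF antipode_linear linear_maps_id]]
lemmas convR_linear = A2.tensor_lift_linear[OF A mult_bilinear[OF linear_maps_id antipode_linear]]
lemmas convL_pure = A2.tensor_lift_pure[OF A mult_bilinear[OF antipode_linear linear_maps_id]]
lemmas convR_pure = A2.tensor_lift_pure[OF A mult_bilinear[OF linear_maps_id antipode_linear]]

text \<open>As \<open>S\<close> reverses products, \<open>convL\<close> sends the product of
  \<open>s\<close> with the pure tensor of \<open>a\<close> and \<open>b\<close> to
  \<open>S a\<close> times \<open>convL s\<close> times \<open>b\<close>. A scalar value of
  \<open>convL s\<close> can leave the middle.\<close>

lemma convL_mult: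
  assumes s: "s \<in> carrier A2" and t: "t \<in> carrier A2" and c: "convL s = c \<odot> \<one>"
  shows "convL (s \<otimes>\<^bsub>A2\<^esub> t) = c \<odot> convL t"
proof (rule A2.linear_maps_tensor_eq[OF A
      linear_maps_compose[OF linear_maps_mult_left[OF A2.AB.complex_algebra_axioms linear_maps_id s]
        convL_linear] linear_maps_scaled[OF A convL_linear] _ t])
  fix a b assume ab [simp]: "a \<in> carrier A" "b \<in> carrier A"
  then have t: "pure_tensor A A a b \<in> carrier A2" by blast
  have "convL (s \<otimes>\<^bsub>A2\<^esub> pure_tensor A A a b) = S a \<otimes> convL s \<otimes> b"
    by (rule A2.linear_maps_tensor_eq[OF A
          linear_maps_compose[OF linear_maps_mult_right[OF A2.AB.complex_algebra_axioms linear_maps_id t]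
            convL_linear]
          linear_maps_mult_right[OF A linear_maps_mult_left[OF A convL_linear S_closed[OF ab(1)]] ab(2)] _ s])
      (simp add: A2.pure_mult convL_pure m_assoc)
  then show "convL (s \<otimes>\<^bsub>A2\<^esub> pure_tensor A A a b) = c \<odot> convL (pure_tensor A A a b)"
    by (simp add: c convL_pure smult_mult_left smult_mult_right)
qed

text \<open>Mirror image of \<open>convL_mult\<close>: now the second factor ends up in the middle,
  so the scalar condition is on \<open>t\<close>.\<close>

lemma convR_mult:
  assumes s: "s \<in> carrier A2" and t: "t \<in> carrier A2" and c: "convR t = c \<odot> \<one>"
  shows "convR (s \<otimes>\<^bsub>A2\<^esub> t) = c \<odot> convR s"
proof (rule A2.linear_maps_tensor_eq[OF A
      linear_maps_compose[OF linear_maps_mult_right[OF A2.AB.complex_algebra_axioms linear_maps_id t]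
        convR_linear] linear_maps_scaled[OF A convR_linear] _ s])
  fix a b assume ab [simp]: "a \<in> carrier A" "b \<in> carrier A"
  then have s: "pure_tensor A A a b \<in> carrier A2" by blast
  have "convR (pure_tensor A A a b \<otimes>\<^bsub>A2\<^esub> t) = a \<otimes> convR t \<otimes> S b"
    by (rule A2.linear_maps_tensor_eq[OF A
          linear_maps_compose[OF linear_maps_mult_left[OF A2.AB.complex_algebra_axioms linear_maps_id s]
            convR_linear]
          linear_maps_mult_right[OF A linear_maps_mult_left[OF A convR_linear ab(1)] S_closed[OF ab(2)]] _ t])
      (simp add: A2.pure_mult convR_pure m_assoc)
  then show "convR (pure_tensor A A a b \<otimes>\<^bsub>A2\<^esub> t) = c \<odot> convR (pure_tensor A A a b)"
    by (simp add: c convR_pure smult_mult_left smult_mult_right)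
qed

text \<open>These are the closure steps required by \<open>presented_induct\<close>. For a product,
  the law at one factor makes the inner value a scalar, and the law at the other factor evaluates
  what remains.\<close>

lemma antipode_closed:
  defines "good \<equiv> \<lambda>x. convL (\<Delta> x) = \<epsilon> x \<odot> \<one> \<and> convR (\<Delta> x) = \<epsilon> x \<odot> \<one>"
  shows "good \<one>"
    and "\<lbrakk>x \<in> carrier A; y \<in> carrier A; good x; good y\<rbrakk> \<Longrightarrow> good (x \<oplus> y)"
    and "\<lbrakk>x \<in> carrier A; good x\<rbrakk> \<Longrightarrow> good (c \<odot> x)"
    and "\<lbrakk>x \<in> carrier A; y \<in> carrier A; good x; good y\<rbrakk> \<Longrightarrow> good (x \<otimes> y)"
  unfolding good_def
  using algebra_homs_closed[OF \<Delta>]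
  by (simp_all add: algebra_homs_one[OF \<Delta>] algebra_homs_add[OF \<Delta>] algebra_homs_smult[OF \<Delta>]
      algebra_homs_mult[OF \<Delta>] A2.pure_one convL_pure convR_pure convL_mult convR_mult
      linear_maps_add[OF convL_linear] linear_maps_add[OF convR_linear] linear_maps_smult[OF convL_linear]
      linear_maps_smult[OF convR_linear] smult_add_left smult_smult mult.commute)

end

lemma hopf_algebra_presentedI:
  fixes R defines "A \<equiv> presented_algebra R"
  assumes \<Delta>: "\<Delta> \<in> algebra_homs A (tensor_algebra A A)"
    and \<epsilon>: "\<epsilon> \<in> algebra_homs A complex_alg" and S: "S \<in> algebra_homs A (opposite_algebra A)"
    and coassoc: "\<And>g. tensor_assoc A (tensor_map (tensor_algebra A A) A \<Delta> (\<lambda>b. b) (\<Delta> (presented_gen R g))) =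
      tensor_map A (tensor_algebra A A) (\<lambda>a. a) \<Delta> (\<Delta> (presented_gen R g))"
    and counit: "\<And>g. tensor_lift A (\<lambda>a b. \<epsilon> a \<odot>\<^bsub>A\<^esub> b) (\<Delta> (presented_gen R g)) = presented_gen R g"
      "\<And>g. tensor_lift A (\<lambda>a b. \<epsilon> b \<odot>\<^bsub>A\<^esub> a) (\<Delta> (presented_gen R g)) = presented_gen R g"
    and antipode: "\<And>g. tensor_lift A (\<lambda>a b. S a \<otimes>\<^bsub>A\<^esub> b) (\<Delta> (presented_gen R g))
        = \<epsilon> (presented_gen R g) \<odot>\<^bsub>A\<^esub> \<one>\<^bsub>A\<^esub>"
      "\<And>g. tensor_lift A (\<lambda>a b. a \<otimes>\<^bsub>A\<^esub> S b) (\<Delta> (presented_gen R g))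
        = \<epsilon> (presented_gen R g) \<odot>\<^bsub>A\<^esub> \<one>\<^bsub>A\<^esub>"
  shows "hopf_algebra A \<Delta> \<epsilon> S"
proof -
  have A: "complex_algebra A" unfolding A_def by (rule complex_algebra_presented)
  interpret complex_algebra A by (rule A)
  interpret A2: tensor_product A A by (simp add: tensor_product_def A)
  note hom_eq = algebra_homs_presented_eq[of _ R, folded A_def]
  note counit_homs = counit_homs[OF \<epsilon>]
  have anti: "tensor_lift A (\<lambda>a b. S a \<otimes>\<^bsub>A\<^esub> b) (\<Delta> x) = \<epsilon> x \<odot>\<^bsub>A\<^esub> \<one>\<^bsub>A\<^esub>
      \<and> tensor_lift A (\<lambda>a b. a \<otimes>\<^bsub>A\<^esub> S b) (\<Delta> x) = \<epsilon> x \<odot>\<^bsub>A\<^esub> \<one>\<^bsub>A\<^esub>" if "x \<in> carrier A" for x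
    using that unfolding A_def
  proof (induction rule: presented_induct)
    case (gen g)
    then show ?case using antipode[unfolded A_def] by blast
  next
    case one
    show ?case by (rule antipode_closed(1)[OF A \<Delta> \<epsilon> S, unfolded A_def])
  next
    case (add x y)
    then show ?case by (intro antipode_closed(2)[OF A \<Delta> \<epsilon> S, unfolded A_def])
  next
    case (smult c x)
    then show ?case by (intro antipode_closed(3)[OF A \<Delta> \<epsilon> S, unfolded A_def])
  next
    case (mult x y)
    then show ?case by (intro antipode_closed(4)[OF A \<Delta> \<epsilon> S, unfolded A_def])
  qed
  show ?thesis
  proof (intro hopf_algebra.intro hopf_algebra_axioms.intro A \<Delta> \<epsilon> antipode_linear[OF A \<Delta> \<epsilon> S])
    fix x assume x: "x \<in> carrier A"
    show "tensor_assoc A (tensor_map A2 A \<Delta> (\<lambda>b. b) (\<Delta> x)) = tensor_map A A2 (\<lambda>a. a) \<Delta> (\<Delta> x)"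
      by (rule hom_eq[OF algebra_homs_compose[OF algebra_homs_compose[OF \<Delta> tensor_map_hom] tensor_assoc_hom]
            algebra_homs_compose[OF \<Delta> tensor_map_hom] coassoc x])
        (intro A A2.AB.complex_algebra_axioms algebra_homs_id \<Delta>)+
    show "tensor_lift A (\<lambda>a b. \<epsilon> a \<odot>\<^bsub>A\<^esub> b) (\<Delta> x) = x" "tensor_lift A (\<lambda>a b. \<epsilon> b \<odot>\<^bsub>A\<^esub> a) (\<Delta> x) = x"
      by (rule hom_eq[OF algebra_homs_compose[OF \<Delta> counit_homs(1)] algebra_homs_id counit(1) x]
          hom_eq[OF algebra_homs_compose[OF \<Delta> counit_homs(2)] algebra_homs_id counit(2) x])+
  qed (simp_all add: anti)
qed

text \<open>The antipode is the convolution inverse of the identity, so it is determined by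
  \<open>\<Delta>\<close> and \<open>\<epsilon>\<close>: both sides of the coassociativity law are mapped to \<open>A\<close> by
  \<open>a \<otimes> (b \<otimes> c) \<mapsto> S a b S' c\<close>.\<close>

lemma antipode_unique:
  assumes "hopf_algebra A \<Delta> \<epsilon> S" "hopf_algebra A \<Delta> \<epsilon> S'" and x: "x \<in> carrier A"
  shows "S x = S' x"
proof -
  interpret H: hopf_algebra A \<Delta> \<epsilon> S by fact
  interpret H': hopf_algebra A \<Delta> \<epsilon> S' by fact
  note A = H.complex_algebra_axioms
  interpret A2: tensor_product A A by (simp add: tensor_product_def A)
  note A2 = A2.AB.complex_algebra_axioms
  interpret A3: tensor_product A "tensor_algebra A A" by (simp add: tensor_product_def A A2)
  interpret A3': tensor_product "tensor_algebra A A" A by (simp add: tensor_product_def A A2)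
  let ?A2 = "tensor_algebra A A"
  define R where "R = tensor_lift A (\<lambda>a b. a \<otimes>\<^bsub>A\<^esub> S' b)"
  define \<Psi> where "\<Psi> = tensor_lift A (\<lambda>a t. S a \<otimes>\<^bsub>A\<^esub> R t)"
  note \<Delta> = algebra_homs_linear[OF H.comult_hom]
  note \<epsilon> = algebra_homs_linear[OF H.counit_hom]
  note S = H.antipode_linear H'.antipode_linear
  note [simp] = linear_maps_closed[OF S(1)] linear_maps_closed[OF S(2)] linear_maps_closed[OF \<Delta>]
  note bR = H.mult_bilinear[OF linear_maps_id S(2)]
  have R: "R \<in> linear_maps ?A2 A"
    unfolding R_def by (rule A2.tensor_lift_linear[OF A bR])
  note b\<Psi> = H.mult_bilinear[OF S(1) R]
  have \<Psi>: "\<Psi> \<in> linear_maps (tensor_algebra A ?A2) A"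
    unfolding \<Psi>_def by (rule A3.tensor_lift_linear[OF A b\<Psi>])
  have \<Psi>_pure: "\<Psi> (pure_tensor A ?A2 a t) = S a \<otimes>\<^bsub>A\<^esub> R t" if "a \<in> carrier A" "t \<in> carrier ?A2" for a t
    unfolding \<Psi>_def by (rule A3.tensor_lift_pure[OF A b\<Psi> that])
  have R_pure: "R (pure_tensor A A a b) = a \<otimes>\<^bsub>A\<^esub> S' b" if "a \<in> carrier A" "b \<in> carrier A" for a b
    unfolding R_def by (rule A2.tensor_lift_pure[OF A bR that])
  have R_\<Delta>: "R (\<Delta> b) = \<epsilon> b \<odot>\<^bsub>A\<^esub> \<one>\<^bsub>A\<^esub>" if "b \<in> carrier A" for b
    unfolding R_def by (rule H'.antipode_right[OF that])
  have tl: "tensor_lift A (\<lambda>a b. S a \<otimes>\<^bsub>A\<^esub> b) \<in> linear_maps ?A2 A"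
    by (rule A2.tensor_lift_linear[OF A H.mult_bilinear[OF S(1) linear_maps_id]])
  have eL: "tensor_lift A (\<lambda>a b. \<epsilon> a \<odot>\<^bsub>A\<^esub> b) \<in> linear_maps ?A2 A"
    and eR: "tensor_lift A (\<lambda>a b. \<epsilon> b \<odot>\<^bsub>A\<^esub> a) \<in> linear_maps ?A2 A"
    by (rule A2.tensor_lift_linear[OF A H.smult_bilinear(1)[OF \<epsilon>]]
        A2.tensor_lift_linear[OF A H.smult_bilinear(2)[OF \<epsilon>]])+
  note tm1 = tensor_map_linear[OF A A A A2 linear_maps_id \<Delta>]
  note tm2 = tensor_map_linear[OF A A A2 A \<Delta> linear_maps_id]
  have "\<Psi> (tensor_map A ?A2 (\<lambda>a. a) \<Delta> t) = S (tensor_lift A (\<lambda>a b. \<epsilon> b \<odot>\<^bsub>A\<^esub> a) t)"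
    if "t \<in> carrier ?A2" for t
    by (rule A2.linear_maps_tensor_eq[OF A linear_maps_compose[OF tm1 \<Psi>] linear_maps_compose[OF eR S(1)] _ that])
      (simp add: tensor_map_pure[OF A A A A2 linear_maps_id \<Delta>] \<Psi>_pure R_\<Delta> H.smult_mult_right
        A2.tensor_lift_pure[OF A H.smult_bilinear(2)[OF \<epsilon>]] linear_maps_smult[OF S(1)])
  then have 1: "\<Psi> (tensor_map A ?A2 (\<lambda>a. a) \<Delta> (\<Delta> x)) = S x"
    using x by (simp add: H.counit_right)
  have inner: "\<Psi> (tensor_assoc A (pure_tensor ?A2 A s b)) = tensor_lift A (\<lambda>a c. S a \<otimes>\<^bsub>A\<^esub> c) s \<otimes>\<^bsub>A\<^esub> S' b"
    if "s \<in> carrier ?A2" and b [simp]: "b \<in> carrier A" for s b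
    by (rule A2.linear_maps_tensor_eq[OF A
          linear_maps_compose[OF linear_maps_compose[OF
              bilinear_maps_linear(2)[OF A3'.pure_bilinear b] H.tensor_assoc_linear] \<Psi>]
          linear_maps_mult_right[OF A tl linear_maps_closed[OF S(2) b]] _ that(1)])
      (simp add: H.tensor_assoc_pure \<Psi>_pure R_pure H.m_assoc
        A2.tensor_lift_pure[OF A H.mult_bilinear[OF S(1) linear_maps_id]])
  have "\<Psi> (tensor_assoc A (tensor_map ?A2 A \<Delta> (\<lambda>b. b) t)) = S' (tensor_lift A (\<lambda>a b. \<epsilon> a \<odot>\<^bsub>A\<^esub> b) t)"
    if "t \<in> carrier ?A2" for t
    by (rule A2.linear_maps_tensor_eq[OF A linear_maps_compose[OF linear_maps_compose[OF tm2
            H.tensor_assoc_linear] \<Psi>] linear_maps_compose[OF eL S(2)] _ that])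
      (simp add: tensor_map_pure[OF A A A2 A \<Delta> linear_maps_id] inner H.antipode_left H.smult_mult_left
        A2.tensor_lift_pure[OF A H.smult_bilinear(1)[OF \<epsilon>]] linear_maps_smult[OF S(2)])
  then have "\<Psi> (tensor_assoc A (tensor_map ?A2 A \<Delta> (\<lambda>b. b) (\<Delta> x))) = S' x"
    using x by (simp add: H.counit_left)
  with 1 show ?thesis using H.coassoc[OF x] by simp
qed

section \<open>Noncommutative polynomial expressions and their normal forms\<close>

text \<open>The coefficient \<open>(n, i, j)\<close> stands for \<open>n \<eta>\<^sup>j / 2\<^sup>i\<close>, where \<open>\<eta> \<noteq> 0\<close> is a fixed complex number.\<close>

type_synonym coef = "int \<times> nat \<times> int"

type_synonym 'g nc_poly = "(coef \<times> 'g list) list"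

text \<open>Left-hand sides of two letters suffice, since a rule either reorders two adjacent
  generators or cancels powers of \<open>T\<close>.\<close>

type_synonym 'g rules = "'g \<Rightarrow> 'g \<Rightarrow> 'g nc_poly option"

datatype 'g expr = Gen 'g | One | Scal coef "'g expr" | Plus "'g expr" "'g expr" | Times "'g expr" "'g expr"

instantiation expr :: (type) "{zero, one, plus, times, uminus, minus}"
begin

definition "0 = Scal (0, 0, 0) One"
definition "1 = One"
definition "x + y = Plus x y"
definition "x * y = Times x y"
definition "- x = Scal (- 1, 0, 0) x"
definition "x - y = Plus x (Scal (- 1, 0, 0) y)" for x y :: "'a expr"

instance ..

end

lemmas expr_ops = zero_expr_def one_expr_def plus_expr_def times_expr_def uminus_expr_def minus_expr_def

fun coef_value :: "complex \<Rightarrow> coef \<Rightarrow> complex" where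
  "coef_value \<eta> (n, i, j) = of_int n / 2 ^ i * \<eta> powi j"

fun coef_mult :: "coef \<Rightarrow> coef \<Rightarrow> coef" where
  "coef_mult (n, i, j) (m, k, l) = (n * m, i + k, j + l)"

text \<open>Only meaningful when both exponents of \<open>\<eta>\<close> agree.\<close>

fun coef_add :: "coef \<Rightarrow> coef \<Rightarrow> coef" where
  "coef_add (n, i, j) (m, k, l) =
     (if i \<le> k then (n * 2 ^ (k - i) + m, k, j) else (n + m * 2 ^ (i - k), i, j))"

text \<open>Terms merge only if their powers of \<open>\<eta>\<close> agree, so
  \<open>\<eta>\<close> is treated as an indeterminate. Fractions are left unreduced; a zero
  coefficient is recognized by its numerator.\<close>

fun add_monomial :: "coef \<Rightarrow> 'g list \<Rightarrow> 'g nc_poly \<Rightarrow> 'g nc_poly" where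
  "add_monomial c w [] = (if fst c = 0 then [] else [(c, w)])"
| "add_monomial c w ((d, v) # p) =
     (if snd (snd c) = snd (snd d) \<and> w = v
      then (let s = coef_add c d in if fst s = 0 then p else (s, v) # p)
      else (d, v) # add_monomial c w p)"

definition poly_add :: "'g nc_poly \<Rightarrow> 'g nc_poly \<Rightarrow> 'g nc_poly" where
  "poly_add p q = foldr (\<lambda>(c, w). add_monomial c w) p q"

definition poly_scale :: "coef \<Rightarrow> 'g list \<Rightarrow> 'g nc_poly \<Rightarrow> 'g nc_poly" where
  "poly_scale c w p = map (\<lambda>(d, v). (coef_mult c d, w @ v)) p"

definition poly_mult :: "'g nc_poly \<Rightarrow> 'g nc_poly \<Rightarrow> 'g nc_poly" where
  "poly_mult p q = concat (map (\<lambda>(c, w). poly_scale c w q) p)"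

fun rewrite_word :: "'g rules \<Rightarrow> 'g list \<Rightarrow> 'g nc_poly option" where
  "rewrite_word rl (a # b # w) =
     (case rl a b of
        Some p \<Rightarrow> Some (map (\<lambda>(c, v). (c, v @ w)) p)
      | None \<Rightarrow> map_option (poly_scale (1, 0, 0) [a]) (rewrite_word rl (b # w)))"
| "rewrite_word rl w = None"

text \<open>The pair holds pending and finished terms. Irreducible monomials move to the second
  component, where like terms merge; the sum of both values (\<open>state_value\<close>) is the
  invariant.\<close>

fun rewrite_step :: "'g rules \<Rightarrow> 'g nc_poly \<times> 'g nc_poly \<Rightarrow> 'g nc_poly \<times> 'g nc_poly" where
  "rewrite_step rl ([], q) = ([], q)"
| "rewrite_step rl ((c, w) # p, q) =
     (case rewrite_word rl w of
        None \<Rightarrow> (p, add_monomial c w q)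
      | Some r \<Rightarrow> (poly_scale c [] r @ p, q))"

text \<open>At most \<open>2\<^sup>k\<close> steps; a result that is not yet reduced would still have the right value.\<close>

primrec rewrite_steps :: "'g rules \<Rightarrow> nat \<Rightarrow> 'g nc_poly \<times> 'g nc_poly \<Rightarrow> 'g nc_poly \<times> 'g nc_poly" where
  "rewrite_steps rl 0 s = rewrite_step rl s"
| "rewrite_steps rl (Suc k) s = (if fst s = [] then s else rewrite_steps rl k (rewrite_steps rl k s))"

definition reduce :: "'g rules \<Rightarrow> 'g nc_poly \<Rightarrow> 'g nc_poly" where
  "reduce rl p = (case rewrite_steps rl 16 (p, []) of (r, q) \<Rightarrow> r @ q)"

text \<open>Products are reduced as soon as they are formed, which limits the growth of intermediate
  results. The clause for a zero scalar matters at \<open>h = 0\<close>: scaling would leave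
  monomials with numerator 0, while \<open>equal_mod\<close> tests for the empty list.\<close>

primrec norm_expr :: "'g rules \<Rightarrow> 'g expr \<Rightarrow> 'g nc_poly" where
  "norm_expr rl (Gen g) = [((1, 0, 0), [g])]"
| "norm_expr rl One = [((1, 0, 0), [])]"
| "norm_expr rl (Scal c e) = (if fst c = 0 then [] else poly_scale c [] (norm_expr rl e))"
| "norm_expr rl (Plus e e') = poly_add (norm_expr rl e) (norm_expr rl e')"
| "norm_expr rl (Times e e') = reduce rl (poly_mult (norm_expr rl e) (norm_expr rl e'))"

definition equal_mod :: "'g rules \<Rightarrow> 'g expr \<Rightarrow> 'g expr \<Rightarrow> bool" where
  "equal_mod rl e e' \<longleftrightarrow> norm_expr rl (e - e') = []"

primrec subst_expr :: "('g \<Rightarrow> 'k expr) \<Rightarrow> 'g expr \<Rightarrow> 'k expr" where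
  "subst_expr s (Gen g) = s g"
| "subst_expr s One = One"
| "subst_expr s (Scal c e) = Scal c (subst_expr s e)"
| "subst_expr s (Plus e e') = Plus (subst_expr s e) (subst_expr s e')"
| "subst_expr s (Times e e') = Times (subst_expr s e) (subst_expr s e')"

abbreviation rename_expr :: "('g \<Rightarrow> 'k) \<Rightarrow> 'g expr \<Rightarrow> 'k expr" where
  "rename_expr f \<equiv> subst_expr (\<lambda>g. Gen (f g))"

text \<open>By \<open>eval_reverse\<close>, evaluating in the opposite algebra amounts to evaluating
  the reversed expression, so the checks for the antipode use the rules of the algebra
  itself.\<close>

primrec reverse_expr :: "'g expr \<Rightarrow> 'g expr" where
  "reverse_expr (Gen g) = Gen g"
| "reverse_expr One = One"
| "reverse_expr (Scal c e) = Scal c (reverse_expr e)"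
| "reverse_expr (Plus e e') = Plus (reverse_expr e) (reverse_expr e')"
| "reverse_expr (Times e e') = Times (reverse_expr e') (reverse_expr e)"

section \<open>Values of expressions and soundness of rewriting\<close>

primrec eval_expr :: "(complex, 'a) module \<Rightarrow> complex \<Rightarrow> ('g \<Rightarrow> 'a) \<Rightarrow> 'g expr \<Rightarrow> 'a" where
  "eval_expr A \<eta> \<rho> (Gen g) = \<rho> g"
| "eval_expr A \<eta> \<rho> One = \<one>\<^bsub>A\<^esub>"
| "eval_expr A \<eta> \<rho> (Scal c e) = coef_value \<eta> c \<odot>\<^bsub>A\<^esub> eval_expr A \<eta> \<rho> e"
| "eval_expr A \<eta> \<rho> (Plus e e') = eval_expr A \<eta> \<rho> e \<oplus>\<^bsub>A\<^esub> eval_expr A \<eta> \<rho> e'"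
| "eval_expr A \<eta> \<rho> (Times e e') = eval_expr A \<eta> \<rho> e \<otimes>\<^bsub>A\<^esub> eval_expr A \<eta> \<rho> e'"

primrec eval_word :: "(complex, 'a) module \<Rightarrow> ('g \<Rightarrow> 'a) \<Rightarrow> 'g list \<Rightarrow> 'a" where
  "eval_word A \<rho> [] = \<one>\<^bsub>A\<^esub>"
| "eval_word A \<rho> (g # w) = \<rho> g \<otimes>\<^bsub>A\<^esub> eval_word A \<rho> w"

primrec eval_poly :: "(complex, 'a) module \<Rightarrow> complex \<Rightarrow> ('g \<Rightarrow> 'a) \<Rightarrow> 'g nc_poly \<Rightarrow> 'a" where
  "eval_poly A \<eta> \<rho> [] = \<zero>\<^bsub>A\<^esub>"
| "eval_poly A \<eta> \<rho> (m # p) =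
     coef_value \<eta> (fst m) \<odot>\<^bsub>A\<^esub> eval_word A \<rho> (snd m) \<oplus>\<^bsub>A\<^esub> eval_poly A \<eta> \<rho> p"

definition valid_rules :: "(complex, 'a) module \<Rightarrow> complex \<Rightarrow> ('g \<Rightarrow> 'a) \<Rightarrow> 'g rules \<Rightarrow> bool" where
  "valid_rules A \<eta> \<rho> rl \<longleftrightarrow>
     (\<forall>a b p. rl a b = Some p \<longrightarrow> \<rho> a \<otimes>\<^bsub>A\<^esub> \<rho> b = eval_poly A \<eta> \<rho> p)"

lemma coef_value_mult:
  "\<eta> \<noteq> 0 \<Longrightarrow> coef_value \<eta> (coef_mult c d) = coef_value \<eta> c * coef_value \<eta> d"
  by (cases c; cases d) (simp add: power_int_add power_add)

lemma coef_value_add: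
  assumes "snd (snd c) = snd (snd d)"
  shows "coef_value \<eta> (coef_add c d) = coef_value \<eta> c + coef_value \<eta> d"
proof (cases c; cases d)
  fix n i j m k l assume cd: "c = (n, i, j)" "d = (m, k, l)"
  have "(2::complex) ^ k = 2 ^ i * 2 ^ (k - i)" if "i \<le> k"
    using that by (simp flip: power_add)
  moreover have "(2::complex) ^ i = 2 ^ k * 2 ^ (i - k)" if "\<not> i \<le> k"
    using that by (simp flip: power_add)
  ultimately show ?thesis
    using assms cd by (auto simp: field_simps)
qed

lemma coef_value_eq_0: "fst c = 0 \<Longrightarrow> coef_value \<eta> c = 0"
  by (cases c) simp

locale evaluation = complex_algebra A for A :: "(complex, 'a) module" (structure) +
  fixes \<eta> :: complex and \<rho> :: "'g \<Rightarrow> 'a"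
  assumes \<eta>: "\<eta> \<noteq> 0" and \<rho>_closed [simp]: "\<rho> g \<in> carrier A"
begin

abbreviation "ev \<equiv> eval_expr A \<eta> \<rho>"
abbreviation "evw \<equiv> eval_word A \<rho>"
abbreviation "evp \<equiv> eval_poly A \<eta> \<rho>"

lemma ev_closed [simp]: "ev e \<in> carrier A"
  by (induction e) simp_all

lemma evw_closed [simp]: "evw w \<in> carrier A"
  by (induction w) simp_all

lemma evp_closed [simp]: "evp p \<in> carrier A"
  by (induction p) simp_all

lemma ev_ops [simp]:
  "ev 0 = \<zero>" "ev 1 = \<one>" "ev (x + y) = ev x \<oplus> ev y" "ev (x * y) = ev x \<otimes> ev y"
  "ev (- x) = \<ominus> ev x" "ev (x - y) = ev x \<ominus> ev y"
  by (simp_all add: expr_ops minus_eq_smult minus_eq)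

lemma evw_append: "evw (v @ w) = evw v \<otimes> evw w"
  by (induction v) (simp_all add: m_assoc)

lemma evp_append: "evp (p @ q) = evp p \<oplus> evp q"
  by (induction p) (simp_all add: a_assoc)

lemma evp_add_monomial: "evp (add_monomial c w p) = coef_value \<eta> c \<odot> evw w \<oplus> evp p"
proof (induction c w p rule: add_monomial.induct)
  case (1 c w)
  then show ?case by (simp add: coef_value_eq_0)
next
  case (2 c w d v p)
  show ?case
  proof (cases "snd (snd c) = snd (snd d) \<and> w = v")
    case True
    then have "coef_value \<eta> c \<odot> evw w \<oplus> evp ((d, v) # p) = coef_value \<eta> (coef_add c d) \<odot> evw v \<oplus> evp p"
      by (simp add: coef_value_add smult_add_left a_assoc)
    then show ?thesis using True by (simp add: Let_def coef_value_eq_0)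
  next
    case False
    then have eq: "add_monomial c w ((d, v) # p) = (d, v) # add_monomial c w p" by auto
    show ?thesis unfolding eq using 2[OF False] by (simp add: a_lcomm)
  qed
qed

lemma evp_add: "evp (poly_add p q) = evp p \<oplus> evp q"
  unfolding poly_add_def
  by (induction p) (simp_all add: evp_add_monomial a_assoc case_prod_beta)

lemma evp_scale: "evp (poly_scale c w p) = coef_value \<eta> c \<odot> (evw w \<otimes> evp p)"
  unfolding poly_scale_def
  by (induction p)
    (simp_all add: case_prod_beta coef_value_mult[OF \<eta>] evw_append smult_add_right r_distr smult_mult_right smult_smult)

lemma evp_mult: "evp (poly_mult p q) = evp p \<otimes> evp q"
  unfolding poly_mult_def
  by (induction p) (simp_all add: case_prod_beta evp_append evp_scale l_distr smult_mult_left)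

lemma evp_append_word: "evp (map (\<lambda>(c, v). (c, v @ w)) p) = evp p \<otimes> evw w"
  by (induction p) (simp_all add: case_prod_beta evw_append l_distr smult_mult_left)

context
  fixes rl :: "'g rules"
  assumes valid: "valid_rules A \<eta> \<rho> rl"
begin

lemma evp_rewrite_word: "rewrite_word rl w = Some p \<Longrightarrow> evp p = evw w"
proof (induction w arbitrary: p rule: induct_list012)
  case (3 a b w)
  show ?case
  proof (cases "rl a b")
    case None
    with 3 show ?thesis by (auto simp: evp_scale)
  next
    case (Some q)
    then have "\<rho> a \<otimes> \<rho> b = evp q" using valid by (simp add: valid_rules_def)
    with 3(3) Some show ?thesis by (auto simp: evp_append_word simp flip: m_assoc)
  qed
qed simp_all

definition state_value :: "'g nc_poly \<times> 'g nc_poly \<Rightarrow> 'a" where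
  "state_value s = evp (fst s) \<oplus> evp (snd s)"

lemma state_value_step: "state_value (rewrite_step rl s) = state_value s"
proof (cases "(rl, s)" rule: rewrite_step.cases)
  case (2 rl' c w p q)
  then show ?thesis
    by (cases "rewrite_word rl w")
      (simp_all add: state_value_def evp_add_monomial evp_append evp_scale evp_rewrite_word a_ac)
qed simp

lemma state_value_steps: "state_value (rewrite_steps rl k s) = state_value s"
  by (induction k arbitrary: s) (simp_all add: state_value_step)

lemma evp_reduce: "evp (reduce rl p) = evp p"
proof -
  have "state_value (rewrite_steps rl 16 (p, [])) = evp p"
    by (simp add: state_value_steps) (simp add: state_value_def)
  then show ?thesis by (simp add: reduce_def state_value_def evp_append case_prod_beta)
qed

lemma evp_norm: "evp (norm_expr rl e) = ev e"
  by (induction e) (simp_all add: evp_scale evp_add evp_reduce evp_mult coef_value_eq_0)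

lemma equal_mod_sound:
  assumes "equal_mod rl e e'"
  shows "ev e = ev e'"
proof -
  have "ev e \<ominus> ev e' = \<zero>"
    using evp_norm[of "e - e'"] assms by (simp add: equal_mod_def)
  then show ?thesis by (simp add: diff_eq_zero)
qed

end

text \<open>Lets a redundant generator be eliminated before reducing: \<open>H3\<close> in the
  generic case, \<open>T'\<close> at \<open>h = 0\<close>.\<close>

lemma ev_subst: "(\<And>g. ev (s g) = \<rho> g) \<Longrightarrow> ev (subst_expr s e) = ev e"
  by (induction e) simp_all

end

lemma eval_subst: "eval_expr A \<eta> \<rho> (subst_expr s e) = eval_expr A \<eta> (\<lambda>g. eval_expr A \<eta> \<rho> (s g)) e"
  by (induction e) simp_all

lemma eval_reverse: "eval_expr (opposite_algebra A) \<eta> \<rho> e = eval_expr A \<eta> \<rho> (reverse_expr e)"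
  by (induction e) simp_all

lemma eval_hom:
  assumes "complex_algebra A" "f \<in> algebra_homs A B" "\<And>g. \<rho> g \<in> carrier A"
  shows "f (eval_expr A \<eta> \<rho> e) = eval_expr B \<eta> (\<lambda>g. f (\<rho> g)) e"
proof -
  interpret complex_algebra A by fact
  have closed: "eval_expr A \<eta> \<rho> e \<in> carrier A" for e
    by (induction e) (simp_all add: assms(3))
  show ?thesis
    by (induction e)
      (simp_all add: closed algebra_homs_one[OF assms(2)] algebra_homs_add[OF assms(2)]
        algebra_homs_smult[OF assms(2)] algebra_homs_mult[OF assms(2)])
qed


subsection \<open>Tensor products\<close>

text \<open>A tensor product is generated by two commuting copies of its factors. The third equation
  moves the left copy to the front; nesting the construction gives rules for the triple tensor
  product.\<close>

fun tensor_rules :: "'g rules \<Rightarrow> 'k rules \<Rightarrow> ('g + 'k) rules" where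
  "tensor_rules rl rl' (Inl a) (Inl b) = map_option (map (\<lambda>(c, w). (c, map Inl w))) (rl a b)"
| "tensor_rules rl rl' (Inr a) (Inr b) = map_option (map (\<lambda>(c, w). (c, map Inr w))) (rl' a b)"
| "tensor_rules rl rl' (Inr b) (Inl a) = Some [((1, 0, 0), [Inl a, Inr b])]"
| "tensor_rules rl rl' (Inl a) (Inr b) = None"

definition tensor_env ::
  "(complex, 'a) module \<Rightarrow> (complex, 'b) module \<Rightarrow> ('g \<Rightarrow> 'a) \<Rightarrow> ('k \<Rightarrow> 'b) \<Rightarrow> 'g + 'k
     \<Rightarrow> ('a \<times> 'b \<Rightarrow>\<^sub>0 complex) set" where
  "tensor_env A B \<rho> \<sigma> =
     case_sum (\<lambda>g. pure_tensor A B (\<rho> g) \<one>\<^bsub>B\<^esub>) (\<lambda>k. pure_tensor A B \<one>\<^bsub>A\<^esub> (\<sigma> k))"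

lemma (in tensor_product) pure_homs:
  "(\<lambda>a. pure_tensor A B a \<one>\<^bsub>B\<^esub>) \<in> algebra_homs A AB"
  "(\<lambda>b. pure_tensor A B \<one>\<^bsub>A\<^esub> b) \<in> algebra_homs B AB"
  by (rule algebra_homsI; simp add: bilinear_maps_linear[OF pure_bilinear] pure_mult pure_one)+

lemma eval_poly_hom:
  assumes "complex_algebra A" "complex_algebra B" "f \<in> algebra_homs A B" "\<And>g. \<rho> g \<in> carrier A"
    and "\<And>g. \<sigma> (h g) = f (\<rho> g)"
  shows "f (eval_poly A \<eta> \<rho> p) = eval_poly B \<eta> \<sigma> (map (\<lambda>(c, w). (c, map h w)) p)"
proof -
  interpret complex_algebra A by fact
  have closed: "eval_word A \<rho> w \<in> carrier A" for w
    by (induction w) (simp_all add: assms(4))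
  have closed': "eval_poly A \<eta> \<rho> p \<in> carrier A" for p
    by (induction p) (simp_all add: closed)
  have "f (eval_word A \<rho> w) = eval_word B \<sigma> (map h w)" for w
    by (induction w)
      (simp_all add: closed assms(4,5) algebra_homs_one[OF assms(3)] algebra_homs_mult[OF assms(3)])
  then show ?thesis
    by (induction p)
      (simp_all add: closed closed' case_prod_beta linear_maps_zero[OF assms(1,2) algebra_homs_linear[OF assms(3)]]
        algebra_homs_add[OF assms(3)] algebra_homs_smult[OF assms(3)])
qed

lemma evaluation_tensor:
  assumes "evaluation A \<eta> \<rho>" "evaluation B \<eta> \<sigma>"
  shows "evaluation (tensor_algebra A B) \<eta> (tensor_env A B \<rho> \<sigma>)"
proof -
  interpret A: evaluation A \<eta> \<rho> by fact
  interpret B: evaluation B \<eta> \<sigma> by fact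
  interpret tensor_product A B
    by (simp add: tensor_product_def A.complex_algebra_axioms B.complex_algebra_axioms)
  show ?thesis
    by (simp add: evaluation_def evaluation_axioms_def AB.complex_algebra_axioms A.\<eta>
        tensor_env_def split: sum.split)
qed

lemma valid_tensor_rules:
  assumes "evaluation A \<eta> \<rho>" "evaluation B \<eta> \<sigma>"
    and rl: "valid_rules A \<eta> \<rho> rl" and rl': "valid_rules B \<eta> \<sigma> rl'"
  shows "valid_rules (tensor_algebra A B) \<eta> (tensor_env A B \<rho> \<sigma>) (tensor_rules rl rl')"
proof -
  interpret A: evaluation A \<eta> \<rho> by fact
  interpret B: evaluation B \<eta> \<sigma> by fact
  interpret tensor_product A B
    by (simp add: tensor_product_def A.complex_algebra_axioms B.complex_algebra_axioms)
  note lr = A.complex_algebra_axioms B.complex_algebra_axioms AB.complex_algebra_axioms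
  let ?\<tau> = "tensor_env A B \<rho> \<sigma>"
  have l: "pure_tensor A B (eval_poly A \<eta> \<rho> p) \<one>\<^bsub>B\<^esub>
      = eval_poly AB \<eta> ?\<tau> (map (\<lambda>(c, w). (c, map Inl w)) p)" for p
    by (rule eval_poly_hom[OF lr(1,3) pure_homs(1)]) (simp_all add: tensor_env_def)
  have r: "pure_tensor A B \<one>\<^bsub>A\<^esub> (eval_poly B \<eta> \<sigma> p)
      = eval_poly AB \<eta> ?\<tau> (map (\<lambda>(c, w). (c, map Inr w)) p)" for p
    by (rule eval_poly_hom[OF lr(2,3) pure_homs(2)]) (simp_all add: tensor_env_def)
  show ?thesis
    unfolding valid_rules_def
  proof (intro allI impI)
    fix a b p assume p: "tensor_rules rl rl' a b = Some p"
    show "?\<tau> a \<otimes>\<^bsub>AB\<^esub> ?\<tau> b = eval_poly AB \<eta> ?\<tau> p"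
    proof (cases a; cases b)
      fix x y assume ab: "a = Inl x" "b = Inl y"
      with p obtain q where q: "rl x y = Some q" "p = map (\<lambda>(c, w). (c, map Inl w)) q" by auto
      then have "\<rho> x \<otimes>\<^bsub>A\<^esub> \<rho> y = eval_poly A \<eta> \<rho> q" using rl by (simp add: valid_rules_def)
      then show ?thesis by (simp add: q flip: l) (simp add: ab tensor_env_def pure_mult)
    next
      fix x y assume ab: "a = Inr x" "b = Inr y"
      with p obtain q where q: "rl' x y = Some q" "p = map (\<lambda>(c, w). (c, map Inr w)) q" by auto
      then have "\<sigma> x \<otimes>\<^bsub>B\<^esub> \<sigma> y = eval_poly B \<eta> \<sigma> q" using rl' by (simp add: valid_rules_def)
      then show ?thesis by (simp add: q flip: r) (simp add: ab tensor_env_def pure_mult)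
    next
      fix x y assume "a = Inr x" "b = Inl y"
      then show ?thesis using p by (auto simp: tensor_env_def pure_mult)
    next
      fix x y assume "a = Inl x" "b = Inr y"
      then show ?thesis using p by simp
    qed
  qed
qed

lemma eval_tensor_env:
  assumes "evaluation A \<eta> \<rho>" "evaluation B \<eta> \<sigma>"
  shows "eval_expr (tensor_algebra A B) \<eta> (tensor_env A B \<rho> \<sigma>) (rename_expr Inl e)
      = pure_tensor A B (eval_expr A \<eta> \<rho> e) \<one>\<^bsub>B\<^esub>"
    and "eval_expr (tensor_algebra A B) \<eta> (tensor_env A B \<rho> \<sigma>) (rename_expr Inr e')
      = pure_tensor A B \<one>\<^bsub>A\<^esub> (eval_expr B \<eta> \<sigma> e')"
proof -
  interpret A: evaluation A \<eta> \<rho> by fact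
  interpret B: evaluation B \<eta> \<sigma> by fact
  interpret tensor_product A B
    by (simp add: tensor_product_def A.complex_algebra_axioms B.complex_algebra_axioms)
  show "eval_expr AB \<eta> (tensor_env A B \<rho> \<sigma>) (rename_expr Inl e)
      = pure_tensor A B (eval_expr A \<eta> \<rho> e) \<one>\<^bsub>B\<^esub>"
    by (subst eval_hom[OF A.complex_algebra_axioms pure_homs(1)]) (simp_all add: eval_subst tensor_env_def)
  show "eval_expr AB \<eta> (tensor_env A B \<rho> \<sigma>) (rename_expr Inr e')
      = pure_tensor A B \<one>\<^bsub>A\<^esub> (eval_expr B \<eta> \<sigma> e')"
    by (subst eval_hom[OF B.complex_algebra_axioms pure_homs(2)]) (simp_all add: eval_subst tensor_env_def)
qed


subsection \<open>Derivation of rewrite rules from relations\<close>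

text \<open>A table lists, for each rule, a multiplier \<open>u\<close> and the relation \<open>l = r\<close> such that the rule
  \<open>a b = p\<close> follows from \<open>a b - p = u (l - r)\<close> modulo the rules listed before it.\<close>

definition rules_of :: "(('g \<times> 'g) \<times> 'g nc_poly) list \<Rightarrow> 'g rules" where
  "rules_of t a b = map_of t (a, b)"

fun derivable ::
  "('g \<Rightarrow> 'g expr) \<Rightarrow> ('k \<Rightarrow> 'g expr \<times> 'g expr) \<Rightarrow> ('g \<times> 'g \<Rightarrow> 'g expr \<times> 'k)
     \<Rightarrow> (('g \<times> 'g) \<times> 'g nc_poly) list \<Rightarrow> (('g \<times> 'g) \<times> 'g nc_poly) list \<Rightarrow> bool" where
  "derivable s rel cert done [] \<longleftrightarrow> True"
| "derivable s rel cert done (((a, b), p) # t) \<longleftrightarrow>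
     (case cert (a, b) of (u, k) \<Rightarrow> case rel k of (l, r) \<Rightarrow>
        poly_add (poly_scale (- 1, 0, 0) [] p)
          (norm_expr (rules_of done) (Gen a * Gen b - subst_expr s (u * (l - r)))) = []) \<and>
     derivable s rel cert (((a, b), p) # done) t"

context evaluation
begin

definition valid_table :: "(('g \<times> 'g) \<times> 'g nc_poly) list \<Rightarrow> bool" where
  "valid_table t \<longleftrightarrow> (\<forall>((a, b), p) \<in> set t. \<rho> a \<otimes> \<rho> b = evp p)"

lemma valid_rules_of: "valid_table t \<Longrightarrow> valid_rules A \<eta> \<rho> (rules_of t)"
  by (auto simp: valid_table_def valid_rules_def rules_of_def dest!: map_of_SomeD)

text \<open>As \<open>l = r\<close> holds in the algebra, subtracting \<open>u (l - r)\<close> does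
  not change the value of \<open>a b\<close>. The normal form taken modulo rules that are already
  valid then identifies this value with that of \<open>p\<close>, and the new rule joins the valid
  ones.\<close>

lemma derivable_sound:
  assumes s: "\<And>g. ev (s g) = \<rho> g"
    and rel: "\<And>k. ev (fst (rel k)) = ev (snd (rel k))"
  shows "\<lbrakk>derivable s rel cert done t; valid_table done\<rbrakk> \<Longrightarrow> valid_table t"
proof (induction t arbitrary: "done")
  case Nil
  then show ?case by (simp add: valid_table_def)
next
  case (Cons x t)
  obtain a b p where x: "x = ((a, b), p)" by (metis surj_pair)
  obtain u k where u: "cert (a, b) = (u, k)" by (metis surj_pair)
  obtain l r where lr: "rel k = (l, r)" by (metis surj_pair)
  define e where "e = Gen a * Gen b - subst_expr s (u * (l - r))"
  have e: "ev e = \<rho> a \<otimes> \<rho> b"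
    using rel[of k] by (simp add: e_def ev_subst[OF s] lr minus_eq r_neg)
  have "evp (poly_add (poly_scale (- 1, 0, 0) [] p) (norm_expr (rules_of done) e)) = \<zero>"
    using Cons.prems(1) by (simp add: x u lr e_def)
  then have "(- 1) \<odot> evp p \<oplus> ev e = \<zero>"
    by (simp add: evp_add evp_scale evp_norm[OF valid_rules_of[OF Cons.prems(2)]])
  then have "\<ominus> ev e = \<ominus> evp p"
    by (intro minus_equality) (simp_all add: minus_eq_smult[OF evp_closed])
  then have "ev e = evp p"
    by (metis minus_minus[OF ev_closed] minus_minus[OF evp_closed])
  with e have ab: "\<rho> a \<otimes> \<rho> b = evp p" by simp
  then have "valid_table (x # done)"
    using Cons.prems(2) by (simp add: valid_table_def x)
  then have "valid_table t"
    using Cons.IH[of "x # done"] Cons.prems(1) by (simp add: x)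
  with ab show ?case by (simp add: valid_table_def x)
qed

end

section \<open>The Jordanian relations\<close>

abbreviation commutator_expr :: "'g expr \<Rightarrow> 'g expr \<Rightarrow> 'g expr" where
  "commutator_expr x y \<equiv> x * y - y * x"

text \<open>Each relation is labelled by the pair of generators whose commutation it governs.\<close>

definition jordanian_exprs ::
  "coef \<Rightarrow> coef \<Rightarrow> ((jgen \<times> jgen) \<times> jgen expr \<times> jgen expr) list" where
  "jordanian_exprs h k =
    (let H1 = Gen gH1; H2 = Gen gH2; H3 = Gen gH3; E1 = Gen gE1; E2 = Gen gE2; T = Gen gT; T' = Gen gT';
         F1 = Gen gF1; F2 = Gen gF2; F3 = Gen gF3; h2 = coef_mult (1, 1, 0) h; h4 = coef_mult (1, 2, 0) h
     in
     [((gT, gT'), T * T', 1), ((gT', gT), T' * T, 1),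
      ((gH3, gT), commutator_expr H3 T, T * T - 1),
      ((gH3, gT'), commutator_expr H3 T', T' * T' - 1),
      ((gT, gF3), commutator_expr T F3, Scal h2 (H3 * T + T * H3)),
      ((gT', gF3), commutator_expr T' F3, Scal (coef_mult (- 1, 0, 0) h2) (H3 * T' + T' * H3)),
      ((gH3, gF3), commutator_expr H3 F3, Scal (- 1, 1, 0) (T * F3 + F3 * T + T' * F3 + F3 * T')),
      ((gH1, gH2), commutator_expr H1 H2, 0), ((gH1, gH3), commutator_expr H1 (T' * H3), 0),
      ((gH2, gH3), commutator_expr H2 (T' * H3), 0),
      ((gH1, gE1), commutator_expr H1 E1, Scal (2, 0, 0) E1),
      ((gH2, gE2), commutator_expr H2 E2, Scal (2, 0, 0) E2),
      ((gH1, gE2), commutator_expr H1 E2, - E2), ((gH2, gE1), commutator_expr H2 E1, - E1),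
      ((gH3, gE1), commutator_expr (T' * H3) E1, E1), ((gH3, gE2), commutator_expr (T' * H3) E2, E2),
      ((gH1, gF1), commutator_expr H1 F1, Scal (- 2, 0, 0) F1 + Scal h (E2 * T' * H3)),
      ((gH2, gF2), commutator_expr H2 F2, Scal (- 2, 0, 0) F2 - Scal h (E1 * T' * H3)),
      ((gH1, gF2), commutator_expr H1 F2, F2 - Scal h (E1 * T' * H3)),
      ((gH2, gF1), commutator_expr H2 F1, F1 + Scal h (E2 * T' * H3)),
      ((gH3, gF1), commutator_expr (T * H3) F1, - (T * T * F1)),
      ((gH3, gF2), commutator_expr (T * H3) F2, - (T * T * F2)),
      ((gE1, gF1), commutator_expr (T' * E1) F1,
         Scal (1, 1, 0) ((T + T') * H1) + Scal (1, 1, 0) ((T - T') * H2)),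
      ((gE2, gF2), commutator_expr (T' * E2) F2,
         Scal (1, 1, 0) ((T + T') * H2) + Scal (1, 1, 0) ((T - T') * H1)),
      ((gE1, gF2), commutator_expr (T' * E1) F2, 0), ((gE2, gF1), commutator_expr (T' * E2) F1, 0),
      ((gE1, gE2), Scal (coef_mult (2, 0, 0) h) (commutator_expr E1 E2), T * T - 1),
      ((gF2, gF1), commutator_expr (T * F2) (T * F1),
         T * (F3 - Scal h2 (H3 * T * H3) - Scal (coef_mult (1, 3, 0) h) (T - T'))),
      ((gH1, gT), commutator_expr (T * H1) T, Scal (1, 1, 0) (T * T - 1)),
      ((gH2, gT), commutator_expr (T * H2) T, Scal (1, 1, 0) (T * T - 1)),
      ((gH1, gT'), commutator_expr (T * H1) T', Scal (1, 1, 0) (T' * T' - 1)),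
      ((gH2, gT'), commutator_expr (T * H2) T', Scal (1, 1, 0) (T' * T' - 1)),
      ((gH1, gF3), commutator_expr H1 F3,
         Scal (- 1, 2, 0) (T' * (T * F3 + F3 * T + T' * F3 + F3 * T'))
         - Scal h4 (T' * H3 * H3) - Scal h4 (H3 * T' * H3)),
      ((gH2, gF3), commutator_expr H2 F3,
         Scal (- 1, 2, 0) (T' * (T * F3 + F3 * T + T' * F3 + F3 * T'))
         - Scal h4 (T' * H3 * H3) - Scal h4 (H3 * T' * H3)),
      ((gE1, gT), commutator_expr E1 T, 0), ((gE1, gT'), commutator_expr E1 T', 0),
      ((gE2, gT), commutator_expr E2 T, 0), ((gE2, gT'), commutator_expr E2 T', 0),
      ((gF1, gT), commutator_expr F1 T, Scal h (T * E2)),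
      ((gF1, gT'), commutator_expr F1 T', Scal (coef_mult (- 1, 0, 0) h) (T' * E2)),
      ((gF2, gT), commutator_expr F2 T, Scal (coef_mult (- 1, 0, 0) h) (T * E1)),
      ((gF2, gT'), commutator_expr F2 T', Scal h (T' * E1)),
      ((gE1, gF3), commutator_expr E1 F3, Scal (- 1, 1, 0) (T * F2 + F2 * T)),
      ((gE2, gF3), commutator_expr E2 F3, Scal (1, 1, 0) (T * F1 + F1 * T)),
      ((gF1, gF3), commutator_expr F1 F3,
         Scal k (T * F1) - Scal h (E2 * F3) + Scal (coef_mult h h4) (T * E2)),
      ((gF2, gF3), commutator_expr F2 F3,
         Scal k (T * F2) + Scal h (E1 * F3) - Scal (coef_mult h h4) (T * E1))])"

text \<open>A label without a relation yields \<open>0 = 0\<close>, so that the two components agree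
  in the algebra for every label, as \<open>derivable_sound\<close> requires.\<close>

definition jordanian_expr :: "coef \<Rightarrow> coef \<Rightarrow> jgen \<times> jgen \<Rightarrow> jgen expr \<times> jgen expr" where
  "jordanian_expr h k p =
     (case map_of (jordanian_exprs h k) p of None \<Rightarrow> (0, 0) | Some lr \<Rightarrow> lr)"

definition relator :: "coef \<Rightarrow> coef \<Rightarrow> jgen \<Rightarrow> jgen \<Rightarrow> jgen expr" where
  "relator h k a b = (case jordanian_expr h k (a, b) of (l, r) \<Rightarrow> l - r)"

fun jordanian_counit :: "jgen \<Rightarrow> coef" where
  "jordanian_counit gT = (1, 0, 0)"
| "jordanian_counit gT' = (1, 0, 0)"
| "jordanian_counit g = (0, 0, 0)"

text \<open>A list of pairs stands for the sum of their tensor products.\<close>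

primrec jordanian_coproduct :: "coef \<Rightarrow> jgen \<Rightarrow> (jgen expr \<times> jgen expr) list" where
  "jordanian_coproduct h gE1 = [(Gen gE1, 1), (Gen gT, Gen gE1)]"
| "jordanian_coproduct h gE2 = [(Gen gE2, 1), (Gen gT, Gen gE2)]"
| "jordanian_coproduct h gT = [(Gen gT, Gen gT)]"
| "jordanian_coproduct h gT' = [(Gen gT', Gen gT')]"
| "jordanian_coproduct h gF1 = [(Gen gF1, 1), (Gen gT', Gen gF1), (Gen gH3, Scal h (Gen gE2))]"
| "jordanian_coproduct h gF2 =
     [(Gen gF2, 1), (Gen gT', Gen gF2), (Gen gH3, Scal (coef_mult (- 1, 0, 0) h) (Gen gE1))]"
| "jordanian_coproduct h gF3 = [(Gen gF3, Gen gT), (Gen gT', Gen gF3)]"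
| "jordanian_coproduct h gH1 =
     [(Gen gH1, 1), (1, Gen gH1), (Scal (- 1, 1, 0) (1 - Gen gT' * Gen gT'), Gen gT' * Gen gH3)]"
| "jordanian_coproduct h gH2 =
     [(Gen gH2, 1), (1, Gen gH2), (Scal (- 1, 1, 0) (1 - Gen gT' * Gen gT'), Gen gT' * Gen gH3)]"
| "jordanian_coproduct h gH3 = [(Gen gH3, Gen gT), (Gen gT', Gen gH3)]"

primrec jordanian_antipode :: "coef \<Rightarrow> jgen \<Rightarrow> jgen expr" where
  "jordanian_antipode h gE1 = - (Gen gT' * Gen gE1)"
| "jordanian_antipode h gE2 = - (Gen gT' * Gen gE2)"
| "jordanian_antipode h gT = Gen gT'"
| "jordanian_antipode h gT' = Gen gT"
| "jordanian_antipode h gF1 = - (Gen gT * Gen gF1) + Scal h (Gen gT * Gen gH3 * Gen gT' * Gen gE2)"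
| "jordanian_antipode h gF2 = - (Gen gT * Gen gF2) - Scal h (Gen gT * Gen gH3 * Gen gT' * Gen gE1)"
| "jordanian_antipode h gF3 = - (Gen gT * Gen gF3 * Gen gT')"
| "jordanian_antipode h gH1 = - Gen gH1 - Scal (1, 1, 0) ((Gen gT - Gen gT') * Gen gH3)"
| "jordanian_antipode h gH2 = - Gen gH2 - Scal (1, 1, 0) ((Gen gT - Gen gT') * Gen gH3)"
| "jordanian_antipode h gH3 = - (Gen gT * Gen gH3 * Gen gT')"

definition tensor_sum :: "('g expr \<times> 'k expr) list \<Rightarrow> ('g + 'k) expr" where
  "tensor_sum ps = foldr (\<lambda>(x, y) e. rename_expr Inl x * rename_expr Inr y + e) ps 0"

text \<open>The order of letters in normal forms. It is also the order in which
  \<open>row_table\<close> lists the rules, hence decides which rules are available when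
  \<open>derivable\<close> treats the next one.\<close>

definition jgens :: "jgen list" where
  "jgens = [gT, gT', gE1, gE2, gH1, gH2, gH3, gF1, gF2, gF3]"

definition tensor_subst :: "('g \<Rightarrow> 'g expr) \<Rightarrow> ('k \<Rightarrow> 'k expr) \<Rightarrow> 'g + 'k \<Rightarrow> ('g + 'k) expr" where
  "tensor_subst s s' = case_sum (\<lambda>g. rename_expr Inl (s g)) (\<lambda>k. rename_expr Inr (s' k))"

definition comult_respects :: "(jgen \<Rightarrow> jgen expr) \<Rightarrow> jgen rules \<Rightarrow> coef \<Rightarrow> coef \<Rightarrow> bool" where
  "comult_respects s rl h k = list_all (\<lambda>(_, l, r).
     let \<Delta> = \<lambda>g. subst_expr (tensor_subst s s) (tensor_sum (jordanian_coproduct h g))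
     in equal_mod (tensor_rules rl rl) (subst_expr \<Delta> l) (subst_expr \<Delta> r)) (jordanian_exprs h k)"

definition antipode_respects :: "(jgen \<Rightarrow> jgen expr) \<Rightarrow> jgen rules \<Rightarrow> coef \<Rightarrow> coef \<Rightarrow> bool" where
  "antipode_respects s rl h k = list_all (\<lambda>(_, l, r).
     let S = \<lambda>g. subst_expr s (jordanian_antipode h g)
     in equal_mod rl (subst_expr S (reverse_expr l)) (subst_expr S (reverse_expr r))) (jordanian_exprs h k)"

text \<open>The images of the generators are multiples of one, so only empty words arise and the
  empty set of rules is enough.\<close>

definition counit_respects :: "coef \<Rightarrow> coef \<Rightarrow> bool" where
  "counit_respects h k = list_all (\<lambda>(_, l, r).
     let \<epsilon> = \<lambda>g. Scal (jordanian_counit g) (1 :: jgen expr)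
     in equal_mod (\<lambda>_ _. None) (subst_expr \<epsilon> l) (subst_expr \<epsilon> r)) (jordanian_exprs h k)"

text \<open>\<open>left\<close> and \<open>right\<close> describe, on the generators of the double
  tensor product, the coproduct applied in the first and in the second factor. In
  \<open>left\<close> the associativity map becomes a relabelling by \<open>Inl\<close> and
  \<open>Inr\<close>.\<close>

definition coassociative :: "(jgen \<Rightarrow> jgen expr) \<Rightarrow> jgen rules \<Rightarrow> coef \<Rightarrow> bool" where
  "coassociative s rl h = list_all (\<lambda>g.
     let \<Delta> = \<lambda>g. tensor_sum (jordanian_coproduct h g);
         s3 = tensor_subst s (tensor_subst s s);
         left = case_sum (\<lambda>g. subst_expr (case_sum (\<lambda>a. Gen (Inl a)) (\<lambda>a. Gen (Inr (Inl a)))) (\<Delta> g))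
           (\<lambda>g. Gen (Inr (Inr g)));
         right = case_sum (\<lambda>g. Gen (Inl g)) (\<lambda>g. rename_expr Inr (\<Delta> g))
     in equal_mod (tensor_rules rl (tensor_rules rl rl))
       (subst_expr s3 (subst_expr left (\<Delta> g))) (subst_expr s3 (subst_expr right (\<Delta> g)))) jgens"

definition counital :: "(jgen \<Rightarrow> jgen expr) \<Rightarrow> jgen rules \<Rightarrow> coef \<Rightarrow> bool" where
  "counital s rl h = list_all (\<lambda>g.
     let \<Delta> = tensor_sum (jordanian_coproduct h g); \<epsilon> = \<lambda>g. Scal (jordanian_counit g) One
     in equal_mod rl (subst_expr s (subst_expr (case_sum \<epsilon> Gen) \<Delta>)) (s g) \<and>
        equal_mod rl (subst_expr s (subst_expr (case_sum Gen \<epsilon>) \<Delta>)) (s g)) jgens"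

definition antipodal :: "(jgen \<Rightarrow> jgen expr) \<Rightarrow> jgen rules \<Rightarrow> coef \<Rightarrow> bool" where
  "antipodal s rl h = list_all (\<lambda>g.
     let S = \<lambda>e. subst_expr (jordanian_antipode h) (reverse_expr e); \<Delta> = jordanian_coproduct h g;
         \<epsilon> = Scal (jordanian_counit g) 1
     in equal_mod rl (subst_expr s (foldr (\<lambda>(x, y) e. S x * y + e) \<Delta> 0)) \<epsilon> \<and>
        equal_mod rl (subst_expr s (foldr (\<lambda>(x, y) e. x * S y + e) \<Delta> 0)) \<epsilon>) jgens"

section \<open>Rewrite rules in the three cases\<close>

text \<open>The relations solved for \<open>a b\<close>, after \<open>H3\<close> has been replaced
  by \<open>T (H1 + H2)\<close>. Only the rules for \<open>F3 F1\<close> and \<open>F3 F2\<close>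
  depend on \<open>\<kappa>\<close>, and they are those of \<open>\<kappa> = h/2\<close>. The rows
  of \<open>gH3\<close> serve the stage before \<open>H3\<close> is eliminated.\<close>

definition generic_rows :: "jgen \<Rightarrow> (jgen \<times> jgen nc_poly) list" where
  "generic_rows a = (case a of
     gT \<Rightarrow> [(gT', [((1, 0, 0), [])])]
   | gT' \<Rightarrow> [(gT, [((1, 0, 0), [])])]
   | gE1 \<Rightarrow> [(gT, [((1, 0, 0), [gT, gE1])]),
       (gT', [((1, 0, 0), [gT', gE1])])]
   | gE2 \<Rightarrow> [(gT, [((1, 0, 0), [gT, gE2])]),
       (gT', [((1, 0, 0), [gT', gE2])]),
       (gE1, [((1, 0, 0), [gE1, gE2]), ((- 1, 1, - 1), [gT, gT]), ((1, 1, - 1), [])])]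
   | gH1 \<Rightarrow> [(gT, [((- 1, 1, 0), [gT']), ((1, 1, 0), [gT]), ((1, 0, 0), [gT, gH1])]),
       (gT', [((- 1, 1, 0), [gT']), ((1, 1, 0), [gT', gT', gT']), ((1, 0, 0), [gT', gH1])]),
       (gE1, [((2, 0, 0), [gE1]), ((1, 0, 0), [gE1, gH1])]),
       (gE2, [((- 1, 0, 0), [gE2]), ((1, 0, 0), [gE2, gH1])])]
   | gH2 \<Rightarrow> [(gT, [((- 1, 1, 0), [gT']), ((1, 1, 0), [gT]), ((1, 0, 0), [gT, gH2])]),
       (gT', [((- 1, 1, 0), [gT']), ((1, 1, 0), [gT', gT', gT']), ((1, 0, 0), [gT', gH2])]),
       (gE1, [((- 1, 0, 0), [gE1]), ((1, 0, 0), [gE1, gH2])]),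
       (gE2, [((2, 0, 0), [gE2]), ((1, 0, 0), [gE2, gH2])]),
       (gH1, [((1, 0, 0), [gH1, gH2])])]
   | gH3 \<Rightarrow> [(gT, [((1, 0, 0), [gT, gH3]), ((1, 0, 0), [gT, gT]), ((- 1, 0, 0), [])]),
       (gT', [((1, 0, 0), [gT', gH3]), ((1, 0, 0), [gT', gT']), ((- 1, 0, 0), [])])]
   | gF1 \<Rightarrow> [(gT, [((1, 0, 1), [gT, gE2]), ((1, 0, 0), [gT, gF1])]),
       (gT', [((- 1, 0, 1), [gT', gE2]), ((1, 0, 0), [gT', gF1])]),
       (gE1, [((1, 1, 0), [gH2]), ((- 1, 1, 0), [gT, gT, gH2]), ((- 1, 1, 0), [gH1]),
         ((- 1, 1, 0), [gT, gT, gH1]), ((1, 1, 0), []), ((- 1, 1, 0), [gT, gT]), ((1, 0, 1), [gE1, gE2]),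
         ((1, 0, 0), [gE1, gF1])]),
       (gE2, [((1, 0, 1), [gE2, gE2]), ((1, 0, 0), [gE2, gF1])]),
       (gH1, [((- 1, 0, 1), [gE2, gH2]), ((- 1, 0, 1), [gE2, gH1]), ((2, 0, 0), [gF1]),
         ((1, 0, 0), [gH1, gF1])]),
       (gH2, [((- 1, 0, 1), [gE2, gH2]), ((- 1, 0, 1), [gE2, gH1]), ((- 1, 0, 0), [gF1]),
         ((1, 0, 0), [gH2, gF1])])]
   | gF2 \<Rightarrow> [(gT, [((- 1, 0, 1), [gT, gE1]), ((1, 0, 0), [gT, gF2])]),
       (gT', [((1, 0, 1), [gT', gE1]), ((1, 0, 0), [gT', gF2])]),
       (gE1, [((- 1, 0, 1), [gE1, gE1]), ((1, 0, 0), [gE1, gF2])]),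
       (gE2, [((1, 1, 0), [gH1]), ((- 1, 1, 0), [gT, gT, gH1]), ((- 1, 1, 0), [gH2]),
         ((- 1, 1, 0), [gT, gT, gH2]), ((- 1, 0, 1), [gE1, gE2]), ((1, 0, 0), [gE2, gF2])]),
       (gH1, [((1, 0, 1), [gE1, gH2]), ((1, 0, 1), [gE1, gH1]), ((- 1, 0, 0), [gF2]), ((1, 0, 0), [gH1, gF2])]),
       (gH2, [((1, 0, 1), [gE1, gH2]), ((1, 0, 1), [gE1, gH1]), ((2, 0, 0), [gF2]), ((1, 0, 0), [gH2, gF2])]),
       (gF1, [((1, 3, 1), [gT', gT']), ((- 1, 3, 1), []), ((- 1, 1, 1), [gT, gT, gH2, gH2]),
         ((- 1, 0, 1), [gT, gT, gH2]), ((1, 0, 1), [gH2]), ((- 1, 0, 1), [gT, gT, gH1, gH2]),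
         ((- 1, 0, 1), [gT, gT, gH1]), ((1, 0, 1), [gH1]), ((- 1, 1, 1), [gT, gT, gH1, gH1]),
         ((1, 0, 0), [gT', gF3]), ((1, 0, 1), [gE2, gF2]), ((1, 0, 1), [gE1, gF1]),
         ((1, 0, 0), [gF1, gF2])])]
   | gF3 \<Rightarrow> [(gT, [((- 1, 0, 1), [gT, gT, gH2]), ((- 1, 0, 1), [gT, gT, gH1]),
         ((- 1, 1, 1), [gT, gT]), ((1, 1, 1), []), ((1, 0, 0), [gT, gF3])]),
       (gT', [((1, 0, 1), [gH2]), ((1, 0, 1), [gH1]), ((1, 1, 1), [gT', gT']), ((- 1, 1, 1), []),
         ((1, 0, 0), [gT', gF3])]),
       (gE1, [((1, 0, 0), [gT, gF2]), ((- 1, 1, 1), [gT, gE1]), ((1, 0, 0), [gE1, gF3])]),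
       (gE2, [((- 1, 0, 0), [gT, gF1]), ((- 1, 1, 1), [gT, gE2]), ((1, 0, 0), [gE2, gF3])]),
       (gH1, [((1, 1, 1), [gT, gH2, gH2]), ((1, 0, 1), [gT, gH1, gH2]), ((1, 1, 1), [gT, gH1, gH1]),
         ((1, 1, 0), [gT', gT', gF3]), ((1, 3, 1), [gT', gT', gT']), ((1, 1, 0), [gF3]), ((- 1, 3, 1), [gT]),
         ((1, 0, 0), [gH1, gF3])]),
       (gH2, [((1, 1, 1), [gT, gH2, gH2]), ((1, 0, 1), [gT, gH1, gH2]), ((1, 1, 1), [gT, gH1, gH1]),
         ((1, 1, 0), [gT', gT', gF3]), ((1, 3, 1), [gT', gT', gT']), ((1, 1, 0), [gF3]), ((- 1, 3, 1), [gT]),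
         ((1, 0, 0), [gH2, gF3])]),
       (gF1, [((- 1, 2, 2), [gT, gE2]), ((1, 0, 1), [gE2, gF3]), ((- 1, 1, 1), [gT, gF1]),
         ((1, 0, 0), [gF1, gF3])]),
       (gF2, [((1, 2, 2), [gT, gE1]), ((- 1, 0, 1), [gE1, gF3]), ((- 1, 1, 1), [gT, gF2]),
         ((1, 0, 0), [gF2, gF3])])])"

text \<open>There is no rule for \<open>E2 E1\<close>: at \<open>h = 0\<close> the relation for
  \<open>[E1,E2]\<close> only says \<open>T^2 = 1\<close>, so \<open>E1\<close> and
  \<open>E2\<close> stay unordered. \<open>H3\<close> is a letter of its own, and \<open>T'\<close>
  is absent because it equals \<open>T\<close>.\<close>

definition zero_rows :: "jgen \<Rightarrow> (jgen \<times> jgen nc_poly) list" where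
  "zero_rows a = (case a of
     gT \<Rightarrow> [(gT, [((1, 0, 0), [])])]
   | gE1 \<Rightarrow> [(gT, [((1, 0, 0), [gT, gE1])])]
   | gE2 \<Rightarrow> [(gT, [((1, 0, 0), [gT, gE2])])]
   | gH1 \<Rightarrow> [(gT, [((1, 0, 0), [gT, gH1])]),
       (gE1, [((2, 0, 0), [gE1]), ((1, 0, 0), [gE1, gH1])]),
       (gE2, [((- 1, 0, 0), [gE2]), ((1, 0, 0), [gE2, gH1])])]
   | gH2 \<Rightarrow> [(gT, [((1, 0, 0), [gT, gH2])]),
       (gE1, [((- 1, 0, 0), [gE1]), ((1, 0, 0), [gE1, gH2])]),
       (gE2, [((2, 0, 0), [gE2]), ((1, 0, 0), [gE2, gH2])]),
       (gH1, [((1, 0, 0), [gH1, gH2])])]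
   | gH3 \<Rightarrow> [(gT, [((1, 0, 0), [gT, gH3])]),
       (gE1, [((1, 0, 0), [gE1, gH3]), ((1, 0, 0), [gT, gE1])]),
       (gE2, [((1, 0, 0), [gE2, gH3]), ((1, 0, 0), [gT, gE2])]),
       (gH1, [((1, 0, 0), [gH1, gH3])]),
       (gH2, [((1, 0, 0), [gH2, gH3])])]
   | gF1 \<Rightarrow> [(gT, [((1, 0, 0), [gT, gF1])]),
       (gE1, [((- 1, 0, 0), [gH1]), ((1, 0, 0), [gE1, gF1])]),
       (gE2, [((1, 0, 0), [gE2, gF1])]),
       (gH1, [((2, 0, 0), [gF1]), ((1, 0, 0), [gH1, gF1])]),
       (gH2, [((- 1, 0, 0), [gF1]), ((1, 0, 0), [gH2, gF1])]),
       (gH3, [((1, 0, 0), [gH3, gF1]), ((1, 0, 0), [gT, gF1])])]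
   | gF2 \<Rightarrow> [(gT, [((1, 0, 0), [gT, gF2])]),
       (gE1, [((1, 0, 0), [gE1, gF2])]),
       (gE2, [((- 1, 0, 0), [gH2]), ((1, 0, 0), [gE2, gF2])]),
       (gH1, [((- 1, 0, 0), [gF2]), ((1, 0, 0), [gH1, gF2])]),
       (gH2, [((2, 0, 0), [gF2]), ((1, 0, 0), [gH2, gF2])]),
       (gH3, [((1, 0, 0), [gH3, gF2]), ((1, 0, 0), [gT, gF2])]),
       (gF1, [((1, 0, 0), [gT, gF3]), ((1, 0, 0), [gF1, gF2])])]
   | gF3 \<Rightarrow> [(gT, [((1, 0, 0), [gT, gF3])]),
       (gE1, [((1, 0, 0), [gT, gF2]), ((1, 0, 0), [gE1, gF3])]),
       (gE2, [((- 1, 0, 0), [gT, gF1]), ((1, 0, 0), [gE2, gF3])]),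
       (gH1, [((1, 0, 0), [gF3]), ((1, 0, 0), [gH1, gF3])]),
       (gH2, [((1, 0, 0), [gF3]), ((1, 0, 0), [gH2, gF3])]),
       (gH3, [((2, 0, 0), [gT, gF3]), ((1, 0, 0), [gH3, gF3])]),
       (gF1, [((1, 0, 0), [gF1, gF3])]),
       (gF2, [((1, 0, 0), [gF2, gF3])])]
   | _ \<Rightarrow> [])"

text \<open>The rows are used in two forms: \<open>row_rules\<close> looks a rule up by its first
  letter during computations, and \<open>row_table\<close> lists all rules for their
  derivation.\<close>

definition row_rules :: "(jgen \<Rightarrow> (jgen \<times> jgen nc_poly) list) \<Rightarrow> jgen rules" where
  "row_rules rows a b = map_of (rows a) b"

definition row_table :: "(jgen \<Rightarrow> (jgen \<times> jgen nc_poly) list) \<Rightarrow> ((jgen \<times> jgen) \<times> jgen nc_poly) list" where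
  "row_table rows = concat (map (\<lambda>a. map (\<lambda>(b, p). ((a, b), p)) (rows a)) jgens)"

definition generic_subst :: "jgen \<Rightarrow> jgen expr" where
  "generic_subst g = (if g = gH3 then Gen gT * (Gen gH1 + Gen gH2) else Gen g)"

text \<open>The rules that move \<open>T\<close> and \<open>T'\<close> to the left and cancel them.
  Those for \<open>F3\<close> are left out because their right-hand sides already presuppose
  \<open>H3 = T (H1 + H2)\<close>.\<close>

definition before_H3 :: "(jgen \<times> jgen) \<times> jgen nc_poly \<Rightarrow> bool" where
  "before_H3 = (\<lambda>((a, b), p). b \<in> {gT, gT'} \<and> a \<noteq> gF3)"

definition without_H3 :: "(jgen \<times> jgen) \<times> jgen nc_poly \<Rightarrow> bool" where
  "without_H3 = (\<lambda>((a, b), p). a \<noteq> gH3)"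

text \<open>Leaves out the two rules that depend on \<open>\<kappa>\<close>; the others are also
  valid for \<open>\<kappa> = h\<close>, where they serve to prove the collapse.\<close>

definition before_F3F :: "(jgen \<times> jgen) \<times> jgen nc_poly \<Rightarrow> bool" where
  "before_F3F = (\<lambda>((a, b), p). a \<noteq> gH3 \<and> \<not> (a = gF3 \<and> b \<in> {gF1, gF2}))"

definition zero_subst :: "jgen \<Rightarrow> jgen expr" where
  "zero_subst g = (if g = gT' then Gen gT else Gen g)"

definition collapsed_subst :: "jgen \<Rightarrow> jgen expr" where
  "collapsed_subst g = (if g = gT \<or> g = gT' then Gen gT else 0)"

definition collapsed_rows :: "jgen \<Rightarrow> (jgen \<times> jgen nc_poly) list" where
  "collapsed_rows g = (if g = gT then [(gT, [((1, 0, 0), [])])] else [])"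

definition alternative_forms :: "(jgen \<Rightarrow> jgen expr) \<Rightarrow> jgen rules \<Rightarrow> coef \<Rightarrow> bool" where
  "alternative_forms s rl h \<longleftrightarrow>
    (let H3 = Gen gH3; E1 = Gen gE1; E2 = Gen gE2; T = Gen gT; T' = Gen gT'; F1 = Gen gF1; F2 = Gen gF2;
         X = Gen gH1 + Gen gH2; h' = coef_mult (- 1, 0, 0) h;
         eq2 = (\<lambda>p q. equal_mod (tensor_rules rl rl) (subst_expr (tensor_subst s s) (tensor_sum [p]))
           (subst_expr (tensor_subst s s) (tensor_sum [q])));
         eq = (\<lambda>x y. equal_mod rl (subst_expr s x) (subst_expr s y))
     in eq2 (H3, Scal h E2) (T * X, T' * commutator_expr F1 T) \<and>
        eq2 (H3, Scal h' E1) (T * X, T' * commutator_expr F2 T) \<and>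
        eq2 (1 - T' * T', T' * H3) (1 - T' * T', X) \<and>
        eq (Scal h (T * H3 * T' * E2)) (T * T * X * (T' * T') * commutator_expr F1 T) \<and>
        eq (- Scal h (T * H3 * T' * E1)) (T * T * X * (T' * T') * commutator_expr F2 T) \<and>
        eq ((T - T') * H3) ((T * T - 1) * X))"

definition hopf_compatible :: "(jgen \<Rightarrow> jgen expr) \<Rightarrow> jgen rules \<Rightarrow> coef \<Rightarrow> coef \<Rightarrow> bool" where
  "hopf_compatible s rl h k \<longleftrightarrow>
     comult_respects s rl h k \<and> antipode_respects s rl h k \<and> counit_respects h k \<and>
     coassociative s rl h \<and> counital s rl h \<and> antipodal s rl h \<and>
     alternative_forms s rl h"

text \<open>Some relations carry extra factors: \<open>2h\<close> for \<open>[E1,E2]\<close>,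
  \<open>T\<close> in \<open>[T H1, T]\<close> and \<open>[T F2, T F1]\<close>, \<open>T'\<close> in
  \<open>[T' E1, F1]\<close>. The multiplier cancels them and fixes the sign, up to terms that
  earlier rules reduce. The last clause reads a commutator relation in the opposite
  direction.\<close>

fun generic_cert :: "jgen \<times> jgen \<Rightarrow> jgen expr \<times> jgen \<times> jgen" where
  "generic_cert (a, b) =
     (if (a, b) = (gE2, gE1) then (Scal (- 1, 1, - 1) 1, (gE1, gE2))
      else if (a, b) = (gF2, gF1) then (Gen gT' * Gen gT', (gF2, gF1))
      else if a \<in> {gH1, gH2} \<and> b \<in> {gT, gT'} then (Gen gT', (a, b))
      else if a \<in> {gF1, gF2} \<and> b \<in> {gE1, gE2} then (- Gen gT, (b, a))
      else if b \<in> {gT, gT'} \<and> a \<noteq> gF3 \<or> a \<in> {gH1, gH2} \<and> b \<in> {gE1, gE2} then (1, (a, b))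
      else (- 1, (b, a)))"

fun zero_cert :: "jgen \<times> jgen \<Rightarrow> jgen expr \<times> jgen \<times> jgen" where
  "zero_cert (a, b) =
     (if (a, b) = (gT, gT) then (1, (gT, gT'))
      else if (a, b) = (gF2, gF1) then (1, (gF2, gF1))
      else if a \<in> {gH1, gH2} \<and> b = gT \<or> a = gH3 \<and> b \<in> {gE1, gE2} then (Gen gT, (a, b))
      else if a \<in> {gF1, gF2} \<and> b \<in> {gE1, gE2, gH3} \<or> a = gH3 \<and> b \<in> {gH1, gH2} then (- Gen gT, (b, a))
      else if b = gT \<and> a \<noteq> gF3 \<or> a \<in> {gH1, gH2} \<and> b \<in> {gE1, gE2} then (1, (a, b))
      else (- 1, (b, a)))"

section \<open>Computations that certify the rules and the Hopf axioms\<close>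

lemma zero_table:
  "derivable zero_subst (jordanian_expr (0, 0, 0) (0, 0, 0)) zero_cert [] (row_table zero_rows)"
  by code_simp

text \<open>Two stages. The first two tables keep \<open>H3\<close> as a letter and feed
  \<open>H3_certificate\<close> for both values of \<open>\<kappa>\<close>. The last two substitute
  \<open>T (H1 + H2)\<close> for \<open>H3\<close>, which is legitimate only once that certificate
  is available.\<close>

lemma generic_table:
  "derivable Gen (jordanian_expr (1, 0, 1) (1, 1, 1)) generic_cert [] (filter before_H3 (row_table generic_rows))"
  "derivable Gen (jordanian_expr (1, 0, 1) (1, 0, 1)) generic_cert [] (filter before_H3 (row_table generic_rows))"
  "derivable generic_subst (jordanian_expr (1, 0, 1) (1, 1, 1)) generic_cert [] (filter without_H3 (row_table generic_rows))"
  "derivable generic_subst (jordanian_expr (1, 0, 1) (1, 0, 1)) generic_cert []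
     (filter before_F3F (row_table generic_rows))"
  by code_simp+

lemma generic_rows_cases: "list_all (\<lambda>x. without_H3 x \<or> before_H3 x) (row_table generic_rows)"
  by code_simp

text \<open>An explicit combination of relators. The commutator of \<open>T\<close> with the relator
  of \<open>[T F2, T F1]\<close> yields brackets of \<open>E1\<close> with \<open>F1\<close> and of
  \<open>E2\<close> with \<open>F2\<close>, together with \<open>[T, F3]\<close>. The relators for
  these brackets turn them into \<open>T (H1 + H2)\<close> and \<open>H3\<close>, and the one for
  \<open>[E1,E2]\<close> absorbs the remaining commutator of \<open>E1\<close> and
  \<open>E2\<close>. The factor \<open>-1/h\<close> and the powers of \<open>T'\<close> normalize
  the result.\<close>

lemma H3_certificate:
  fixes k :: coef
  assumes "k = (1, 1, 1) \<or> k = (1, 0, 1)"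
  defines "d \<equiv> relator (1, 0, 1) k"
    and "T \<equiv> Gen gT" and "T' \<equiv> Gen gT'"
  shows "equal_mod (rules_of (filter before_H3 (row_table generic_rows)))
    (Gen gH3 - T * (Gen gH1 + Gen gH2))
    (Scal (- 1, 0, - 1) (T' * T' *
       (T' * T' * (T * d gF2 gF1 - d gF2 gF1 * T + T * d gT gF3)
        - Scal (1, 0, 1) (T * T * (d gE1 gF1 + d gE2 gF2)) - Scal (3, 1, 1) (T * d gE1 gE2))))"
  using assms(1) unfolding d_def T_def T'_def by (elim disjE; simp only:; code_simp)

text \<open>The commutators of \<open>T\<close> with the relations for \<open>[F1, F3]\<close> and \<open>[F2, F3]\<close> force \<open>E1 = E2 = 0\<close>
  when \<open>\<kappa> = h \<noteq> 0\<close>.\<close>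

lemma E_certificate:
  defines "d \<equiv> relator (1, 0, 1) (1, 0, 1)"
    and "T \<equiv> Gen gT" and "T' \<equiv> Gen gT'" and "s \<equiv> subst_expr generic_subst"
  shows "equal_mod (rules_of (filter before_F3F (row_table generic_rows)))
      (Gen gE1) (s (Scal (- 2, 0, - 2) (T' * T' * (T * d gF2 gF3 - d gF2 gF3 * T))))"
    and "equal_mod (rules_of (filter before_F3F (row_table generic_rows)))
      (Gen gE2) (s (Scal (2, 0, - 2) (T' * T' * (T * d gF1 gF3 - d gF1 gF3 * T))))"
  unfolding d_def T_def T'_def s_def by code_simp+

definition partial_subst :: "jgen list \<Rightarrow> jgen \<Rightarrow> jgen expr" where
  "partial_subst zs g = (if g = gT' then Gen gT else if g \<in> set zs then 0 else Gen g)"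

text \<open>Once \<open>E1 = E2 = 0\<close>, and hence \<open>T^2 = 1\<close> and
  \<open>T' = T\<close>, the relations for \<open>[T' E1, F1]\<close> and \<open>[T' E2, F2]\<close>
  read \<open>0 = T H1\<close> and \<open>0 = T H2\<close>. With the Cartan elements gone,
  \<open>[H1,F1]\<close> and \<open>[H2,F2]\<close> read \<open>0 = -2 F1\<close> and
  \<open>0 = -2 F2\<close>, and finally \<open>[T F2, T F1]\<close> reads \<open>0 = T F3\<close>.
  The list in \<open>eqv\<close> names the generators already known to vanish.\<close>

lemma collapse_certs:
  defines "d \<equiv> relator (1, 0, 1) (1, 0, 1)"
    and "T \<equiv> Gen gT"
    and "eqv \<equiv> \<lambda>zs x y. equal_mod (row_rules collapsed_rows) x (subst_expr (partial_subst zs) y)"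
  shows "eqv [gE1, gE2] (Gen gH1) (- (T * d gE1 gF1))"
    and "eqv [gE1, gE2] (Gen gH2) (- (T * d gE2 gF2))"
    and "eqv [gE1, gE2, gH1, gH2, gH3] (Gen gF1) (Scal (1, 1, 0) (d gH1 gF1))"
    and "eqv [gE1, gE2, gH1, gH2, gH3] (Gen gF2) (Scal (1, 1, 0) (d gH2 gF2))"
    and "eqv [gE1, gE2, gH1, gH2, gH3, gF1, gF2] (Gen gF3) (- (T * d gF2 gF1))"
  unfolding d_def T_def eqv_def by code_simp+

lemma hopf_compatible_zero: "hopf_compatible zero_subst (row_rules zero_rows) (0, 0, 0) (0, 0, 0)"
  by code_simp

lemma hopf_compatible_collapsed:
  "hopf_compatible collapsed_subst (row_rules collapsed_rows) (1, 0, 1) (1, 0, 1)"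
  by code_simp

lemma comult_respects_generic:
  "comult_respects generic_subst (row_rules generic_rows) (1, 0, 1) (1, 1, 1)"
  by code_simp

lemma antipode_respects_generic:
  "antipode_respects generic_subst (row_rules generic_rows) (1, 0, 1) (1, 1, 1)"
  by code_simp

lemma coassociative_generic: "coassociative generic_subst (row_rules generic_rows) (1, 0, 1)"
  by code_simp

lemma remaining_generic:
  "counit_respects (1, 0, 1) (1, 1, 1)"
  "counital generic_subst (row_rules generic_rows) (1, 0, 1)"
  "antipodal generic_subst (row_rules generic_rows) (1, 0, 1)"
  "alternative_forms generic_subst (row_rules generic_rows) (1, 0, 1)"
  by code_simp+

lemma hopf_compatible_generic:
  "hopf_compatible generic_subst (row_rules generic_rows) (1, 0, 1) (1, 1, 1)"
  unfolding hopf_compatible_def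
  by (intro conjI comult_respects_generic antipode_respects_generic coassociative_generic remaining_generic)

section \<open>The Hopf structure\<close>

text \<open>The bridge between the relations as stated and their symbolic list; from here on only
  the list is used.\<close>

lemma (in evaluation) jordanian_relations_eq:
  fixes \<sigma> :: "jgen \<Rightarrow> 'a"
  assumes "\<And>g. \<sigma> g \<in> carrier A" and h: "coef_value \<eta> hc = h" and k: "coef_value \<eta> kc = \<kappa>"
  shows "jordanian_relations A h \<kappa> (\<sigma> gH1) (\<sigma> gH2) (\<sigma> gH3) (\<sigma> gE1) (\<sigma> gE2) (\<sigma> gT) (\<sigma> gT')
      (\<sigma> gF1) (\<sigma> gF2) (\<sigma> gF3)
    = (\<lambda>(_, l, r). (eval_expr A \<eta> \<sigma> l, eval_expr A \<eta> \<sigma> r)) ` set (jordanian_exprs hc kc)"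
proof -
  interpret \<sigma>: evaluation A \<eta> \<sigma>
    using \<eta> assms(1) by unfold_locales
  show ?thesis
    unfolding jordanian_relations_def jordanian_exprs_def commutator_def Let_def
    by (simp only: list.set image_insert image_empty prod.case \<sigma>.ev_ops eval_expr.simps
        coef_value_mult[OF \<eta>] h k)
      (simp add: power2_eq_square)
qed

lemma complex_algebra_jordanian: "complex_algebra (jordanian_algebra h \<kappa>)"
  unfolding jordanian_algebra_def by (rule complex_algebra_presented)

lemma jordanian_gen_closed [simp]: "jordanian_gen h \<kappa> g \<in> carrier (jordanian_algebra h \<kappa>)"
  by (simp add: jordanian_gen_def jordanian_algebra_def)

lemma evaluation_jordanian:
  "\<eta> \<noteq> 0 \<Longrightarrow> evaluation (jordanian_algebra h \<kappa>) \<eta> (jordanian_gen h \<kappa>)"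
  by (simp add: evaluation_def evaluation_axioms_def complex_algebra_jordanian)

context
  fixes h \<kappa> \<eta> :: complex and hc kc :: coef
  assumes \<eta>: "\<eta> \<noteq> 0" and hc: "coef_value \<eta> hc = h" and kc: "coef_value \<eta> kc = \<kappa>"
begin

lemma presentation_eq:
  "jordanian_presentation h \<kappa> =
     (\<lambda>(_, l, r). (eval_expr free_algebra \<eta> free_gen l, eval_expr free_algebra \<eta> free_gen r))
       ` set (jordanian_exprs hc kc)"
proof -
  interpret evaluation free_algebra \<eta> "free_gen :: jgen \<Rightarrow> _"
    by (simp add: evaluation_def evaluation_axioms_def complex_algebra_free_algebra \<eta>)
  show ?thesis
    by (rule jordanian_relations_eq[OF _ hc kc]) simp
qed

lemma jordanian_relation:
  assumes "(x, l, r) \<in> set (jordanian_exprs hc kc)"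
  shows "eval_expr (jordanian_algebra h \<kappa>) \<eta> (jordanian_gen h \<kappa>) l
    = eval_expr (jordanian_algebra h \<kappa>) \<eta> (jordanian_gen h \<kappa>) r"
proof -
  let ?R = "jordanian_presentation h \<kappa>"
  have "(eval_expr free_algebra \<eta> free_gen l, eval_expr free_algebra \<eta> free_gen r) \<in> ?R"
    unfolding presentation_eq using assms by force
  note presented_relation[OF this]
  moreover have "relation_ideal ?R +>\<^bsub>free_algebra\<^esub> (eval_expr free_algebra \<eta> free_gen e)
      = eval_expr (jordanian_algebra h \<kappa>) \<eta> (jordanian_gen h \<kappa>) e" for e
    using eval_hom[OF complex_algebra_free_algebra presented_proj_hom[of ?R], of free_gen \<eta> e]
    by (simp add: presented_gen_def jordanian_algebra_def jordanian_gen_def[abs_def])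
  ultimately show ?thesis by simp
qed

lemma jordanian_expr_relation:
  "eval_expr (jordanian_algebra h \<kappa>) \<eta> (jordanian_gen h \<kappa>) (fst (jordanian_expr hc kc x))
    = eval_expr (jordanian_algebra h \<kappa>) \<eta> (jordanian_gen h \<kappa>) (snd (jordanian_expr hc kc x))"
  by (auto simp: jordanian_expr_def split: option.split dest!: map_of_SomeD jordanian_relation)

lemma jordanian_universal:
  assumes B: "complex_algebra B" and \<sigma>: "\<And>g. \<sigma> g \<in> carrier B"
    and rel: "\<And>x l r. (x, l, r) \<in> set (jordanian_exprs hc kc) \<Longrightarrow>
      eval_expr B \<eta> \<sigma> l = eval_expr B \<eta> \<sigma> r"
  shows "presented_hom B \<sigma> \<in> algebra_homs (jordanian_algebra h \<kappa>) B"
    and "presented_hom B \<sigma> (jordanian_gen h \<kappa> g) = \<sigma> g"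
proof -
  have "free_hom B \<sigma> (eval_expr free_algebra \<eta> free_gen e) = eval_expr B \<eta> \<sigma> e" for e
    using eval_hom[OF complex_algebra_free_algebra free_hom_hom[of B \<sigma>, OF B \<sigma>], of free_gen \<eta> e]
    by (simp add: free_hom_gen[of B \<sigma>, OF B \<sigma>])
  then have eq: "free_hom B \<sigma> l = free_hom B \<sigma> r" if "(l, r) \<in> jordanian_presentation h \<kappa>" for l r
    using that unfolding presentation_eq by (auto intro: rel)
  show "presented_hom B \<sigma> \<in> algebra_homs (jordanian_algebra h \<kappa>) B"
    unfolding jordanian_algebra_def by (rule presented_hom_hom[OF B \<sigma> eq])
  show "presented_hom B \<sigma> (jordanian_gen h \<kappa> g) = \<sigma> g"
    unfolding jordanian_gen_def by (rule presented_hom_gen[OF B \<sigma> eq])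
qed

end

text \<open>The three cases differ only in these data, and the construction of the Hopf structure is
  uniform in them. \<open>s\<close> eliminates redundant generators without changing values, and
  \<open>hc\<close> and \<open>kc\<close> express \<open>h\<close> and \<open>\<kappa>\<close>
  through \<open>\<eta>\<close>. At \<open>h = 0\<close> both are zero coefficients and
  \<open>\<eta> = 1\<close>.\<close>

locale jordanian_case =
  fixes h \<kappa> \<eta> :: complex and hc kc :: coef and s :: "jgen \<Rightarrow> jgen expr" and rl :: "jgen rules"
  assumes \<eta>: "\<eta> \<noteq> 0" and hc: "coef_value \<eta> hc = h" and kc: "coef_value \<eta> kc = \<kappa>"
    and compatible: "hopf_compatible s rl hc kc"
    and subst: "\<And>g. eval_expr (jordanian_algebra h \<kappa>) \<eta> (jordanian_gen h \<kappa>) (s g) = jordanian_gen h \<kappa> g"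
    and valid: "valid_rules (jordanian_algebra h \<kappa>) \<eta> (jordanian_gen h \<kappa>) rl"
begin

abbreviation "U \<equiv> jordanian_algebra h \<kappa>"
abbreviation "gen \<equiv> jordanian_gen h \<kappa>"
abbreviation "UU \<equiv> tensor_algebra U U"
abbreviation "UUU \<equiv> tensor_algebra U UU"
abbreviation "\<tau> \<equiv> tensor_env U U gen gen"
abbreviation "\<tau>3 \<equiv> tensor_env U UU gen \<tau>"

sublocale U: evaluation U \<eta> gen
  by (rule evaluation_jordanian[OF \<eta>])
sublocale U2: tensor_product U U
  by (simp add: tensor_product_def U.complex_algebra_axioms)
sublocale \<tau>: evaluation UU \<eta> \<tau>
  by (rule evaluation_tensor[OF U.evaluation_axioms U.evaluation_axioms])
sublocale U3: tensor_product U UU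
  by (simp add: tensor_product_def U.complex_algebra_axioms U2.AB.complex_algebra_axioms)
sublocale \<tau>3: evaluation UUU \<eta> \<tau>3
  by (rule evaluation_tensor[OF U.evaluation_axioms \<tau>.evaluation_axioms])

lemmas U_axioms = U.complex_algebra_axioms
lemmas UU_axioms = U2.AB.complex_algebra_axioms

lemma \<tau>_sel [simp]:
  "\<tau> (Inl g) = pure_tensor U U (gen g) \<one>\<^bsub>U\<^esub>" "\<tau> (Inr g) = pure_tensor U U \<one>\<^bsub>U\<^esub> (gen g)"
  "\<tau>3 (Inl g) = pure_tensor U UU (gen g) \<one>\<^bsub>UU\<^esub>" "\<tau>3 (Inr x) = pure_tensor U UU \<one>\<^bsub>U\<^esub> (\<tau> x)"
  by (simp_all add: tensor_env_def)

lemma valid2: "valid_rules UU \<eta> \<tau> (tensor_rules rl rl)"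
  by (rule valid_tensor_rules[OF U.evaluation_axioms U.evaluation_axioms valid valid])

lemma valid3: "valid_rules UUU \<eta> \<tau>3 (tensor_rules rl (tensor_rules rl rl))"
  by (rule valid_tensor_rules[OF U.evaluation_axioms \<tau>.evaluation_axioms valid valid2])

lemma subst2: "\<tau>.ev (tensor_subst s s x) = \<tau> x"
  by (cases x)
    (simp_all add: tensor_subst_def subst eval_tensor_env[OF U.evaluation_axioms U.evaluation_axioms])

lemma subst3: "\<tau>3.ev (tensor_subst s (tensor_subst s s) x) = \<tau>3 x"
  by (cases x)
    (simp_all add: tensor_subst_def[of s "tensor_subst s s"] subst subst2
      eval_tensor_env[OF U.evaluation_axioms \<tau>.evaluation_axioms])

lemma equal_modD:
  "equal_mod rl (subst_expr s x) (subst_expr s y) \<Longrightarrow> U.ev x = U.ev y"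
  "equal_mod (tensor_rules rl rl) (subst_expr (tensor_subst s s) u) (subst_expr (tensor_subst s s) v)
     \<Longrightarrow> \<tau>.ev u = \<tau>.ev v"
  "equal_mod (tensor_rules rl (tensor_rules rl rl)) (subst_expr (tensor_subst s (tensor_subst s s)) u')
     (subst_expr (tensor_subst s (tensor_subst s s)) v') \<Longrightarrow> \<tau>3.ev u' = \<tau>3.ev v'"
  by (drule U.equal_mod_sound[OF valid], simp only: U.ev_subst[OF subst])
    (drule \<tau>.equal_mod_sound[OF valid2], simp only: \<tau>.ev_subst[OF subst2],
      drule \<tau>3.equal_mod_sound[OF valid3], simp only: \<tau>3.ev_subst[OF subst3])

abbreviation "copE \<equiv> \<lambda>g. tensor_sum (jordanian_coproduct hc g)"

text \<open>The restrictions make the three maps extensional, so that uniqueness is equality of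
  functions and not only agreement on the carrier.\<close>

definition "\<Delta> = restrict (presented_hom UU (\<lambda>g. \<tau>.ev (copE g))) (carrier U)"
definition "\<epsilon> = restrict (presented_hom complex_alg (\<lambda>g. coef_value \<eta> (jordanian_counit g))) (carrier U)"
definition "S = restrict (presented_hom (opposite_algebra U) (\<lambda>g. U.ev (jordanian_antipode hc g))) (carrier U)"

lemma restrict_universal:
  assumes B: "complex_algebra B" and \<sigma>: "\<And>g. \<sigma> g \<in> carrier B"
    and rel: "\<And>x l r. (x, l, r) \<in> set (jordanian_exprs hc kc) \<Longrightarrow>
      eval_expr B \<eta> \<sigma> l = eval_expr B \<eta> \<sigma> r"
  shows "restrict (presented_hom B \<sigma>) (carrier U) \<in> algebra_homs U B"
    and "restrict (presented_hom B \<sigma>) (carrier U) (gen g) = \<sigma> g"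
  using algebra_homs_cong[OF U_axioms jordanian_universal(1)[OF \<eta> hc kc assms]]
    jordanian_universal(2)[OF \<eta> hc kc assms]
  by simp_all

lemma comult: "\<Delta> \<in> algebra_homs U UU" "\<Delta> (gen g) = \<tau>.ev (copE g)"
proof -
  have rel: "eval_expr UU \<eta> (\<lambda>g. \<tau>.ev (copE g)) l = eval_expr UU \<eta> (\<lambda>g. \<tau>.ev (copE g)) r"
    if "(x, l, r) \<in> set (jordanian_exprs hc kc)" for x l r
  proof -
    have "equal_mod (tensor_rules rl rl)
        (subst_expr (\<lambda>g. subst_expr (tensor_subst s s) (copE g)) l)
        (subst_expr (\<lambda>g. subst_expr (tensor_subst s s) (copE g)) r)"
      using compatible that by (auto simp: hopf_compatible_def comult_respects_def list_all_iff Let_def)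
    from \<tau>.equal_mod_sound[OF valid2 this] show ?thesis
      by (simp add: eval_subst[of _ _ _ "\<lambda>g. subst_expr (tensor_subst s s) (copE g)"] \<tau>.ev_subst[OF subst2])
  qed
  show "\<Delta> \<in> algebra_homs U UU" "\<Delta> (gen g) = \<tau>.ev (copE g)"
    unfolding \<Delta>_def
    using restrict_universal[OF UU_axioms \<tau>.ev_closed rel] by auto
qed

lemma counit: "\<epsilon> \<in> algebra_homs U complex_alg" "\<epsilon> (gen g) = coef_value \<eta> (jordanian_counit g)"
proof -
  \<comment> \<open>The substituted expressions contain scalars but no generators, so a constant
    environment serves as a placeholder.\<close>
  interpret e: evaluation complex_alg \<eta> "\<lambda>_ :: jgen. 0"
    by (simp add: evaluation_def evaluation_axioms_def complex_algebra_complex_alg \<eta>)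
  have rel: "eval_expr complex_alg \<eta> (\<lambda>g. coef_value \<eta> (jordanian_counit g)) l
      = eval_expr complex_alg \<eta> (\<lambda>g. coef_value \<eta> (jordanian_counit g)) r"
    if "(x, l, r) \<in> set (jordanian_exprs hc kc)" for x l r
  proof -
    have *: "equal_mod (\<lambda>_ _. None)
        (subst_expr (\<lambda>g. Scal (jordanian_counit g) (1 :: jgen expr)) l)
        (subst_expr (\<lambda>g. Scal (jordanian_counit g) 1) r)"
      using compatible that by (auto simp: hopf_compatible_def counit_respects_def list_all_iff Let_def)
    have "valid_rules complex_alg \<eta> (\<lambda>_ :: jgen. 0) (\<lambda>_ _. None)"
      by (simp add: valid_rules_def)
    from e.equal_mod_sound[OF this *] show ?thesis
      by (simp add: eval_subst) (simp add: complex_alg_def)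
  qed
  have "\<And>g. coef_value \<eta> (jordanian_counit g) \<in> carrier complex_alg" by simp
  from restrict_universal[OF complex_algebra_complex_alg this rel]
  show "\<epsilon> \<in> algebra_homs U complex_alg" "\<epsilon> (gen g) = coef_value \<eta> (jordanian_counit g)"
    unfolding \<epsilon>_def by auto
qed

lemma antipode: "S \<in> algebra_homs U (opposite_algebra U)" "S (gen g) = U.ev (jordanian_antipode hc g)"
proof -
  let ?\<sigma> = "\<lambda>g. U.ev (jordanian_antipode hc g)"
  have rel: "eval_expr (opposite_algebra U) \<eta> ?\<sigma> l = eval_expr (opposite_algebra U) \<eta> ?\<sigma> r"
    if "(x, l, r) \<in> set (jordanian_exprs hc kc)" for x l r
  proof -
    have "equal_mod rl
        (subst_expr (\<lambda>g. subst_expr s (jordanian_antipode hc g)) (reverse_expr l))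
        (subst_expr (\<lambda>g. subst_expr s (jordanian_antipode hc g)) (reverse_expr r))"
      using compatible that by (auto simp: hopf_compatible_def antipode_respects_def list_all_iff Let_def)
    from U.equal_mod_sound[OF valid this] show ?thesis
      by (simp add: eval_reverse eval_subst[of _ _ _ "\<lambda>g. subst_expr s (jordanian_antipode hc g)"]
          U.ev_subst[OF subst])
  qed
  have "\<And>g. ?\<sigma> g \<in> carrier (opposite_algebra U)" by simp
  from restrict_universal[OF complex_algebra_opposite[OF U_axioms] this rel]
  show "S \<in> algebra_homs U (opposite_algebra U)" "S (gen g) = ?\<sigma> g"
    unfolding S_def by auto
qed

section \<open>The Hopf axioms on generators\<close>

lemma ev_tensor_sum:
  "\<tau>.ev (tensor_sum ps) = foldr (\<lambda>(x, y) t. pure_tensor U U (U.ev x) (U.ev y) \<oplus>\<^bsub>UU\<^esub> t) ps \<zero>\<^bsub>UU\<^esub>"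
  unfolding tensor_sum_def
  by (induction ps)
    (simp_all add: case_prod_beta eval_tensor_env[OF U.evaluation_axioms U.evaluation_axioms] U2.pure_mult)

text \<open>Applied with \<open>S\<close> and the identity as \<open>F\<close> and \<open>G\<close>,
  in either order; \<open>F'\<close> and \<open>G'\<close> are their symbolic counterparts, so that
  each antipode law becomes an identity of expressions.\<close>

lemma linear_tensor_sum:
  assumes f: "f \<in> linear_maps UU U"
    and pure: "\<And>a b. \<lbrakk>a \<in> carrier U; b \<in> carrier U\<rbrakk> \<Longrightarrow> f (pure_tensor U U a b) = F a \<otimes>\<^bsub>U\<^esub> G b"
    and F: "\<And>x. F (U.ev x) = U.ev (F' x)" and G: "\<And>y. G (U.ev y) = U.ev (G' y)"
  shows "f (\<tau>.ev (tensor_sum ps)) = U.ev (foldr (\<lambda>(x, y) e. F' x * G' y + e) ps 0)"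
proof -
  have closed: "\<tau>.ev (tensor_sum ps) \<in> carrier UU" for ps by simp
  show ?thesis
    unfolding ev_tensor_sum
  proof (induction ps)
    case Nil
    show ?case by (simp add: linear_maps_zero[OF UU_axioms U_axioms f])
  next
    case (Cons p ps)
    then show ?case
      using closed[of ps]
      by (cases p) (simp add: linear_maps_add[OF f] pure F G ev_tensor_sum)
  qed
qed

lemma S_ev: "S (U.ev e) = U.ev (subst_expr (jordanian_antipode hc) (reverse_expr e))"
  using eval_hom[OF U_axioms antipode(1), of gen \<eta> e]
  by (simp add: eval_reverse eval_subst antipode(2))

lemma antipode_gen:
  "tensor_lift U (\<lambda>a b. S a \<otimes>\<^bsub>U\<^esub> b) (\<Delta> (gen g)) = \<epsilon> (gen g) \<odot>\<^bsub>U\<^esub> \<one>\<^bsub>U\<^esub>"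
  "tensor_lift U (\<lambda>a b. a \<otimes>\<^bsub>U\<^esub> S b) (\<Delta> (gen g)) = \<epsilon> (gen g) \<odot>\<^bsub>U\<^esub> \<one>\<^bsub>U\<^esub>"
proof -
  let ?S = "\<lambda>e. subst_expr (jordanian_antipode hc) (reverse_expr e)" and ?ps = "jordanian_coproduct hc g"
  have "g \<in> set jgens" by (cases g) (simp_all add: jgens_def)
  then have *: "equal_mod rl (subst_expr s (foldr (\<lambda>(x, y) e. ?S x * y + e) ?ps 0))
      (subst_expr s (Scal (jordanian_counit g) One))"
    "equal_mod rl (subst_expr s (foldr (\<lambda>(x, y) e. x * ?S y + e) ?ps 0))
      (subst_expr s (Scal (jordanian_counit g) One))"
    using compatible by (auto simp: hopf_compatible_def antipodal_def list_all_iff Let_def one_expr_def)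
  note S = antipode_linear[OF U_axioms comult(1) counit(1) antipode(1)]
  note conv = convL_linear[OF U_axioms comult(1) counit(1) antipode(1)]
    convR_linear[OF U_axioms comult(1) counit(1) antipode(1)]
    convL_pure[OF U_axioms comult(1) counit(1) antipode(1)]
    convR_pure[OF U_axioms comult(1) counit(1) antipode(1)]
  show "tensor_lift U (\<lambda>a b. S a \<otimes>\<^bsub>U\<^esub> b) (\<Delta> (gen g)) = \<epsilon> (gen g) \<odot>\<^bsub>U\<^esub> \<one>\<^bsub>U\<^esub>"
    using linear_tensor_sum[where G = "\<lambda>y. y" and G' = "\<lambda>y. y", OF conv(1,3) S_ev refl, of ?ps] equal_modD(1)[OF *(1)]
    by (simp add: comult(2) counit(2))
  show "tensor_lift U (\<lambda>a b. a \<otimes>\<^bsub>U\<^esub> S b) (\<Delta> (gen g)) = \<epsilon> (gen g) \<odot>\<^bsub>U\<^esub> \<one>\<^bsub>U\<^esub>"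
    using linear_tensor_sum[where F = "\<lambda>y. y" and F' = "\<lambda>y. y", OF conv(2,4) refl S_ev, of ?ps] equal_modD(1)[OF *(2)]
    by (simp add: comult(2) counit(2))
qed

lemma counit_gen:
  "tensor_lift U (\<lambda>a b. \<epsilon> a \<odot>\<^bsub>U\<^esub> b) (\<Delta> (gen g)) = gen g"
  "tensor_lift U (\<lambda>a b. \<epsilon> b \<odot>\<^bsub>U\<^esub> a) (\<Delta> (gen g)) = gen g"
proof -
  let ?\<epsilon> = "\<lambda>g. Scal (jordanian_counit g) One"
  have "g \<in> set jgens" by (cases g) (simp_all add: jgens_def)
  then have *: "equal_mod rl (subst_expr s (subst_expr (case_sum ?\<epsilon> Gen) (copE g))) (subst_expr s (Gen g))"
    "equal_mod rl (subst_expr s (subst_expr (case_sum Gen ?\<epsilon>) (copE g))) (subst_expr s (Gen g))"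
    using compatible by (auto simp: hopf_compatible_def counital_def list_all_iff Let_def)
  note lin = algebra_homs_linear[OF counit(1)]
  note homs = U.counit_homs[OF counit(1)]
  note pure = U2.tensor_lift_pure[OF U_axioms U.smult_bilinear(1)[OF lin]]
    U2.tensor_lift_pure[OF U_axioms U.smult_bilinear(2)[OF lin]]
  have one: "\<epsilon> \<one>\<^bsub>U\<^esub> = 1"
    using algebra_homs_one[OF counit(1)] by (simp add: complex_alg_def)
  have "tensor_lift U (\<lambda>a b. \<epsilon> a \<odot>\<^bsub>U\<^esub> b) (\<tau> x) = U.ev (case_sum ?\<epsilon> Gen x)" for x
    by (cases x) (simp_all add: pure one counit(2))
  then show "tensor_lift U (\<lambda>a b. \<epsilon> a \<odot>\<^bsub>U\<^esub> b) (\<Delta> (gen g)) = gen g"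
    using equal_modD(1)[OF *(1)] by (simp add: comult(2) eval_hom[OF UU_axioms homs(1)] eval_subst)
  have "tensor_lift U (\<lambda>a b. \<epsilon> b \<odot>\<^bsub>U\<^esub> a) (\<tau> x) = U.ev (case_sum Gen ?\<epsilon> x)" for x
    by (cases x) (simp_all add: pure one counit(2))
  then show "tensor_lift U (\<lambda>a b. \<epsilon> b \<odot>\<^bsub>U\<^esub> a) (\<Delta> (gen g)) = gen g"
    using equal_modD(1)[OF *(2)] by (simp add: comult(2) eval_hom[OF UU_axioms homs(2)] eval_subst)
qed

lemma coassoc_gen:
  "tensor_assoc U (tensor_map UU U \<Delta> (\<lambda>b. b) (\<Delta> (gen g))) = tensor_map U UU (\<lambda>a. a) \<Delta> (\<Delta> (gen g))"
proof -
  let ?left = "case_sum (\<lambda>g. subst_expr (case_sum (\<lambda>a. Gen (Inl a)) (\<lambda>a. Gen (Inr (Inl a)))) (copE g))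
    (\<lambda>g. Gen (Inr (Inr g)))"
  let ?right = "case_sum (\<lambda>g. Gen (Inl g)) (\<lambda>g. rename_expr Inr (copE g))"
  interpret U3': tensor_product UU U
    by (simp add: tensor_product_def U_axioms UU_axioms)
  have "g \<in> set jgens" by (cases g) (simp_all add: jgens_def)
  then have *: "equal_mod (tensor_rules rl (tensor_rules rl rl))
      (subst_expr (tensor_subst s (tensor_subst s s)) (subst_expr ?left (copE g)))
      (subst_expr (tensor_subst s (tensor_subst s s)) (subst_expr ?right (copE g)))"
    using compatible by (auto simp: hopf_compatible_def coassociative_def list_all_iff Let_def)
  note lin = algebra_homs_linear[OF comult(1)]
  note hom1 = algebra_homs_compose[OF tensor_map_hom[OF U_axioms U_axioms UU_axioms U_axioms comult(1)
        algebra_homs_id] U.tensor_assoc_hom]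
  note hom2 = tensor_map_hom[OF U_axioms U_axioms U_axioms UU_axioms algebra_homs_id comult(1)]
  note pure1 = tensor_map_pure[OF U_axioms U_axioms UU_axioms U_axioms lin linear_maps_id]
  note pure2 = tensor_map_pure[OF U_axioms U_axioms U_axioms UU_axioms linear_maps_id lin]
  note hom3 = algebra_homs_compose[OF U3'.pure_homs(1) U.tensor_assoc_hom]
  \<comment> \<open>Both sides of the law are homomorphisms into the triple tensor product, so they
    are computed on the generators \<open>\<tau> x\<close>. This first step describes how
    associativity moves the elements of the first two factors.\<close>
  have "tensor_assoc U (pure_tensor UU U (\<tau> x) \<one>\<^bsub>U\<^esub>)
      = \<tau>3.ev (case_sum (\<lambda>a. Gen (Inl a)) (\<lambda>a. Gen (Inr (Inl a))) x)" for x
    by (cases x) (simp_all add: U.tensor_assoc_pure U2.pure_one)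
  then have "tensor_assoc U (pure_tensor UU U (\<tau>.ev e) \<one>\<^bsub>U\<^esub>)
      = \<tau>3.ev (subst_expr (case_sum (\<lambda>a. Gen (Inl a)) (\<lambda>a. Gen (Inr (Inl a)))) e)" for e
    using eval_hom[OF UU_axioms hom3, of \<tau> \<eta> e] by (simp add: eval_subst)
  then have "tensor_assoc U (tensor_map UU U \<Delta> (\<lambda>b. b) (\<tau> x)) = \<tau>3.ev (?left x)" for x
    by (cases x)
      (simp_all add: pure1 comult(2) algebra_homs_one[OF comult(1)] U2.pure_one U.tensor_assoc_pure)
  then have 1: "tensor_assoc U (tensor_map UU U \<Delta> (\<lambda>b. b) (\<Delta> (gen g))) = \<tau>3.ev (subst_expr ?left (copE g))"
    by (simp add: comult(2) eval_hom[OF UU_axioms hom1] eval_subst[of _ _ _ ?left])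
  have "tensor_map U UU (\<lambda>a. a) \<Delta> (\<tau> x) = \<tau>3.ev (?right x)" for x
    by (cases x)
      (simp_all add: pure2 comult(2) algebra_homs_one[OF comult(1)]
        eval_tensor_env[OF U.evaluation_axioms \<tau>.evaluation_axioms])
  then have 2: "tensor_map U UU (\<lambda>a. a) \<Delta> (\<Delta> (gen g)) = \<tau>3.ev (subst_expr ?right (copE g))"
    by (simp add: comult(2) eval_hom[OF UU_axioms hom2] eval_subst[of _ _ _ ?right])
  show ?thesis using equal_modD(3)[OF *] 1 2 by simp
qed

theorem hopf: "hopf_algebra U \<Delta> \<epsilon> S"
  by (rule hopf_algebra_presentedI[of _ "jordanian_presentation h \<kappa>",
        folded jordanian_algebra_def jordanian_gen_def,
        OF comult(1) counit(1) antipode(1) coassoc_gen counit_gen antipode_gen])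

section \<open>Values on generators and uniqueness\<close>

lemma extensional: "\<Delta> \<in> extensional (carrier U)" "\<epsilon> \<in> extensional (carrier U)" "S \<in> extensional (carrier U)"
  by (simp_all add: \<Delta>_def \<epsilon>_def S_def)

abbreviation tensor_UU (infixl \<open>\<boxdot>\<close> 67) where "x \<boxdot> y \<equiv> pure_tensor U U x y"

lemmas pure_smult =
  linear_maps_smult[OF bilinear_maps_linear(1)[OF U2.pure_bilinear]]
  linear_maps_smult[OF bilinear_maps_linear(2)[OF U2.pure_bilinear]]

lemma coef_values [simp]:
  "coef_value \<eta> hc = h" "coef_value \<eta> (coef_mult c hc) = coef_value \<eta> c * h"
  by (simp_all add: hc coef_value_mult[OF \<eta>])

lemma comult_values:
  "\<Delta> (gen gE1) = gen gE1 \<boxdot> \<one>\<^bsub>U\<^esub> \<oplus>\<^bsub>UU\<^esub> gen gT \<boxdot> gen gE1"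
  "\<Delta> (gen gE2) = gen gE2 \<boxdot> \<one>\<^bsub>U\<^esub> \<oplus>\<^bsub>UU\<^esub> gen gT \<boxdot> gen gE2"
  "\<Delta> (gen gT) = gen gT \<boxdot> gen gT"
  "\<Delta> (gen gT') = gen gT' \<boxdot> gen gT'"
  "\<Delta> (gen gF1) = gen gF1 \<boxdot> \<one>\<^bsub>U\<^esub> \<oplus>\<^bsub>UU\<^esub> gen gT' \<boxdot> gen gF1 \<oplus>\<^bsub>UU\<^esub> h \<odot>\<^bsub>UU\<^esub> (gen gH3 \<boxdot> gen gE2)"
  "\<Delta> (gen gF2) = gen gF2 \<boxdot> \<one>\<^bsub>U\<^esub> \<oplus>\<^bsub>UU\<^esub> gen gT' \<boxdot> gen gF2 \<ominus>\<^bsub>UU\<^esub> h \<odot>\<^bsub>UU\<^esub> (gen gH3 \<boxdot> gen gE1)"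
  "\<Delta> (gen gF3) = gen gF3 \<boxdot> gen gT \<oplus>\<^bsub>UU\<^esub> gen gT' \<boxdot> gen gF3"
  "g \<in> {gH1, gH2} \<Longrightarrow> \<Delta> (gen g) = gen g \<boxdot> \<one>\<^bsub>U\<^esub> \<oplus>\<^bsub>UU\<^esub> \<one>\<^bsub>U\<^esub> \<boxdot> gen g \<ominus>\<^bsub>UU\<^esub>
     (1/2) \<odot>\<^bsub>UU\<^esub> ((\<one>\<^bsub>U\<^esub> \<ominus>\<^bsub>U\<^esub> gen gT' \<otimes>\<^bsub>U\<^esub> gen gT') \<boxdot> (gen gT' \<otimes>\<^bsub>U\<^esub> gen gH3))"
  "\<Delta> (gen gH3) = gen gH3 \<boxdot> gen gT \<oplus>\<^bsub>UU\<^esub> gen gT' \<boxdot> gen gH3"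
  by (auto simp: comult(2) ev_tensor_sum pure_smult U2.AB.a_assoc U2.AB.minus_eq U2.AB.smult_minus)

lemma antipode_values:
  "S (gen gE1) = \<ominus>\<^bsub>U\<^esub> (gen gT' \<otimes>\<^bsub>U\<^esub> gen gE1)"
  "S (gen gE2) = \<ominus>\<^bsub>U\<^esub> (gen gT' \<otimes>\<^bsub>U\<^esub> gen gE2)"
  "S (gen gT) = gen gT'"
  "S (gen gT') = gen gT"
  "S (gen gF1) = \<ominus>\<^bsub>U\<^esub> (gen gT \<otimes>\<^bsub>U\<^esub> gen gF1) \<oplus>\<^bsub>U\<^esub>
     h \<odot>\<^bsub>U\<^esub> (gen gT \<otimes>\<^bsub>U\<^esub> gen gH3 \<otimes>\<^bsub>U\<^esub> gen gT' \<otimes>\<^bsub>U\<^esub> gen gE2)"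
  "S (gen gF2) = \<ominus>\<^bsub>U\<^esub> (gen gT \<otimes>\<^bsub>U\<^esub> gen gF2) \<ominus>\<^bsub>U\<^esub>
     h \<odot>\<^bsub>U\<^esub> (gen gT \<otimes>\<^bsub>U\<^esub> gen gH3 \<otimes>\<^bsub>U\<^esub> gen gT' \<otimes>\<^bsub>U\<^esub> gen gE1)"
  "S (gen gF3) = \<ominus>\<^bsub>U\<^esub> (gen gT \<otimes>\<^bsub>U\<^esub> gen gF3 \<otimes>\<^bsub>U\<^esub> gen gT')"
  "g \<in> {gH1, gH2} \<Longrightarrow> S (gen g) = \<ominus>\<^bsub>U\<^esub> gen g \<ominus>\<^bsub>U\<^esub>
     (1/2) \<odot>\<^bsub>U\<^esub> ((gen gT \<ominus>\<^bsub>U\<^esub> gen gT') \<otimes>\<^bsub>U\<^esub> gen gH3)"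
  "S (gen gH3) = \<ominus>\<^bsub>U\<^esub> (gen gT \<otimes>\<^bsub>U\<^esub> gen gH3 \<otimes>\<^bsub>U\<^esub> gen gT')"
  by (auto simp: antipode(2))

lemma alternative_values:
  "h \<odot>\<^bsub>UU\<^esub> (gen gH3 \<boxdot> gen gE2) =
     (gen gT \<otimes>\<^bsub>U\<^esub> (gen gH1 \<oplus>\<^bsub>U\<^esub> gen gH2)) \<boxdot> (gen gT' \<otimes>\<^bsub>U\<^esub> \<lbrakk>gen gF1, gen gT\<rbrakk>\<^bsub>U\<^esub>)" (is ?a1)
  "\<ominus>\<^bsub>UU\<^esub> (h \<odot>\<^bsub>UU\<^esub> (gen gH3 \<boxdot> gen gE1)) =
     (gen gT \<otimes>\<^bsub>U\<^esub> (gen gH1 \<oplus>\<^bsub>U\<^esub> gen gH2)) \<boxdot> (gen gT' \<otimes>\<^bsub>U\<^esub> \<lbrakk>gen gF2, gen gT\<rbrakk>\<^bsub>U\<^esub>)" (is ?a2)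
  "(\<one>\<^bsub>U\<^esub> \<ominus>\<^bsub>U\<^esub> gen gT' \<otimes>\<^bsub>U\<^esub> gen gT') \<boxdot> (gen gT' \<otimes>\<^bsub>U\<^esub> gen gH3) =
     (\<one>\<^bsub>U\<^esub> \<ominus>\<^bsub>U\<^esub> gen gT' \<otimes>\<^bsub>U\<^esub> gen gT') \<boxdot> (gen gH1 \<oplus>\<^bsub>U\<^esub> gen gH2)" (is ?a3)
  "h \<odot>\<^bsub>U\<^esub> (gen gT \<otimes>\<^bsub>U\<^esub> gen gH3 \<otimes>\<^bsub>U\<^esub> gen gT' \<otimes>\<^bsub>U\<^esub> gen gE2) =
     gen gT \<otimes>\<^bsub>U\<^esub> gen gT \<otimes>\<^bsub>U\<^esub> (gen gH1 \<oplus>\<^bsub>U\<^esub> gen gH2) \<otimes>\<^bsub>U\<^esub> (gen gT' \<otimes>\<^bsub>U\<^esub> gen gT') \<otimes>\<^bsub>U\<^esub> \<lbrakk>gen gF1, gen gT\<rbrakk>\<^bsub>U\<^esub>" (is ?a4)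
  "\<ominus>\<^bsub>U\<^esub> (h \<odot>\<^bsub>U\<^esub> (gen gT \<otimes>\<^bsub>U\<^esub> gen gH3 \<otimes>\<^bsub>U\<^esub> gen gT' \<otimes>\<^bsub>U\<^esub> gen gE1)) =
     gen gT \<otimes>\<^bsub>U\<^esub> gen gT \<otimes>\<^bsub>U\<^esub> (gen gH1 \<oplus>\<^bsub>U\<^esub> gen gH2) \<otimes>\<^bsub>U\<^esub> (gen gT' \<otimes>\<^bsub>U\<^esub> gen gT') \<otimes>\<^bsub>U\<^esub> \<lbrakk>gen gF2, gen gT\<rbrakk>\<^bsub>U\<^esub>" (is ?a5)
  "(gen gT \<ominus>\<^bsub>U\<^esub> gen gT') \<otimes>\<^bsub>U\<^esub> gen gH3 =
     (gen gT \<otimes>\<^bsub>U\<^esub> gen gT \<ominus>\<^bsub>U\<^esub> \<one>\<^bsub>U\<^esub>) \<otimes>\<^bsub>U\<^esub> (gen gH1 \<oplus>\<^bsub>U\<^esub> gen gH2)" (is ?a6)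
proof -
  have "alternative_forms s rl hc"
    using compatible by (simp add: hopf_compatible_def)
  note alt = this[unfolded alternative_forms_def Let_def]
  note eqs = alt[THEN conjunct1, THEN equal_modD(2)]
    alt[THEN conjunct2, THEN conjunct1, THEN equal_modD(2)]
    alt[THEN conjunct2, THEN conjunct2, THEN conjunct1, THEN equal_modD(2)]
    alt[THEN conjunct2, THEN conjunct2, THEN conjunct2, THEN conjunct1, THEN equal_modD(1)]
    alt[THEN conjunct2, THEN conjunct2, THEN conjunct2, THEN conjunct2, THEN conjunct1, THEN equal_modD(1)]
    alt[THEN conjunct2, THEN conjunct2, THEN conjunct2, THEN conjunct2, THEN conjunct2, THEN equal_modD(1)]
  show ?a1 ?a2 ?a3
    using eqs(1-3) by (simp_all add: ev_tensor_sum pure_smult U2.AB.smult_minus commutator_def)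
  show ?a4 ?a5 ?a6
    using eqs(4-6) by (simp_all add: commutator_def)
qed

lemma counit_values:
  "\<epsilon> (gen gT) = 1" "\<epsilon> (gen gT') = 1" "\<epsilon> (gen gH1) = 0" "\<epsilon> (gen gH2) = 0" "\<epsilon> (gen gH3) = 0"
  "\<epsilon> (gen gE1) = 0" "\<epsilon> (gen gE2) = 0" "\<epsilon> (gen gF1) = 0" "\<epsilon> (gen gF2) = 0" "\<epsilon> (gen gF3) = 0"
  by (simp_all add: counit(2))

lemma hopf_unique:
  assumes H: "hopf_algebra U \<Delta>' \<epsilon>' S'"
    and "\<Delta>' \<in> extensional (carrier U)" "\<epsilon>' \<in> extensional (carrier U)" "S' \<in> extensional (carrier U)"
    and "\<And>g. \<Delta>' (gen g) = \<Delta> (gen g)" "\<And>g. \<epsilon>' (gen g) = \<epsilon> (gen g)"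
  shows "\<Delta>' = \<Delta>" "\<epsilon>' = \<epsilon>" "S' = S"
proof -
  note homs_eq = algebra_homs_presented_eq[of _ "jordanian_presentation h \<kappa>",
      folded jordanian_algebra_def jordanian_gen_def]
  show D: "\<Delta>' = \<Delta>"
    by (rule extensionalityI[OF assms(2) extensional(1)])
      (rule homs_eq[OF hopf_algebra.comult_hom[OF H] comult(1) assms(5)])
  show E: "\<epsilon>' = \<epsilon>"
    by (rule extensionalityI[OF assms(3) extensional(2)])
      (rule homs_eq[OF hopf_algebra.counit_hom[OF H] counit(1) assms(6)])
  show "S' = S"
    by (rule extensionalityI[OF assms(4) extensional(3)])
      (rule antipode_unique[OF H[unfolded D E] hopf])
qed

end

subsection \<open>The three cases\<close>

lemma (in evaluation) valid_row_rules:
  fixes \<rho>' :: "jgen \<Rightarrow> 'a"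
  assumes "\<And>g. \<rho>' g \<in> carrier A" "evaluation.valid_table A \<eta> \<rho>' (row_table rows)"
  shows "valid_rules A \<eta> \<rho>' (row_rules rows)"
proof -
  interpret \<rho>': evaluation A \<eta> \<rho>' using \<eta> assms(1) by unfold_locales
  have "((a, b), p) \<in> set (row_table rows)" if "map_of (rows a) b = Some p" for a b p
  proof -
    have "a \<in> set jgens" by (cases a) (simp_all add: jgens_def)
    moreover have "(b, p) \<in> set (rows a)" using that by (rule map_of_SomeD)
    ultimately show ?thesis by (force simp: row_table_def)
  qed
  then show ?thesis
    using assms(2) by (force simp: valid_rules_def row_rules_def \<rho>'.valid_table_def)
qed

lemma jordanian_expr_sel:
  assumes "(h, k) = ((0, 0, 0), (0, 0, 0)) \<or> (h, k) = ((1, 0, 1), (1, 0, 1))"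
  shows "jordanian_expr h k (gT, gT') = (Gen gT * Gen gT', 1)"
    and "jordanian_expr h k (gE1, gE2) =
      (Scal (coef_mult (2, 0, 0) h) (commutator_expr (Gen gE1) (Gen gE2)), Gen gT * Gen gT - 1)"
  using assms unfolding prod.inject by (elim disjE conjE; simp only:; code_simp)+

lemma jordanian_case_zero: "jordanian_case 0 0 1 (0, 0, 0) (0, 0, 0) zero_subst (row_rules zero_rows)"
proof -
  let ?U = "jordanian_algebra 0 0" and ?g = "jordanian_gen 0 0"
  interpret evaluation ?U 1 ?g by (rule evaluation_jordanian) simp
  have v: "coef_value 1 (0, 0, 0) = 0" by simp
  note rel = jordanian_expr_relation[OF one_neq_zero v v]
  \<comment> \<open>At \<open>h = 0\<close> the left side \<open>2h [E1,E2]\<close>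
    vanishes.\<close>
  have TT: "?g gT \<otimes>\<^bsub>?U\<^esub> ?g gT = \<one>\<^bsub>?U\<^esub>"
    using rel[of "(gE1, gE2)"] by (simp add: jordanian_expr_sel diff_eq_zero)
  have TT': "?g gT \<otimes>\<^bsub>?U\<^esub> ?g gT' = \<one>\<^bsub>?U\<^esub>"
    using rel[of "(gT, gT')"] by (simp add: jordanian_expr_sel)
  \<comment> \<open>Evaluates \<open>T T T'\<close> in two ways.\<close>
  have "?g gT' = ?g gT"
    using m_assoc[of "?g gT" "?g gT" "?g gT'"] by (simp add: TT TT')
  then have s: "ev (zero_subst g) = ?g g" for g
    by (simp add: zero_subst_def)
  have "valid_table (row_table zero_rows)"
    by (rule derivable_sound[OF s jordanian_expr_relation[OF one_neq_zero v v] zero_table])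
      (simp add: valid_table_def)
  then have "valid_rules ?U 1 ?g (row_rules zero_rows)"
    by (intro valid_row_rules) simp_all
  then show ?thesis
    by (intro jordanian_case.intro hopf_compatible_zero v s) simp_all
qed

context
  fixes h \<kappa> :: complex and kc :: coef
  assumes h: "h \<noteq> 0" and kc: "coef_value h kc = \<kappa>" and kc_cases: "kc = (1, 1, 1) \<or> kc = (1, 0, 1)"
begin

interpretation evaluation "jordanian_algebra h \<kappa>" h "jordanian_gen h \<kappa>"
  by (rule evaluation_jordanian[OF h])

lemma hc: "coef_value h (1, 0, 1) = h"
  by simp

lemmas relation = jordanian_expr_relation[OF h hc kc]

lemma ev_relator [simp]: "ev (relator (1, 0, 1) kc a b) = \<zero>\<^bsub>jordanian_algebra h \<kappa>\<^esub>"
  using relation[of "(a, b)"] by (auto simp: relator_def minus_eq r_neg split: prod.split)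

lemma valid_table_Nil: "valid_table []"
  by (simp add: valid_table_def)

lemma valid_before_H3: "valid_table (filter before_H3 (row_table generic_rows))"
proof -
  have "derivable Gen (jordanian_expr (1, 0, 1) kc) generic_cert [] (filter before_H3 (row_table generic_rows))"
    using kc_cases by (elim disjE) (simp_all only: generic_table)
  then show ?thesis
    by (intro derivable_sound[OF _ relation _ valid_table_Nil]) simp_all
qed

lemma generic_subst: "ev (generic_subst g) = jordanian_gen h \<kappa> g"
proof -
  let ?X = "Gen gT * (Gen gH1 + Gen gH2) :: jgen expr"
  \<comment> \<open>The certificate writes the difference as a combination of relators, and these
    have value zero.\<close>
  have "ev (Gen gH3 - ?X) = \<zero>\<^bsub>jordanian_algebra h \<kappa>\<^esub>"
    unfolding equal_mod_sound[OF valid_rules_of[OF valid_before_H3] H3_certificate[OF kc_cases]]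
    by (simp add: minus_eq)
  then have "ev (Gen gH3) = ev ?X"
    by (simp add: diff_eq_zero)
  then show ?thesis
    by (simp add: generic_subst_def)
qed

end

lemma jordanian_case_generic:
  assumes "h \<noteq> 0"
  shows "jordanian_case h (h / 2) h (1, 0, 1) (1, 1, 1) generic_subst (row_rules generic_rows)"
proof -
  let ?U = "jordanian_algebra h (h / 2)" and ?g = "jordanian_gen h (h / 2)"
  interpret evaluation ?U h ?g by (rule evaluation_jordanian[OF assms])
  have k: "coef_value h (1, 1, 1) = h / 2" by simp
  note hk = assms k disjI1[OF refl]
  note s = generic_subst[OF hk]
  have "valid_table (filter without_H3 (row_table generic_rows))"
    by (rule derivable_sound[OF s relation[OF hk] generic_table(3) valid_table_Nil[OF hk]])
  then have "valid_table (row_table generic_rows)"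
    using valid_before_H3[OF hk] generic_rows_cases unfolding valid_table_def list_all_iff by fastforce
  then have "valid_rules ?U h ?g (row_rules generic_rows)"
    by (intro valid_row_rules) simp_all
  then show ?thesis
    by (intro jordanian_case.intro hopf_compatible_generic k s assms) simp_all
qed

lemma jordanian_case_collapsed:
  assumes "h \<noteq> 0"
  shows "jordanian_case h h h (1, 0, 1) (1, 0, 1) collapsed_subst (row_rules collapsed_rows)"
proof -
  let ?U = "jordanian_algebra h h" and ?g = "jordanian_gen h h"
  interpret evaluation ?U h ?g by (rule evaluation_jordanian[OF assms])
  have k: "coef_value h (1, 0, 1) = h" by simp
  note hk = assms k disjI2[OF refl]
  note s = generic_subst[OF hk]
  note [simp] = ev_relator[OF hk] ev_subst[OF s]
  have "valid_table (filter before_F3F (row_table generic_rows))"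
    by (rule derivable_sound[OF s relation[OF hk] generic_table(4) valid_table_Nil[OF hk]])
  note E = E_certificate[THEN equal_mod_sound[OF valid_rules_of[OF this]]]
  \<comment> \<open>The certificates express \<open>E1\<close> and \<open>E2\<close> by commutators
    of \<open>T\<close> with relators, which are zero.\<close>
  have E0: "?g gE1 = \<zero>\<^bsub>?U\<^esub>" "?g gE2 = \<zero>\<^bsub>?U\<^esub>"
    unfolding E[unfolded eval_expr.simps(1)] by (simp_all add: minus_eq)
  note rel = jordanian_expr_relation[OF assms k k]
  have TT: "?g gT \<otimes>\<^bsub>?U\<^esub> ?g gT = \<one>\<^bsub>?U\<^esub>"
    using rel[of "(gE1, gE2)"] by (simp add: jordanian_expr_sel E0 diff_eq_zero minus_eq[of _ "\<zero>\<^bsub>?U\<^esub>"])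
  have TT': "?g gT \<otimes>\<^bsub>?U\<^esub> ?g gT' = \<one>\<^bsub>?U\<^esub>"
    using rel[of "(gT, gT')"] by (simp add: jordanian_expr_sel)
  have T': "?g gT' = ?g gT"
    using m_assoc[of "?g gT" "?g gT" "?g gT'"] by (simp add: TT TT')
  have valid: "valid_rules ?U h ?g (row_rules collapsed_rows)"
    by (auto simp: valid_rules_def row_rules_def collapsed_rows_def TT split: if_splits)
  note certs = collapse_certs[THEN equal_mod_sound[OF valid]]
  \<comment> \<open>Replacing generators already known to vanish by 0 preserves values, so each
    certificate may build on the vanishing shown before it.\<close>
  have zero: "ev (partial_subst zs g) = ?g g" if "\<And>z. z \<in> set zs \<Longrightarrow> ?g z = \<zero>\<^bsub>?U\<^esub>" for zs g
    using that by (auto simp: partial_subst_def T')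
  have sub: "ev (subst_expr (partial_subst zs) e) = ev e"
    if "\<And>z. z \<in> set zs \<Longrightarrow> ?g z = \<zero>\<^bsub>?U\<^esub>" for zs e
    by (rule ev_subst) (rule zero[OF that])
  have H0: "?g gH1 = \<zero>\<^bsub>?U\<^esub>" "?g gH2 = \<zero>\<^bsub>?U\<^esub>"
    unfolding certs(1,2)[unfolded eval_expr.simps(1)]
    by (subst sub; auto simp: E0)+
  \<comment> \<open>From \<open>H3 = T (H1 + H2)\<close>, which holds for both values of
    \<open>\<kappa>\<close>.\<close>
  have H30: "?g gH3 = \<zero>\<^bsub>?U\<^esub>"
    using s[of gH3] by (simp add: generic_subst_def H0)
  have F0: "?g gF1 = \<zero>\<^bsub>?U\<^esub>" "?g gF2 = \<zero>\<^bsub>?U\<^esub>"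
    unfolding certs(3,4)[unfolded eval_expr.simps(1)]
    by (subst sub; auto simp: E0 H0 H30)+
  have F30: "?g gF3 = \<zero>\<^bsub>?U\<^esub>"
    unfolding certs(5)[unfolded eval_expr.simps(1)]
    by (subst sub; auto simp: E0 H0 H30 F0)
  have s: "ev (collapsed_subst g) = ?g g" for g
    by (cases g) (simp_all add: collapsed_subst_def T' E0 H0 H30 F0 F30)
  show ?thesis
    by (intro jordanian_case.intro hopf_compatible_collapsed k s valid assms)
qed

theorem proposition3:
  fixes h \<kappa> :: complex
    and U :: "(complex, (jgen list \<Rightarrow>\<^sub>0 complex) set) module" (structure)
  assumes "\<kappa> = h \<or> \<kappa> = h / 2"
    and "U = jordanian_algebra h \<kappa>"
    and "UU = tensor_algebra U U"
    and "H1 = jordanian_gen h \<kappa> gH1"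
    and "H2 = jordanian_gen h \<kappa> gH2"
    and "H3 = jordanian_gen h \<kappa> gH3"
    and "E1 = jordanian_gen h \<kappa> gE1"
    and "E2 = jordanian_gen h \<kappa> gE2"
    and "T = jordanian_gen h \<kappa> gT"
    and "T' = jordanian_gen h \<kappa> gT'"
    and "F1 = jordanian_gen h \<kappa> gF1"
    and "F2 = jordanian_gen h \<kappa> gF2"
    and "F3 = jordanian_gen h \<kappa> gF3"
  shows "\<exists>!(\<Delta>, \<epsilon>, S).
    \<Delta> \<in> extensional (carrier U) \<and> \<epsilon> \<in> extensional (carrier U) \<and> S \<in> extensional (carrier U) \<and>
    hopf_algebra U \<Delta> \<epsilon> S \<and>

    \<Delta> E1 = E1 \<boxtimes> \<one> \<oplus>\<^bsub>UU\<^esub> T \<boxtimes> E1 \<and>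
    \<Delta> E2 = E2 \<boxtimes> \<one> \<oplus>\<^bsub>UU\<^esub> T \<boxtimes> E2 \<and>
    \<Delta> T = T \<boxtimes> T \<and>
    \<Delta> T' = T' \<boxtimes> T' \<and>
    \<Delta> F1 = F1 \<boxtimes> \<one> \<oplus>\<^bsub>UU\<^esub> T' \<boxtimes> F1 \<oplus>\<^bsub>UU\<^esub> h \<odot>\<^bsub>UU\<^esub> (H3 \<boxtimes> E2) \<and>
    \<Delta> F1 = F1 \<boxtimes> \<one> \<oplus>\<^bsub>UU\<^esub> T' \<boxtimes> F1 \<oplus>\<^bsub>UU\<^esub> (T \<otimes> (H1 \<oplus> H2)) \<boxtimes> (T' \<otimes> \<lbrakk>F1, T\<rbrakk>) \<and>
    \<Delta> F2 = F2 \<boxtimes> \<one> \<oplus>\<^bsub>UU\<^esub> T' \<boxtimes> F2 \<ominus>\<^bsub>UU\<^esub> h \<odot>\<^bsub>UU\<^esub> (H3 \<boxtimes> E1) \<and>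
    \<Delta> F2 = F2 \<boxtimes> \<one> \<oplus>\<^bsub>UU\<^esub> T' \<boxtimes> F2 \<oplus>\<^bsub>UU\<^esub> (T \<otimes> (H1 \<oplus> H2)) \<boxtimes> (T' \<otimes> \<lbrakk>F2, T\<rbrakk>) \<and>
    \<Delta> F3 = F3 \<boxtimes> T \<oplus>\<^bsub>UU\<^esub> T' \<boxtimes> F3 \<and>
    (\<forall>H\<in>{H1, H2}.
       \<Delta> H = H \<boxtimes> \<one> \<oplus>\<^bsub>UU\<^esub> \<one> \<boxtimes> H
               \<ominus>\<^bsub>UU\<^esub> (1/2) \<odot>\<^bsub>UU\<^esub> ((\<one> \<ominus> T' \<otimes> T') \<boxtimes> (T' \<otimes> H3)) \<and>
       \<Delta> H = H \<boxtimes> \<one> \<oplus>\<^bsub>UU\<^esub> \<one> \<boxtimes> H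
               \<ominus>\<^bsub>UU\<^esub> (1/2) \<odot>\<^bsub>UU\<^esub> ((\<one> \<ominus> T' \<otimes> T') \<boxtimes> (H1 \<oplus> H2))) \<and>
    \<Delta> H3 = H3 \<boxtimes> T \<oplus>\<^bsub>UU\<^esub> T' \<boxtimes> H3 \<and>

    S E1 = \<ominus> (T' \<otimes> E1) \<and>
    S E2 = \<ominus> (T' \<otimes> E2) \<and>
    S T = T' \<and>
    S T' = T \<and>
    S F1 = \<ominus> (T \<otimes> F1) \<oplus> h \<odot> (T \<otimes> H3 \<otimes> T' \<otimes> E2) \<and>
    S F1 = \<ominus> (T \<otimes> F1) \<oplus> T \<otimes> T \<otimes> (H1 \<oplus> H2) \<otimes> (T' \<otimes> T') \<otimes> \<lbrakk>F1, T\<rbrakk> \<and>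
    S F2 = \<ominus> (T \<otimes> F2) \<ominus> h \<odot> (T \<otimes> H3 \<otimes> T' \<otimes> E1) \<and>
    S F2 = \<ominus> (T \<otimes> F2) \<oplus> T \<otimes> T \<otimes> (H1 \<oplus> H2) \<otimes> (T' \<otimes> T') \<otimes> \<lbrakk>F2, T\<rbrakk> \<and>
    S F3 = \<ominus> (T \<otimes> F3 \<otimes> T') \<and>
    (\<forall>H\<in>{H1, H2}.
       S H = \<ominus> H \<ominus> (1/2) \<odot> ((T \<ominus> T') \<otimes> H3) \<and>
       S H = \<ominus> H \<ominus> (1/2) \<odot> ((T \<otimes> T \<ominus> \<one>) \<otimes> (H1 \<oplus> H2))) \<and>
    S H3 = \<ominus> (T \<otimes> H3 \<otimes> T') \<and>

    (\<forall>a\<in>{H1, H2, H3, E1, E2, F1, F2, F3}. \<epsilon> a = 0) \<and>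
    \<epsilon> T = 1 \<and> \<epsilon> T' = 1"

proof -
  have "\<exists>\<eta> hc kc s rl. jordanian_case h \<kappa> \<eta> hc kc s rl"
  proof (cases "h = 0")
    case True
    with assms(1) have "\<kappa> = 0" by auto
    with True show ?thesis using jordanian_case_zero by blast
  next
    case False
    then show ?thesis
      using assms(1) jordanian_case_generic[OF False] jordanian_case_collapsed[OF False] by blast
  qed
  then obtain \<eta> hc kc s rl where "jordanian_case h \<kappa> \<eta> hc kc s rl" by blast
  then interpret C: jordanian_case h \<kappa> \<eta> hc kc s rl .
  note H_values = C.comult_values(8)[OF insertI1] C.comult_values(8)[OF insertI2[OF insertI1]]
    C.antipode_values(8)[OF insertI1] C.antipode_values(8)[OF insertI2[OF insertI1]]
  note gen_values = C.comult_values(1-7,9) C.antipode_values(1-7,9) H_values C.counit_values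
  \<comment> \<open>Rewrites each second form of a coproduct or antipode value into the first. The
    alternatives for \<open>F2\<close> are sums with a negated term, so \<open>minus\<close> unfolds
    subtraction, but only of multiples of \<open>h\<close>, to make the two forms match.\<close>
  note alt = C.alternative_values[symmetric]
  note minus = C.U2.AB.minus_eq[of _ "h \<odot>\<^bsub>C.UU\<^esub> t" for t] C.U.minus_eq[of _ "h \<odot>\<^bsub>C.U\<^esub> t" for t]
  show ?thesis
    unfolding assms(2-)
  proof (rule ex1I[of _ "(C.\<Delta>, C.\<epsilon>, C.S)"], goal_cases)
    case 1
    show ?case
      unfolding prod.case
      by (intro conjI C.extensional C.hopf) (simp_all only: ball_simps simp_thms gen_values minus alt)
  next
    case (2 x)
    obtain \<Delta> \<epsilon> S where x: "x = (\<Delta>, \<epsilon>, S)" by (metis surj_pair)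
    note P = 2[unfolded x prod.case ball_simps simp_thms]
    have "\<Delta> (C.gen g) = C.\<Delta> (C.gen g)" "\<epsilon> (C.gen g) = C.\<epsilon> (C.gen g)" for g
      by (cases g; simp only: P gen_values minus alt)+
    moreover have "\<Delta> \<in> extensional (carrier C.U)" "\<epsilon> \<in> extensional (carrier C.U)"
      "S \<in> extensional (carrier C.U)" "hopf_algebra C.U \<Delta> \<epsilon> S"
      by (simp_all only: P)
    ultimately show ?case
      unfolding x by (intro arg_cong2[where f = Pair] C.hopf_unique)
  qed
qed

end
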